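(* For $k\in\{3,4,6\}$, the approximation ratio of $k$-Opt for \textsc{Metric TSP} satisfies $\alpha_k(n)=\Theta(\sqrt[k]{n})$.
   Context: A \textsc{Metric TSP} instance on $n$ vertices is the complete graph $K_n$ with edge costs $c:E(K_n)\to\mathbb{R}_{\ge0}$ satisfying the triangle inequality. A tour is a Hamiltonian cycle, with length $c(T)=\sum_{e\in T}c(e)$; $\mathrm{OPT}(I)$ is the minimum tour length. A $k$-move replaces at most $k$ edges of a tour by other edges so that the result is again a tour; it is improving if the new tour is strictly shorter. A tour is $k$-optimal if no improving $k$-move exists. $\alpha_k(n)$ is the supremum of $c(T)/\mathrm{OPT}(I)$ over all \textsc{Metric TSP} instances $I$ on $n$ vertices with $\mathrm{OPT}(I)>0$ and all $k$-optimal tours $T$ of $I$. *)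

theory Defs
  imports Complex_Main "HOL-Library.Extended_Real"
begin

text \<open>Vertices of K_n are 0..n-1; edges are 2-element sets of vertices.
  Edge costs are a function on vertex sets; only its values on edges of K_n matter.\<close>

definition Kn_edges :: "nat \<Rightarrow> nat set set" where
  "Kn_edges n = {e. \<exists>x y. x < n \<and> y < n \<and> x \<noteq> y \<and> e = {x, y}}"

definition metric_instance :: "nat \<Rightarrow> (nat set \<Rightarrow> real) \<Rightarrow> bool" where
  "metric_instance n c \<longleftrightarrow>
     (\<forall>e\<in>Kn_edges n. c e \<ge> 0) \<and>
     (\<forall>x y z. x < n \<and> y < n \<and> z < n \<and> x \<noteq> y \<and> y \<noteq> z \<and> x \<noteq> z
        \<longrightarrow> c {x, z} \<le> c {x, y} + c {y, z})"

definition is_tour :: "nat \<Rightarrow> nat set set \<Rightarrow> bool" where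
  "is_tour n T \<longleftrightarrow> n \<ge> 3 \<and>
     (\<exists>p. bij_betw p {0..<n} {0..<n} \<and> T = {{p i, p ((i + 1) mod n)} | i. i < n})"

definition tour_cost :: "(nat set \<Rightarrow> real) \<Rightarrow> nat set set \<Rightarrow> real" where
  "tour_cost c T = (\<Sum>e\<in>T. c e)"

definition OPT :: "nat \<Rightarrow> (nat set \<Rightarrow> real) \<Rightarrow> real" where
  "OPT n c = Min (tour_cost c ` {T. is_tour n T})"

definition k_move :: "nat \<Rightarrow> nat \<Rightarrow> nat set set \<Rightarrow> nat set set \<Rightarrow> bool" where
  "k_move n k T T' \<longleftrightarrow> is_tour n T \<and> is_tour n T' \<and> card (T - T') \<le> k"

definition k_optimal :: "nat \<Rightarrow> nat \<Rightarrow> (nat set \<Rightarrow> real) \<Rightarrow> nat set set \<Rightarrow> bool" where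
  "k_optimal n k c T \<longleftrightarrow> is_tour n T \<and>
     \<not> (\<exists>T'. k_move n k T T' \<and> tour_cost c T' < tour_cost c T)"

text \<open>alpha_k(n), as an extended real supremum (Sup of empty set is -\<infinity>).\<close>
definition alpha :: "nat \<Rightarrow> nat \<Rightarrow> ereal" where
  "alpha k n = Sup {ereal (tour_cost c T / OPT n c) | c T.
       metric_instance n c \<and> OPT n c > 0 \<and> k_optimal n k c T}"

end

theory Submission
  imports Defs "HOL-Algebra.Algebraic_Closure_Type" "HOL-Combinatorics.Permutations"
begin

text \<open>
  Upper bound. Fix an optimal tour of length \<open>L\<close>, a \<open>k\<close>-optimal tour \<open>T\<close>, and a scale \<open>l\<close>. Cut the
  optimal tour into \<open>O(L / l)\<close> classes of cities at distance less than \<open>l / 2 k\<close>, and let an edge of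
  \<open>T\<close> of length about \<open>l\<close>, directed along \<open>T\<close>, join the class of its tail to the class of its head in
  a bipartite multigraph (two copies of the classes). If this graph contains a nonempty set of \<open>2 h\<close>
  edges with even degrees, \<open>h < k\<close>, then \<open>T\<close> can be improved: pair the tails and the heads within
  the classes and replace all \<open>2 h\<close> edges by these short connections. Each circuit that arises
  contains a tail-tail and a head-head connection, so there are at most \<open>h\<close> circuits. Putting back an
  edge that connects two circuits merges them, and as long as more than \<open>h + 1\<close> edges are removed from
  a single circuit, some connection still joins two tails or two heads, and this forces some edge
  that can be put back without splitting the circuit. In the end \<open>h + 1\<close> edges of length about \<open>l\<close>
  are removed and connections of length about \<open>(h - 1) l\<close> are added. Hence there are no such even sets,
  and by a Moore bound there are only \<open>O((L / l) powr (k / (k - 1)))\<close> edges of length about \<open>l\<close>. Summing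
  over geometric scales gives \<open>O(root k n * L)\<close>.

  Lower bound. In a graph of girth \<open>2 k\<close> let the cities travel along a closed trail that uses up all edges
  at the vertices it visits, with the graph distance capped at \<open>k\<close>. An improving \<open>k\<close>-move would give a
  nonempty even edge set with fewer than \<open>2 k\<close> edges, while visiting the cities vertex by vertex is cheap.
  For \<open>k = 3, 4, 6\<close> there are bipartite \<open>(q - 1)\<close>-regular graphs of girth \<open>2 k\<close> with at most \<open>q ^ k\<close> edges,
  namely parts of the incidence graphs of the generalized polygons over a field with \<open>q\<close> elements.
\<close>

text \<open>An even set may have as many as \<open>2 * (k - 1)\<close> edges while a move may drop
  only \<open>k\<close>; hence the need to put edges back. Compared with the original tour, a
  restored edge costs at most its own length, for the detour that it creates, so
  \<open>h + 1\<close> removals against \<open>h - 1\<close> restorations leave a margin of about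
  two lengths. The ratio \<open>1 + 1 / k\<close> between scales and the class width
  \<open>l / (2 * k)\<close> are chosen so that the spread of lengths and the short connections fit
  into this margin. Pairing tails with tails and heads with heads is what leaves an edge to restore:
  in a circuit of tail-head connections only, every restoration could split the circuit. In the
  lower bound the closed trail needs even degrees. Therefore \<open>q\<close> is odd and the two
  coordinates \<open>x\<close>, \<open>y\<close> of an edge avoid 0. Characteristic three also makes
  2 nonzero, which is used to exclude closed walks through five lines. The cap at \<open>k\<close>
  bounds the price of each change of vertex in the cheap tour.\<close>

no_notation Polynomials.var (\<open>X\<index>\<close>)

section \<open>Circuits of two pairings\<close>

text \<open>A perfect matching of the whole type rather than of a finite set, so that the pairing
  laws hold without membership conditions; finiteness is imposed on circuits and invariant sets
  instead.\<close>

definition fpf_involution :: "('a \<Rightarrow> 'a) \<Rightarrow> bool" where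
  "fpf_involution f \<longleftrightarrow> (\<forall>x. f (f x) = x \<and> f x \<noteq> x)"

lemma fpf_involutionD:
  assumes "fpf_involution f"
  shows "f (f x) = x" "f x \<noteq> x" "x \<noteq> f x" "f x = f y \<longleftrightarrow> x = y"
  using assms unfolding fpf_involution_def by metis+

lemma even_card_fpf_involution:
  assumes "finite S" "\<And>x. x \<in> S \<Longrightarrow> f x \<in> S \<and> f (f x) = x \<and> f x \<noteq> x"
  shows "even (card S)"
  using assms
proof (induction "card S" arbitrary: S rule: less_induct)
  case less
  show ?case
  proof (cases "S = {}")
    case False
    then obtain x where x: "x \<in> S" by blast
    let ?S = "S - {x, f x}"
    have fx: "f x \<in> S" "f (f x) = x" "f x \<noteq> x"
      using less.prems(2)[OF x] by auto
    have card: "card S = card ?S + 2"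
      using x fx less.prems(1) card_mono[of S "{x, f x}"] card_Diff_subset[of "{x, f x}" S] by simp
    have "f y \<in> ?S \<and> f (f y) = y \<and> f y \<noteq> y" if "y \<in> ?S" for y
      using less.prems(2)[of y] that fx by auto
    then have "even (card ?S)"
      using less.hyps[of ?S] card less.prems(1) by simp
    then show ?thesis
      using card by simp
  qed simp
qed

section \<open>Connectivity of the union of two pairings\<close>

definition linked :: "('a \<Rightarrow> 'a) \<Rightarrow> ('a \<Rightarrow> 'a) \<Rightarrow> 'a \<Rightarrow> 'a \<Rightarrow> bool" where
  "linked f g = (\<lambda>u v. v = f u \<or> v = g u)\<^sup>*\<^sup>*"

lemma linked_refl [simp, intro]: "linked f g u u"
  by (simp add: linked_def)

lemma linked_trans [trans]: "linked f g u v \<Longrightarrow> linked f g v w \<Longrightarrow> linked f g u w"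
  by (simp add: linked_def)

lemma linked_step1: "linked f g u (f u)" and linked_step2: "linked f g u (g u)"
  by (auto simp: linked_def)

lemma linked_sym:
  assumes "fpf_involution f" "fpf_involution g" "linked f g u v"
  shows "linked f g v u"
  using assms(3) unfolding linked_def
proof (induction rule: rtranclp_induct)
  case (step y z)
  then have "y = f z \<or> y = g z"
    using fpf_involutionD[OF assms(1)] fpf_involutionD[OF assms(2)] by metis
  then show ?case
    using step(3) by (rule converse_rtranclp_into_rtranclp)
qed simp

lemma linked_subset:
  assumes "linked f g u v" "\<And>w. linked f' g' w (f w)" "\<And>w. linked f' g' w (g w)"
  shows "linked f' g' u v"
  using assms(1) unfolding linked_def[of f g]
proof (induction rule: rtranclp_induct)
  case (step y z)
  then show ?case
    using assms(2,3) linked_trans by metis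
qed simp

lemma linked_closed:
  assumes "linked f g u v" "u \<in> D" "\<And>w. w \<in> D \<Longrightarrow> f w \<in> D" "\<And>w. w \<in> D \<Longrightarrow> g w \<in> D"
  shows "v \<in> D"
  using assms(1,2) unfolding linked_def
  by (induction rule: rtranclp_induct) (use assms(3,4) in auto)

text \<open>In the application \<open>x\<close> and \<open>z\<close> are the two darts of a removed
  tour edge: the edge is put back and the former partners of its darts are connected to each
  other.\<close>

definition exchange :: "('a \<Rightarrow> 'a) \<Rightarrow> 'a \<Rightarrow> 'a \<Rightarrow> 'a \<Rightarrow> 'a" where
  "exchange g x z = g(x := z, z := x, g x := g z, g z := g x)"

lemma fpf_involution_exchange:
  assumes "fpf_involution g" "z \<noteq> x" "z \<noteq> g x"
  shows "fpf_involution (exchange g x z)"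
  using assms unfolding fpf_involution_def exchange_def by (auto simp: fun_upd_def) metis+

lemma exchange_simps:
  assumes "fpf_involution g" "z \<noteq> x" "z \<noteq> g x"
  shows "exchange g x z x = z" "exchange g x z z = x" "exchange g x z (g x) = g z"
    "exchange g x z (g z) = g x"
    "u \<notin> {x, z, g x, g z} \<Longrightarrow> exchange g x z u = g u"
  using fpf_involutionD[OF assms(1)] assms(2,3) unfolding exchange_def by (auto simp: fun_upd_def)

text \<open>Walks that use no \<open>g\<close>-pair starting in \<open>K\<close>. For
  \<open>K\<close> closed under \<open>g\<close> this deletes exactly the pairs inside
  \<open>K\<close>.\<close>

definition linked_avoiding :: "'a set \<Rightarrow> ('a \<Rightarrow> 'a) \<Rightarrow> ('a \<Rightarrow> 'a) \<Rightarrow> 'a \<Rightarrow> 'a \<Rightarrow> bool" where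
  "linked_avoiding K f g = (\<lambda>u v. v = f u \<or> u \<notin> K \<and> v = g u)\<^sup>*\<^sup>*"

lemma linked_avoiding_imp_linked: "linked_avoiding K f g u v \<Longrightarrow> linked f g u v"
  unfolding linked_avoiding_def linked_def by (erule mono_rtranclp[rule_format, rotated]) auto

lemma linked_avoiding_refl: "linked_avoiding K f g u u"
  by (simp add: linked_avoiding_def)

lemma linked_avoiding_step1: "linked_avoiding K f g u v \<Longrightarrow> linked_avoiding K f g u (f v)"
  unfolding linked_avoiding_def by (erule rtranclp.rtrancl_into_rtrancl) simp

lemma linked_avoiding_step2:
  "linked_avoiding K f g u v \<Longrightarrow> v \<notin> K \<Longrightarrow> linked_avoiding K f g u (g v)"
  unfolding linked_avoiding_def by (erule rtranclp.rtrancl_into_rtrancl) simp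

text \<open>A graph all of whose degrees are even has no bridge.\<close>

lemma linked_avoiding_partner:
  assumes f: "fpf_involution f" and g: "fpf_involution g" and fin: "finite {u. linked f g x u}"
  shows "linked_avoiding {x, g x} f g x (g x)"
proof (rule ccontr)
  assume neg: "\<not> linked_avoiding {x, g x} f g x (g x)"
  define S where "S = {u. linked_avoiding {x, g x} f g x u}"
  note inv = fpf_involutionD[OF f] fpf_involutionD[OF g]
  have "S \<subseteq> {u. linked f g x u}"
    unfolding S_def using linked_avoiding_imp_linked by fast
  then have finS: "finite S"
    using fin finite_subset by blast
  have "x \<in> S" "g x \<notin> S"
    using neg by (auto simp: S_def linked_avoiding_refl)
  \<comment> \<open>\<open>f\<close> pairs up \<open>S\<close>. Since \<open>g x\<close> is not
    reached, \<open>g\<close> pairs up \<open>S\<close> without \<open>x\<close>, so two consecutive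
    numbers would be even.\<close>
  have "even (card S)"
    by (rule even_card_fpf_involution[OF finS, of f])
      (auto simp: S_def inv linked_avoiding_step1)
  moreover have "even (card (S - {x}))"
  proof (rule even_card_fpf_involution[of _ g])
    fix u assume u: "u \<in> S - {x}"
    then have "u \<noteq> g x"
      using \<open>g x \<notin> S\<close> by auto
    then have "g u \<in> S"
      using u by (auto simp: S_def intro: linked_avoiding_step2)
    moreover have "g u \<noteq> x"
      using \<open>u \<noteq> g x\<close> inv by metis
    ultimately show "g u \<in> S - {x} \<and> g (g u) = u \<and> g u \<noteq> u"
      using inv by blast
  qed (use finS in simp)
  moreover have "card S = Suc (card (S - {x}))"
    using card_Suc_Diff1[OF finS \<open>x \<in> S\<close>] by simp
  ultimately show False
    by simp
qed

text \<open>It suffices that \<open>x\<close> still reaches one former partner: the exchange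
  connects \<open>x\<close> with \<open>z\<close> and \<open>g x\<close> with \<open>g z\<close>, so
  all four points then share a circuit and nothing becomes separated.\<close>

lemma linked_exchange_if_linked_partners:
  assumes g: "fpf_involution g" "z \<noteq> x" "z \<noteq> g x" and f: "fpf_involution f"
    and "linked f (exchange g x z) x (g x) \<or> linked f (exchange g x z) x (g z)"
    and uv: "linked f g u v"
  shows "linked f (exchange g x z) u v" "linked f (exchange g x z) x z"
proof -
  let ?g = "exchange g x z"
  note simps = exchange_simps[OF g]
  note sym = linked_sym[OF f fpf_involution_exchange[OF g]]
  have xz: "linked f ?g x z" and pp: "linked f ?g (g x) (g z)"
    using linked_step2[of f ?g] simps by metis+
  have x: "linked f ?g x w" if "w \<in> {x, z, g x, g z}" for w
    using assms(5) xz pp sym that by (auto intro: linked_trans)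
  have "linked f ?g w (g w)" for w
  proof (cases "w \<in> {x, z, g x, g z}")
    case True
    moreover from this have "g w \<in> {x, z, g x, g z}"
      using fpf_involutionD[OF g(1)] by auto
    ultimately show ?thesis
      using x sym linked_trans by metis
  next
    case False
    then show ?thesis
      using simps(5) linked_step2 by metis
  qed
  then show "linked f ?g u v"
    using uv linked_subset linked_step1 by metis
  show "linked f ?g x z"
    by (rule xz)
qed

text \<open>The walk from \<open>x\<close> to \<open>g x\<close> that avoids their own pair stays in
  the circuit of \<open>x\<close>, which contains neither \<open>z\<close> nor \<open>g z\<close>,
  so it survives the exchange.\<close>

lemma linked_exchange_unlinked:
  assumes f: "fpf_involution f" and g: "fpf_involution g" and fin: "finite {u. linked f g x u}"
    and nl: "\<not> linked f g x z" and uv: "linked f g u v"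
  shows "linked f (exchange g x z) u v" "linked f (exchange g x z) x z"
proof -
  have zx: "z \<noteq> x" "z \<noteq> g x"
    using nl linked_step2[of f g x] by auto
  let ?g = "exchange g x z"
  have "linked f ?g x w" if "linked_avoiding {x, g x} f g x w" for w
  proof -
    have "linked f ?g x w \<and> linked f g x w"
      using that unfolding linked_avoiding_def
    proof (induction rule: rtranclp_induct)
      case (step y w)
      then have lw: "linked f g x w"
        using linked_step1 linked_step2 linked_trans by metis
      have "linked f ?g y w"
      proof (cases "w = f y")
        case True
        then show ?thesis
          by (simp add: linked_step1)
      next
        case False
        then have w: "y \<notin> {x, g x}" "w = g y"
          using step by auto
        have "y \<noteq> z" "y \<noteq> g z"
          using step.IH lw nl w fpf_involutionD[OF g] by metis+
        then show ?thesis
          using w exchange_simps(5)[OF g zx, of y] linked_step2[of f ?g y] by auto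
      qed
      then show ?case
        using step.IH lw linked_trans by metis
    qed simp
    then show ?thesis ..
  qed
  then have "linked f ?g x (g x)"
    using linked_avoiding_partner[OF f g fin] by blast
  then show "linked f ?g u v" "linked f ?g x z"
    using linked_exchange_if_linked_partners[OF g zx f _ uv] by blast+
qed

definition linked_classes :: "('a \<Rightarrow> 'a) \<Rightarrow> ('a \<Rightarrow> 'a) \<Rightarrow> 'a set \<Rightarrow> 'a set set" where
  "linked_classes f g D = (\<lambda>u. {w. linked f g u w}) ` D"

lemma card_linked_classes_exchange:
  assumes f: "fpf_involution f" and g: "fpf_involution g" and D: "finite D" "x \<in> D" "z \<in> D"
    and closed: "\<And>u. u \<in> D \<Longrightarrow> f u \<in> D \<and> g u \<in> D" and nl: "\<not> linked f g x z"
  shows "card (linked_classes f (exchange g x z) D) < card (linked_classes f g D)"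
proof -
  let ?g = "exchange g x z"
  have "z \<noteq> x" "z \<noteq> g x"
    using nl linked_step2[of f g x] by auto
  then have g': "fpf_involution ?g"
    by (rule fpf_involution_exchange[OF g])
  have "{u. linked f g x u} \<subseteq> D"
    using linked_closed[of f g x _ D] D(2) closed by blast
  then have "finite {u. linked f g x u}"
    using D(1) finite_subset by blast
  note ex = linked_exchange_unlinked[OF f g this nl]
  \<comment> \<open>\<open>?h\<close> sends an old class to the new class of an arbitrary
    representative, well defined because old links persist. It maps onto the new classes and
    identifies those of \<open>x\<close> and \<open>z\<close>.\<close>
  let ?h = "\<lambda>C. {w. linked f ?g (SOME u. u \<in> C) w}"
  have h: "?h {w. linked f g u w} = {w. linked f ?g u w}" for u
  proof -
    have "(SOME v. v \<in> {w. linked f g u w}) \<in> {w. linked f g u w}"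
      by (rule someI[of _ u]) simp
    then have "linked f ?g u (SOME v. v \<in> {w. linked f g u w})"
      using ex(1) by blast
    then have "linked f ?g (SOME v. v \<in> {w. linked f g u w}) w \<longleftrightarrow> linked f ?g u w" for w
      using linked_sym[OF f g'] linked_trans by metis
    then show ?thesis
      by simp
  qed
  have img: "linked_classes f ?g D = ?h ` linked_classes f g D"
    unfolding linked_classes_def image_image h ..
  have "\<not> inj_on ?h (linked_classes f g D)"
  proof
    assume inj: "inj_on ?h (linked_classes f g D)"
    have "linked f ?g x w \<longleftrightarrow> linked f ?g z w" for w
      using ex(2)[OF linked_refl] linked_sym[OF f g' ex(2)[OF linked_refl]] linked_trans by metis
    then have "?h {w. linked f g x w} = ?h {w. linked f g z w}"
      unfolding h by (rule Collect_cong)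
    moreover have "{w. linked f g x w} \<in> linked_classes f g D" "{w. linked f g z w} \<in> linked_classes f g D"
      using D by (auto simp: linked_classes_def)
    ultimately have "{w. linked f g x w} = {w. linked f g z w}"
      using inj by (meson inj_onD)
    then show False
      using nl linked_refl by blast
  qed
  moreover have "finite (linked_classes f g D)"
    using D(1) by (simp add: linked_classes_def)
  ultimately show ?thesis
    unfolding img by (metis card_image_le eq_card_imp_inj_on le_neq_implies_less)
qed

text \<open>A proper 2-colouring of the alternating cycle. When \<open>f\<close> is
  \<open>flip\<close> it amounts to a direction of traversal, for instance with \<open>Q\<close> the
  darts through which cities are entered; the complement is the reverse direction.\<close>

definition orientation :: "('a \<Rightarrow> 'a) \<Rightarrow> ('a \<Rightarrow> 'a) \<Rightarrow> 'a set \<Rightarrow> 'a set \<Rightarrow> bool" where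
  "orientation f g D Q \<longleftrightarrow> (\<forall>u\<in>D. (f u \<in> Q) \<noteq> (u \<in> Q) \<and> (g u \<in> Q) \<noteq> (u \<in> Q))"

text \<open>The two paths that are left after removing the pairs of \<open>x\<close> and \<open>z\<close> start at \<open>x\<close> and \<open>z\<close> and end
  outside \<open>Q\<close>, so joining \<open>x\<close> to \<open>z\<close> yields a single circuit again.\<close>

lemma linked_exchange_oriented:
  assumes f: "fpf_involution f" and g: "fpf_involution g" and fin: "finite {u. linked f g x u}"
    and ori: "orientation f g {u. linked f g x u} Q"
    and Q: "x \<in> Q" "z \<in> Q" and xz: "z \<noteq> x" and lz: "linked f g x z" and uv: "linked f g u v"
  shows "linked f (exchange g x z) u v" "z \<noteq> g x"
proof -
  note inv = fpf_involutionD[OF f] fpf_involutionD[OF g]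
  have gQ: "g x \<notin> Q" "g z \<notin> Q"
    using ori Q lz by (auto simp: orientation_def)
  then show zgx: "z \<noteq> g x"
    using Q by auto
  let ?g = "exchange g x z"
  let ?K = "{x, z, g x, g z}"
  define S where "S = {u. linked_avoiding ?K f g x u}"
  have SD: "S \<subseteq> {u. linked f g x u}"
    unfolding S_def using linked_avoiding_imp_linked by fast
  then have finS: "finite S"
    using fin finite_subset by blast
  have flip: "(f u \<in> Q) \<noteq> (u \<in> Q)" "(g u \<in> Q) \<noteq> (u \<in> Q)" if "u \<in> S" for u
    using that SD ori by (auto simp: orientation_def)
  have fS: "f u \<in> S" if "u \<in> S" for u
    using that by (auto simp: S_def intro: linked_avoiding_step1)
  have gS: "g u \<in> S" if "u \<in> S" "u \<notin> ?K" for u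
    using that unfolding S_def mem_Collect_eq by (rule linked_avoiding_step2)
  have "g x \<in> S \<or> g z \<in> S"
  proof (rule ccontr)
    assume neg: "\<not> (g x \<in> S \<or> g z \<in> S)"
    \<comment> \<open>By \<open>f\<close>, half of \<open>S\<close> lies in \<open>Q\<close>. If
      neither former partner is reached, \<open>g\<close> matches the other half with the points of
      \<open>Q\<close> other than \<open>x\<close> and \<open>z\<close>, which leaves
      \<open>x\<close> in excess.\<close>
    have "card (S \<inter> Q) = card (S - Q)"
      by (rule bij_betw_same_card[of f], rule bij_betw_byWitness[of _ f])
        (use flip fS inv in auto)
    moreover have "card (S \<inter> Q - ?K) = card (S - Q)"
    proof (rule bij_betw_same_card[of g], rule bij_betw_byWitness[of _ g])
      show "g ` (S \<inter> Q - ?K) \<subseteq> S - Q"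
        using flip gS by auto
      show "g ` (S - Q) \<subseteq> S \<inter> Q - ?K"
      proof (rule image_subsetI)
        fix u assume u: "u \<in> S - Q"
        then have uK: "u \<notin> ?K"
          using neg Q by auto
        then have "g u \<notin> ?K"
          using inv by auto
        then show "g u \<in> S \<inter> Q - ?K"
          using u uK gS flip by auto
      qed
    qed (use inv in auto)
    moreover have "x \<in> S \<inter> Q"
      using Q by (auto simp: S_def linked_avoiding_refl)
    then have "card (S \<inter> Q - ?K) < card (S \<inter> Q)"
      using finS by (intro psubset_card_mono) auto
    ultimately show False
      by simp
  qed
  moreover have "linked f ?g x w" if "w \<in> S" for w
    using that unfolding S_def linked_avoiding_def mem_Collect_eq
  proof (induction rule: rtranclp_induct)
    case (step y w)
    then have "linked f ?g y w"
      using exchange_simps(5)[OF g xz zgx, of y] linked_step1[of f ?g y] linked_step2[of f ?g y] by auto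
    then show ?case
      using step.IH linked_trans by metis
  qed simp
  ultimately have "linked f ?g x (g x) \<or> linked f ?g x (g z)"
    by blast
  then show "linked f ?g u v"
    using linked_exchange_if_linked_partners[OF g xz zgx f _ uv] by blast
qed

section \<open>The circuit of a point as an orbit\<close>

lemma funpow_add_apply: "(f ^^ (m + n)) x = (f ^^ m) ((f ^^ n) x)"
  by (simp add: funpow_add)

text \<open>An equality would be a palindrome of \<open>f\<close>- and \<open>g\<close>-steps;
  peeling off its two ends leads to a fixed point of \<open>f\<close> or \<open>g\<close>.\<close>

lemma funpow_comp_involutions_neq:
  assumes "fpf_involution f" "fpf_involution g"
  shows "((\<lambda>u. g (f u)) ^^ j) x \<noteq> f x"
proof (induction j arbitrary: x rule: less_induct)
  case (less j)
  note inv = fpf_involutionD[OF assms(1)] fpf_involutionD[OF assms(2)]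
  consider "j = 0" | "j = 1" | i where "j = Suc (Suc i)"
    by (metis One_nat_def not0_implies_Suc)
  then show ?case
  proof cases
    case 3
    have "((\<lambda>u. g (f u)) ^^ i) (g (f x)) \<noteq> f (g (f x))"
      using less[of i "g (f x)"] 3 by simp
    moreover have "((\<lambda>u. g (f u)) ^^ j) x = g (f (((\<lambda>u. g (f u)) ^^ i) (g (f x))))"
      unfolding 3 using funpow_swap1[of "\<lambda>u. g (f u)" i x] by simp
    ultimately show ?thesis
      using inv by metis
  qed (use inv in auto)
qed

text \<open>Composing the two pairings advances by two points on the circuit. The orbit of
  \<open>x\<close> is every other point, the \<open>f\<close>-partners are the rest, and the
  previous lemma keeps the two sets disjoint.\<close>

lemma linked_class_cycle:
  assumes f: "fpf_involution f" and g: "fpf_involution g" and fin: "finite {u. linked f g x u}"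
  obtains m where "m > 0" "inj_on (\<lambda>i. ((\<lambda>u. g (f u)) ^^ i) x) {..<m}" "((\<lambda>u. g (f u)) ^^ m) x = x"
    "{u. linked f g x u} = (\<lambda>i. ((\<lambda>u. g (f u)) ^^ i) x) ` {..<m} \<union> f ` (\<lambda>i. ((\<lambda>u. g (f u)) ^^ i) x) ` {..<m}"
    "orientation f g {u. linked f g x u} ((\<lambda>i. ((\<lambda>u. g (f u)) ^^ i) x) ` {..<m})"
proof -
  note inv = fpf_involutionD[OF f] fpf_involutionD[OF g]
  let ?p = "\<lambda>i. ((\<lambda>u. g (f u)) ^^ i) x"
  have linked_p: "linked f g x (?p i)" for i
  proof (induction i)
    case (Suc i)
    also have "linked f g (?p i) (f (?p i))"
      by (rule linked_step1)
    also have "linked f g (f (?p i)) (?p (Suc i))"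
      using linked_step2 by simp
    finally show ?case .
  qed simp
  have inj: "inj ((\<lambda>u. g (f u)) ^^ i)" for i
  proof (induction i)
    case (Suc i)
    have "inj (\<lambda>u. g (f u))"
      by (auto intro!: injI simp: inv)
    then show ?case
      using inj_compose[OF _ Suc, of "\<lambda>u. g (f u)"] by (simp add: comp_def)
  qed simp
  have cancel: "?p (j - i) = x" if "?p i = ?p j" "i \<le> j" for i j
  proof -
    have "?p j = ((\<lambda>u. g (f u)) ^^ i) (?p (j - i))"
      using that(2) by (simp flip: funpow_add_apply)
    then have "((\<lambda>u. g (f u)) ^^ i) x = ((\<lambda>u. g (f u)) ^^ i) (?p (j - i))"
      using that(1) by simp
    then show ?thesis
      using injD[OF inj[of i]] by metis
  qed
  have "\<not> inj ?p"
  proof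
    assume "inj ?p"
    moreover have "range ?p \<subseteq> {u. linked f g x u}"
      using linked_p by auto
    then have "finite (range ?p)"
      using fin finite_subset by blast
    ultimately show False
      using finite_imageD infinite_UNIV_nat by blast
  qed
  then obtain i j where "i < j" "?p i = ?p j"
    unfolding inj_def by (metis linorder_neqE_nat)
  then have ex: "\<exists>m. m > 0 \<and> ?p m = x"
    using cancel[of i j] by (intro exI[of _ "j - i"]) auto
  define m where "m = (LEAST m. m > 0 \<and> ?p m = x)"
  have m: "m > 0" "?p m = x"
    using LeastI_ex[OF ex] unfolding m_def by auto
  have least: "m \<le> i" if "i > 0" "?p i = x" for i
    unfolding m_def by (rule Least_le) (use that in auto)
  have injm: "inj_on ?p {..<m}"
  proof (rule linorder_inj_onI)
    fix i j assume "i < j" "i \<in> {..<m}" "j \<in> {..<m}"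
    then have "?p (j - i) \<noteq> x"
      using least[of "j - i"] by auto
    then show "?p i \<noteq> ?p j"
      using cancel[of i j] \<open>i < j\<close> by auto
  qed auto
  let ?Q = "?p ` {..<m}"
  have p_Q: "?p i \<in> ?Q" if "i \<le> m" for i
  proof (cases "i = m")
    case True
    then have "?p i = ?p 0"
      using m(2) by simp
    then show ?thesis
      using m(1) by blast
  qed (use that in auto)
  have disj: "f (?p j) \<noteq> ?p i" for i j
  proof (cases "j \<le> i")
    case True
    then have "?p i = ((\<lambda>u. g (f u)) ^^ (i - j)) (?p j)"
      by (simp flip: funpow_add_apply)
    then show ?thesis
      using funpow_comp_involutions_neq[OF f g, of "i - j" "?p j"] by simp
  next
    case False
    then have "?p j = ((\<lambda>u. g (f u)) ^^ (j - i)) (?p i)"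
      by (simp flip: funpow_add_apply)
    then show ?thesis
      using funpow_comp_involutions_neq[OF f g, of "j - i" "?p i"] inv by metis
  qed
  have next_Q: "g (f u) \<in> ?Q" if uQ: "u \<in> ?Q" for u
  proof -
    obtain i where i: "i < m" "u = ?p i"
      using uQ by auto
    then have "g (f u) = ?p (Suc i)"
      by simp
    then show ?thesis
      using p_Q[of "Suc i"] i by simp
  qed
  have prev_Q: "g u \<in> f ` ?Q" if uQ: "u \<in> ?Q" for u
  proof -
    obtain i where i: "i < m" "u = ?p i"
      using uQ by auto
    obtain j where j: "?p (Suc j) = u" "j < m"
    proof (cases i)
      case 0
      moreover have "Suc (m - 1) = m"
        using m by simp
      ultimately show thesis
        using i m that[of "m - 1"] by (metis diff_less funpow_0 zero_less_one)
    qed (use i that in auto)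
    then have "g u = f (?p j)"
      using inv by auto
    then show ?thesis
      using p_Q[of j] j by simp
  qed
  have f_Q: "f v \<notin> ?Q" if "v \<in> ?Q" for v
    using disj that by fast
  have cls: "{u. linked f g x u} = ?Q \<union> f ` ?Q"
  proof
    show "{u. linked f g x u} \<subseteq> ?Q \<union> f ` ?Q"
    proof
      fix u assume "u \<in> {u. linked f g x u}"
      then have "linked f g x u" by simp
      then show "u \<in> ?Q \<union> f ` ?Q"
      proof (rule linked_closed)
        show "x \<in> ?Q \<union> f ` ?Q"
          using p_Q[of 0] by simp
      next
        fix w assume "w \<in> ?Q \<union> f ` ?Q"
        then consider "w \<in> ?Q" | v where "w = f v" "v \<in> ?Q"
          by blast
        then show "f w \<in> ?Q \<union> f ` ?Q" "g w \<in> ?Q \<union> f ` ?Q"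
          using next_Q prev_Q inv by (cases; metis UnI1 UnI2 imageI)+
      qed
    qed
    show "?Q \<union> f ` ?Q \<subseteq> {u. linked f g x u}"
      using linked_p linked_step1 linked_trans by fast
  qed
  have "orientation f g {u. linked f g x u} ?Q"
    unfolding orientation_def
  proof (intro ballI conjI)
    fix u assume "u \<in> {u. linked f g x u}"
    then have "u \<in> ?Q \<or> u \<in> f ` ?Q"
      using cls by blast
    then have "(f u \<in> ?Q) \<noteq> (u \<in> ?Q) \<and> (g u \<in> ?Q) \<noteq> (u \<in> ?Q)"
    proof
      assume u: "u \<in> ?Q"
      then obtain v where "v \<in> ?Q" "g u = f v"
        using prev_Q by blast
      then show ?thesis
        using u f_Q[of u] f_Q[of v] by simp
    next
      assume "u \<in> f ` ?Q"
      then obtain v where v: "v \<in> ?Q" "u = f v"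
        by blast
      then show ?thesis
        using f_Q[of v] next_Q[of v] inv by simp
    qed
    then show "(f u \<in> ?Q) \<noteq> (u \<in> ?Q)" "(g u \<in> ?Q) \<noteq> (u \<in> ?Q)"
      by blast+
  qed
  from that[OF m(1) injm m(2) cls this] show ?thesis .
qed

section \<open>Reconnecting a tour\<close>

text \<open>The factors 2 arise because \<open>D\<close> contains both members of each pair. Used
  for lengths and for counting connections between darts of the same kind.\<close>

lemma sum_exchange:
  fixes F :: "'a \<Rightarrow> 'a \<Rightarrow> real"
  assumes g: "fpf_involution g" "z \<noteq> x" "z \<noteq> g x"
    and D: "finite D" "x \<in> D" "z \<in> D" "g x \<in> D" "g z \<in> D"
    and F: "\<And>u v. F u v = F v u"
  shows "(\<Sum>u\<in>D. F u (exchange g x z u)) =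
    (\<Sum>u\<in>D. F u (g u)) - 2 * F x (g x) - 2 * F z (g z) + 2 * F x z + 2 * F (g x) (g z)"
proof -
  let ?K = "{x, z, g x, g z}"
  note inv = fpf_involutionD[OF g(1)]
  have dist: "x \<noteq> g x" "x \<noteq> g z" "z \<noteq> g z" "g x \<noteq> g z"
    using inv g by metis+
  have split: "(\<Sum>u\<in>D. F u (k u)) = (\<Sum>u\<in>D - ?K. F u (k u)) + (\<Sum>u\<in>?K. F u (k u))" for k
    using D by (intro sum.subset_diff) auto
  have "(\<Sum>u\<in>D - ?K. F u (exchange g x z u)) = (\<Sum>u\<in>D - ?K. F u (g u))"
    using exchange_simps(5)[OF g] by (intro sum.cong) auto
  moreover have "(\<Sum>u\<in>?K. F u (exchange g x z u)) = 2 * F x z + 2 * F (g x) (g z)"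
    using dist g(2,3) exchange_simps[OF g] F[of z x] F[of "g z" "g x"] by simp
  moreover have "(\<Sum>u\<in>?K. F u (g u)) = 2 * F x (g x) + 2 * F z (g z)"
    using dist g(2,3) inv F[of "g x" x] F[of "g z" z] by simp
  ultimately show ?thesis
    unfolding split[of "exchange g x z"] split[of g] by simp
qed

text \<open>A tour is a cyclic permutation \<open>s\<close> of the cities \<open>V\<close>. The darts \<open>(v, True)\<close> and \<open>(v, False)\<close>
  are the outgoing and the incoming half of the tour at \<open>v\<close>; the edge from \<open>v\<close> to \<open>s v\<close> is named
  by \<open>v\<close>, and \<open>X\<close> is a set of edges whose tails and heads are paired by \<open>\<alpha>\<close> and \<open>\<beta>\<close>.\<close>

definition flip :: "'a \<times> bool \<Rightarrow> 'a \<times> bool" where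
  "flip u = (fst u, \<not> snd u)"

lemma flip_simps [simp]: "flip (v, b) = (v, \<not> b)" "fst (flip u) = fst u" "snd (flip u) = (\<not> snd u)"
  by (auto simp: flip_def)

lemma fpf_involution_flip: "fpf_involution flip"
  by (auto simp: fpf_involution_def flip_def)

text \<open>Beyond the orbit description, no city is visited twice: its two darts have different
  colours in the orientation.\<close>

lemma flip_cycle:
  assumes g: "fpf_involution g" and fin: "finite {u. linked flip g x u}"
  obtains p m where "m > 0" "p 0 = x" "p m = x" "\<And>i. p (Suc i) = g (flip (p i))"
    "inj_on (\<lambda>i. fst (p i)) {..<m}"
    "{u. linked flip g x u} = p ` {..<m} \<union> flip ` p ` {..<m}"
    "orientation flip g {u. linked flip g x u} (p ` {..<m})"
proof -
  define p where "p i = ((\<lambda>u. g (flip u)) ^^ i) x" for i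
  obtain m where m: "m > 0" "inj_on p {..<m}" "p m = x"
    and D: "{u. linked flip g x u} = p ` {..<m} \<union> flip ` p ` {..<m}"
    and ori: "orientation flip g {u. linked flip g x u} (p ` {..<m})"
    using linked_class_cycle[OF fpf_involution_flip g fin] unfolding p_def[symmetric] by blast
  define Q where "Q = p ` {..<m}"
  have "flip u \<notin> Q" if "u \<in> Q" for u
    using ori that D unfolding orientation_def Q_def[symmetric] by blast
  then have flip_Q: "p i \<noteq> flip (p j)" if "i < m" "j < m" for i j
    using that by (metis Q_def imageI lessThan_iff)
  have "inj_on (\<lambda>i. fst (p i)) {..<m}"
  proof (rule inj_onI)
    fix i j assume ij: "i \<in> {..<m}" "j \<in> {..<m}" "fst (p i) = fst (p j)"
    then have "p i = p j \<or> p i = flip (p j)"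
      by (auto simp: prod_eq_iff)
    then show "i = j"
      using m(2) ij flip_Q by (auto dest: inj_onD)
  qed
  moreover have "p 0 = x" "\<And>i. p (Suc i) = g (flip (p i))"
    by (simp_all add: p_def)
  ultimately show ?thesis
    using that[of m p] m(1,3) D ori by blast
qed

locale paired_tour =
  fixes V :: "'a set" and s :: "'a \<Rightarrow> 'a" and X :: "'a set" and \<alpha> \<beta> :: "'a \<Rightarrow> 'a"
    and d :: "'a \<Rightarrow> 'a \<Rightarrow> real" and h :: nat
  assumes finite_V: "finite V" and V_nonempty: "V \<noteq> {}" and s: "s permutes V"
    and cyclic: "\<And>S. S \<subseteq> V \<Longrightarrow> S \<noteq> {} \<Longrightarrow> s ` S \<subseteq> S \<Longrightarrow> S = V"
    and X: "X \<subseteq> V" "card X = 2 * h" "h > 0"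
    and \<alpha>: "\<And>x. x \<in> X \<Longrightarrow> \<alpha> x \<in> X \<and> \<alpha> (\<alpha> x) = x \<and> \<alpha> x \<noteq> x"
    and \<beta>: "\<And>x. x \<in> X \<Longrightarrow> \<beta> x \<in> X \<and> \<beta> (\<beta> x) = x \<and> \<beta> x \<noteq> x"
    and d_sym: "\<And>u v. d u v = d v u"
    and d_tri: "\<And>u v w. u \<in> V \<Longrightarrow> v \<in> V \<Longrightarrow> w \<in> V \<Longrightarrow> d u w \<le> d u v + d v w"
begin

text \<open>An incoming dart belongs to the edge named by the predecessor of its city, hence the
  inverse of \<open>s\<close>. Outside \<open>V\<close>, where \<open>s\<close> is the identity, the
  two darts of a city are paired with each other.\<close>

definition full :: "'a \<times> bool \<Rightarrow> 'a \<times> bool" where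
  "full u = (if snd u then if fst u \<in> X then (\<alpha> (fst u), True) else (s (fst u), False)
     else let w = inv_into UNIV s (fst u) in if w \<in> X then (s (\<beta> w), False) else (w, True))"

abbreviation D :: "('a \<times> bool) set" where
  "D \<equiv> V \<times> UNIV"

text \<open>Every connection is counted at both of its darts. The same holds for
  \<open>homogeneous\<close>, which counts tail-tail and head-head connections.\<close>

definition weight :: "('a \<times> bool \<Rightarrow> 'a \<times> bool) \<Rightarrow> real" where
  "weight g = (\<Sum>u\<in>D. d (fst u) (fst (g u)))"

definition homogeneous :: "('a \<times> bool \<Rightarrow> 'a \<times> bool) \<Rightarrow> real" where
  "homogeneous g = (\<Sum>u\<in>D. of_bool (snd u = snd (g u)))"

abbreviation "len v \<equiv> d v (s v)"

text \<open>The invariant while edges are put back, with \<open>R\<close> the edges still missing.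
  One restoration adds at most \<open>4 * len\<close> to the doubled length and destroys at most two
  same-kind connections, that is, four darts. Initially \<open>4 * h\<close> darts are of this kind,
  so some remain as long as more than \<open>h\<close> edges are missing.\<close>

definition state :: "'a set \<Rightarrow> ('a \<times> bool \<Rightarrow> 'a \<times> bool) \<Rightarrow> bool" where
  "state R g \<longleftrightarrow> R \<subseteq> X \<and> fpf_involution g \<and> g ` D \<subseteq> D \<and>
     (\<forall>v\<in>V - R. g (v, True) = (s v, False)) \<and>
     weight g \<le> weight full + 4 * (\<Sum>v\<in>X - R. len v) \<and>
     4 * real (card R) \<le> homogeneous g + 4 * real h"

abbreviation circuits :: "('a \<times> bool \<Rightarrow> 'a \<times> bool) \<Rightarrow> ('a \<times> bool) set set" where
  "circuits g \<equiv> linked_classes flip g D"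

definition connected_state :: "('a \<times> bool \<Rightarrow> 'a \<times> bool) \<Rightarrow> bool" where
  "connected_state g \<longleftrightarrow> (\<forall>u\<in>D. \<forall>w\<in>D. linked flip g u w)"

lemma finite_D: "finite D"
  using finite_V by simp

lemma finite_X: "finite X"
  using X(1) finite_V finite_subset by blast

lemma s_in_V [simp]: "s v \<in> V \<longleftrightarrow> v \<in> V"
  using permutes_in_image[OF s] by simp

lemma inv_s [simp]: "s (inv_into UNIV s v) = v" "inv_into UNIV s (s v) = v" "inv_into UNIV s v \<in> V \<longleftrightarrow> v \<in> V"
  using permutes_inverses[OF s] permutes_in_image[OF permutes_inv[OF s]] by simp_all

lemma s_eq_iff [simp]: "s v = s w \<longleftrightarrow> v = w"
  by (metis inv_s(2))

lemma linked_D: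
  assumes "linked flip g u w" "u \<in> D" "g ` D \<subseteq> D"
  shows "w \<in> D"
  by (rule linked_closed[OF assms(1,2)]) (use assms(3) in \<open>auto simp: flip_def\<close>)

lemma finite_class:
  assumes "u \<in> D" "g ` D \<subseteq> D"
  shows "finite {w. linked flip g u w}"
  using linked_D[OF _ assms] by (intro finite_subset[OF _ finite_D]) blast

lemma full_simps [simp]:
  "v \<in> X \<Longrightarrow> full (v, True) = (\<alpha> v, True)" "v \<notin> X \<Longrightarrow> full (v, True) = (s v, False)"
  "v \<in> X \<Longrightarrow> full (s v, False) = (s (\<beta> v), False)" "v \<notin> X \<Longrightarrow> full (s v, False) = (v, True)"
  by (simp_all add: full_def)

lemma dart_cases:
  obtains v where "u = (v, True)" | v where "u = (s v, False)"
  by (metis inv_s(1) surj_pair)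

lemma fpf_involution_full: "fpf_involution full"
  unfolding fpf_involution_def
proof
  fix u show "full (full u) = u \<and> full u \<noteq> u"
  proof (cases u rule: dart_cases)
    case (1 v)
    then show ?thesis
      using \<alpha>[of v] by (cases "v \<in> X") auto
  next
    case (2 v)
    then show ?thesis
      using \<beta>[of v] by (cases "v \<in> X") auto
  qed
qed

lemma full_D: "full ` D \<subseteq> D"
proof (rule image_subsetI)
  fix u assume "u \<in> D"
  then show "full u \<in> D"
    using \<alpha> \<beta> X(1) by (cases u rule: dart_cases; cases "fst u \<in> X"; cases "inv_into UNIV s (fst u) \<in> X") auto
qed

lemma sum_D: "(\<Sum>u\<in>D. f u) = (\<Sum>v\<in>V. f (v, True)) + (\<Sum>v\<in>V. f (s v, False))"
  for f :: "'a \<times> bool \<Rightarrow> real"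
proof -
  have "D = (\<lambda>v. (v, True)) ` V \<union> (\<lambda>v. (v, False)) ` V"
    by (auto simp: image_iff)
  moreover have "(\<lambda>v. (v, False)) ` V = (\<lambda>v. (s v, False)) ` V"
    using image_image[of "\<lambda>v. (v, False)" s V] by (simp only: permutes_image[OF s])
  ultimately have "D = (\<lambda>v. (v, True)) ` V \<union> (\<lambda>v. (s v, False)) ` V"
    by simp
  then have "(\<Sum>u\<in>D. f u) = (\<Sum>u\<in>(\<lambda>v. (v, True)) ` V. f u) + (\<Sum>u\<in>(\<lambda>v. (s v, False)) ` V. f u)"
    using finite_V by (simp only:, intro sum.union_disjoint) auto
  then show ?thesis
    by (simp add: sum.reindex inj_on_def)
qed

lemma weight_full:
  "weight full = 2 * (\<Sum>v\<in>V. len v) - 2 * (\<Sum>v\<in>X. len v)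
     + (\<Sum>v\<in>X. d v (\<alpha> v) + d (s v) (s (\<beta> v)))"
proof -
  have split: "(\<Sum>v\<in>V. f v) = (\<Sum>v\<in>V - X. f v) + (\<Sum>v\<in>X. f v)" for f :: "'a \<Rightarrow> real"
    by (rule sum.subset_diff[OF X(1) finite_V])
  have "(\<Sum>v\<in>V. d v (fst (full (v, True)))) = (\<Sum>v\<in>V - X. len v) + (\<Sum>v\<in>X. d v (\<alpha> v))"
    unfolding split by simp
  moreover have "(\<Sum>v\<in>V. d (s v) (fst (full (s v, False)))) = (\<Sum>v\<in>V - X. len v) + (\<Sum>v\<in>X. d (s v) (s (\<beta> v)))"
    unfolding split using d_sym by simp
  ultimately show ?thesis
    unfolding weight_def sum_D using split[of len] by (simp add: sum.distrib)
qed

lemma state_full: "state X full"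
proof -
  have "of_bool (v \<in> X) \<le> (of_bool (snd (v, True) = snd (full (v, True))) :: real)"
    "of_bool (v \<in> X) \<le> (of_bool (snd (s v, False) = snd (full (s v, False))) :: real)" for v
    by auto
  then have "(\<Sum>v\<in>V. of_bool (v \<in> X)) + (\<Sum>v\<in>V. of_bool (v \<in> X)) \<le> homogeneous full"
    unfolding homogeneous_def sum_D by (intro add_mono sum_mono)
  moreover have "(\<Sum>v\<in>V. of_bool (v \<in> X)) = real (card X)"
    using finite_V X(1) by (simp add: Int_absorb1)
  ultimately show ?thesis
    unfolding state_def using fpf_involution_full full_D X by auto
qed

text \<open>The new connection between the former partners is at most the path through the restored
  edge, and the two outer legs of this path are the connections being deleted. So the edge is paid
  twice, which is \<open>4 * len\<close> in the doubled sum.\<close>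

lemma state_exchange:
  assumes st: "state R g" and x: "x \<in> R" and neq: "g (x, True) \<noteq> (s x, False)"
  shows "state (R - {x}) (exchange g (x, True) (s x, False))"
proof -
  let ?x = "(x, True)" and ?z = "(s x, False)"
  let ?g = "exchange g ?x ?z"
  have g: "fpf_involution g" "?z \<noteq> ?x" "?z \<noteq> g ?x" and gD: "g ` D \<subseteq> D"
    using st neq by (auto simp: state_def)
  note inv = fpf_involutionD[OF g(1)]
  note simps = exchange_simps[OF g]
  have xV: "x \<in> V" "x \<in> X"
    using st x X(1) by (auto simp: state_def)
  then have D: "?x \<in> D" "?z \<in> D" "g ?x \<in> D" "g ?z \<in> D"
    using gD by auto
  have "?g ` D \<subseteq> D"
  proof (rule image_subsetI)
    fix u assume "u \<in> D"
    then show "?g u \<in> D"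
      using D gD simps by (cases "u \<in> {?x, ?z, g ?x, g ?z}") auto
  qed
  moreover have "?g (v, True) = (s v, False)" if v: "v \<in> V - (R - {x})" for v
  proof (cases "v = x")
    case False
    then have gv: "g (v, True) = (s v, False)"
      using st v by (auto simp: state_def)
    have "(v, True) \<noteq> g ?x"
    proof
      assume "(v, True) = g ?x"
      then have "g (v, True) = ?x"
        using inv by simp
      then show False
        using gv by simp
    qed
    moreover have "(v, True) \<noteq> g ?z"
    proof
      assume "(v, True) = g ?z"
      then have "g (v, True) = ?z"
        using inv by simp
      then show False
        using gv False by simp
    qed
    ultimately show ?thesis
      using simps(5)[of "(v, True)"] False gv by simp
  qed (use simps in simp)
  moreover have "weight ?g \<le> weight g + 4 * len x"
  proof -
    let ?F = "\<lambda>u v. d (fst u) (fst v)"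
    have "weight ?g = weight g - 2 * d x (fst (g ?x)) - 2 * d (s x) (fst (g ?z)) + 2 * len x
        + 2 * d (fst (g ?x)) (fst (g ?z))"
      unfolding weight_def using sum_exchange[OF g finite_D D, of ?F] d_sym by simp
    moreover have "d (fst (g ?x)) (fst (g ?z)) \<le> d (fst (g ?x)) x + (d x (s x) + d (s x) (fst (g ?z)))"
      using d_tri[of "fst (g ?x)" x "fst (g ?z)"] d_tri[of x "s x" "fst (g ?z)"] D by (auto simp: mem_Times_iff)
    ultimately show ?thesis
      using d_sym[of "fst (g ?x)" x] by simp
  qed
  then have "weight ?g \<le> weight full + 4 * (\<Sum>v\<in>X - (R - {x}). len v)"
  proof -
    have "X - (R - {x}) = insert x (X - R)"
      using xV by auto
    then have "(\<Sum>v\<in>X - (R - {x}). len v) = len x + (\<Sum>v\<in>X - R. len v)"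
      using x finite_X by simp
    then show ?thesis
      using \<open>weight ?g \<le> weight g + 4 * len x\<close> st by (simp add: state_def)
  qed
  moreover have "homogeneous ?g \<ge> homogeneous g - 4"
  proof -
    let ?F = "\<lambda>u v. of_bool (snd u = snd v) :: real"
    have F: "?F u v = ?F v u" for u v :: "'a \<times> bool"
      by (simp add: eq_commute)
    have "homogeneous ?g = homogeneous g - 2 * ?F ?x (g ?x) - 2 * ?F ?z (g ?z) + 2 * ?F ?x ?z
        + 2 * ?F (g ?x) (g ?z)"
      unfolding homogeneous_def by (rule sum_exchange[OF g finite_D D, of ?F, OF F])
    moreover have "?F ?x (g ?x) \<le> 1" "?F ?z (g ?z) \<le> 1" "?F ?x ?z \<ge> 0" "?F (g ?x) (g ?z) \<ge> 0"
      by simp_all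
    ultimately show ?thesis
      by linarith
  qed
  then have "4 * real (card (R - {x})) \<le> homogeneous ?g + 4 * real h"
  proof -
    have "finite R"
      using st finite_X finite_subset by (auto simp: state_def)
    then have "real (card R) = real (card (R - {x})) + 1"
      using card_Suc_Diff1[OF _ x] by linarith
    then show ?thesis
      using \<open>homogeneous ?g \<ge> homogeneous g - 4\<close> st by (simp add: state_def)
  qed
  ultimately show ?thesis
    unfolding state_def using st fpf_involution_exchange[OF g] by (auto simp: state_def)
qed

section \<open>From many circuits to one, and down to \<open>h + 1\<close> missing edges\<close>

lemma cyclic_all:
  assumes "v \<in> V" "P v" "\<And>w. w \<in> V \<Longrightarrow> P w \<Longrightarrow> P (s w)" "u \<in> V"
  shows "P u"
proof -
  have "{w \<in> V. P w} = V"
    by (rule cyclic) (use assms in auto)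
  then show ?thesis
    using assms(4) by blast
qed

text \<open>If the two darts of every missing edge are linked, one can still walk along the original
  tour from city to city.\<close>

lemma connected_stateI:
  assumes st: "state R g" and R: "\<And>x. x \<in> R \<Longrightarrow> linked flip g (x, True) (s x, False)"
  shows "connected_state g"
proof -
  have g: "fpf_involution g"
    using st by (simp add: state_def)
  obtain v where v: "v \<in> V"
    using V_nonempty by blast
  have all: "linked flip g (v, True) (u, True)" if "u \<in> V" for u
    using v linked_refl _ that
  proof (rule cyclic_all)
    fix w assume w: "w \<in> V" "linked flip g (v, True) (w, True)"
    have "linked flip g (w, True) (s w, False)"
      using R[of w] st w(1) linked_step2[of flip g "(w, True)"] by (cases "w \<in> R") (auto simp: state_def)
    also have "linked flip g (s w, False) (s w, True)"
      using linked_step1[of flip g "(s w, False)"] by simp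
    finally show "linked flip g (v, True) (s w, True)"
      using w(2) linked_trans by metis
  qed
  have "linked flip g (v, True) u" if uD: "u \<in> D" for u
  proof -
    obtain w b where u: "u = (w, b)" "w \<in> V"
      using uD by auto
    have "linked flip g (w, True) (w, b)"
      using linked_step1[of flip g "(w, True)"] by (cases b) auto
    then show ?thesis
      using all[of w] u linked_trans by metis
  qed
  then show ?thesis
    unfolding connected_state_def using linked_sym[OF fpf_involution_flip g] linked_trans by metis
qed

lemma finite_circuits: "finite (circuits g)"
  using finite_D by (simp add: linked_classes_def)

lemma card_circuits_pos: "card (circuits g) > 0"
  using finite_circuits V_nonempty by (simp add: card_gt_0_iff linked_classes_def)

text \<open>A circuit without a tail of \<open>X\<close> would follow the tour all the way round and
  so meet \<open>X\<close> after all. Together with \<open>x\<close> it contains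
  \<open>\<alpha> x\<close>, so the circuits split \<open>X\<close> into groups of at least
  two.\<close>

lemma card_circuits_full: "card (circuits full) \<le> h"
proof -
  note sym = linked_sym[OF fpf_involution_flip fpf_involution_full]
  have "\<exists>x\<in>X. linked flip full u (x, True)" if uD: "u \<in> D" for u
  proof (rule ccontr)
    assume neg: "\<not> ?thesis"
    obtain w b where u: "u = (w, b)" "w \<in> V"
      using uD by auto
    have w: "linked flip full u (w, True)"
      using linked_step1[of flip full u] u by (cases b) auto
    have all: "linked flip full u (v, True)" if "v \<in> V" for v
      using u(2) w _ that
    proof (rule cyclic_all)
      fix v assume v: "v \<in> V" "linked flip full u (v, True)"
      then have "full (v, True) = (s v, False)"
        using neg by auto
      then have "linked flip full (v, True) (s v, False)"
        using linked_step2 by metis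
      also have "linked flip full (s v, False) (s v, True)"
        using linked_step1[of flip full "(s v, False)"] by simp
      finally show "linked flip full u (s v, True)"
        using v(2) linked_trans by metis
    qed
    obtain x where "x \<in> X"
      using X by fastforce
    then show False
      using neg all[of x] X(1) by blast
  qed
  define cls where "cls v = {w. linked flip full (v, True) w}" for v
  have cls_eq: "cls x = {w. linked flip full u w}" if "linked flip full u (x, True)" for u x
  proof -
    have "linked flip full (x, True) w \<longleftrightarrow> linked flip full u w" for w
      using that sym[OF that] linked_trans by metis
    then show ?thesis
      by (simp add: cls_def)
  qed
  have cls\<alpha>: "cls (\<alpha> x) = cls x" if "x \<in> X" for x
    using cls_eq[of "(x, True)" "\<alpha> x"] linked_step2[of flip full "(x, True)"] that by (simp add: cls_def)
  have "circuits full \<subseteq> cls ` X"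
  proof
    fix C assume "C \<in> circuits full"
    then obtain u where "u \<in> D" "C = {w. linked flip full u w}"
      by (auto simp: linked_classes_def)
    moreover from this obtain x where "x \<in> X" "linked flip full u (x, True)"
      using \<open>\<And>u. u \<in> D \<Longrightarrow> \<exists>x\<in>X. linked flip full u (x, True)\<close> by blast
    ultimately show "C \<in> cls ` X"
      using cls_eq by blast
  qed
  then have "card (circuits full) \<le> card (cls ` X)"
    using finite_X by (intro card_mono) auto
  moreover have "2 * card (cls ` X) \<le> card X"
  proof -
    have "2 \<le> card {x \<in> X. cls x = C}" if C: "C \<in> cls ` X" for C
    proof -
      obtain x where x: "x \<in> X" "cls x = C"
        using C by auto
      have "card {x, \<alpha> x} \<le> card {x \<in> X. cls x = C}"
        using x \<alpha>[OF x(1)] cls\<alpha>[OF x(1)] finite_X by (intro card_mono) auto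
      moreover have "x \<noteq> \<alpha> x"
        using \<alpha>[OF x(1)] by metis
      ultimately show ?thesis
        by simp
    qed
    then have "(\<Sum>C\<in>cls ` X. 2) \<le> (\<Sum>C\<in>cls ` X. card {x \<in> X. cls x = C})"
      by (rule sum_mono)
    also have "\<dots> = card X"
      using sum.image_gen[OF finite_X, of "\<lambda>_. 1::nat" cls] by simp
    finally show ?thesis
      by simp
  qed
  ultimately show ?thesis
    using X(2) by simp
qed

text \<open>Restoring an edge between different circuits lowers \<open>card R\<close> by one and the
  number of circuits by at least one, so the inequality persists. Once no such edge is left there is
  a single circuit, and the inequality gives \<open>h + 1\<close>.\<close>

lemma connect:
  assumes "state R g" "card R \<ge> h + card (circuits g)"
  shows "\<exists>R' g'. state R' g' \<and> connected_state g' \<and> card R' \<ge> h + 1"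
  using assms
proof (induction "card R" arbitrary: R g rule: less_induct)
  case less
  note st = less.prems(1)
  show ?case
  proof (cases "\<forall>x\<in>R. linked flip g (x, True) (s x, False)")
    case True
    then have "connected_state g"
      using connected_stateI[OF st] by blast
    then show ?thesis
      using less.prems card_circuits_pos[of g] by (intro exI[of _ R] exI[of _ g]) auto
  next
    case False
    then obtain x where x: "x \<in> R" and nl: "\<not> linked flip g (x, True) (s x, False)"
      by blast
    let ?x = "(x, True)" and ?z = "(s x, False)"
    let ?g = "exchange g ?x ?z"
    have g: "fpf_involution g" and gD: "g ` D \<subseteq> D" and xV: "x \<in> V"
      using st x X(1) by (auto simp: state_def)
    have neq: "g ?x \<noteq> ?z"
      using nl linked_step2[of flip g ?x] by auto
    have st': "state (R - {x}) ?g"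
      by (rule state_exchange[OF st x neq])
    have "card (circuits ?g) < card (circuits g)"
    proof (rule card_linked_classes_exchange[OF fpf_involution_flip g finite_D _ _ _ nl])
      show "flip u \<in> D \<and> g u \<in> D" if "u \<in> D" for u
        using that gD by (auto simp: flip_def)
    qed (use xV in auto)
    moreover have "finite R"
      using st finite_X finite_subset by (auto simp: state_def)
    then have "card R = Suc (card (R - {x}))"
      using card_Suc_Diff1[OF _ x] by simp
    ultimately show ?thesis
      using less.hyps[OF _ st'] less.prems(2) by simp
  qed
qed

lemma orientation_compl: "orientation f g S Q \<Longrightarrow> orientation f g S (- Q)"
  by (auto simp: orientation_def)

text \<open>The target \<open>h + 1\<close> is what makes the result a \<open>k\<close>-move when
  \<open>h < k\<close>.\<close>

lemma trim:
  assumes "state R g" "connected_state g" "card R \<ge> h + 1"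
  shows "\<exists>R' g'. state R' g' \<and> connected_state g' \<and> card R' = h + 1"
  using assms
proof (induction "card R" arbitrary: R g rule: less_induct)
  case less
  note st = less.prems(1) and con = less.prems(2)
  show ?case
  proof (cases "card R = h + 1")
    case False
    have g: "fpf_involution g" and gD: "g ` D \<subseteq> D"
      using st by (auto simp: state_def)
    obtain v where v: "v \<in> V"
      using V_nonempty by blast
    have cls: "{w. linked flip g u w} = D" if "u \<in> D" for u
      using linked_D[OF _ that gD] con that unfolding connected_state_def by blast
    obtain Q where Q: "orientation flip g D Q"
    proof -
      have vD: "(v, True) \<in> D"
        using v by simp
      show thesis
        using linked_class_cycle[OF fpf_involution_flip g finite_class[OF vD gD]] that
        unfolding cls[OF vD] by blast
    qed
    \<comment> \<open>Otherwise every tour edge, missing or not, has darts of different colours, so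
      all incoming darts have the same colour and all outgoing darts the other. Every connection
      then joins a tail to a head, against the invariant.\<close>
    have "\<exists>x\<in>R. ((x, True) \<in> Q) = ((s x, False) \<in> Q)"
    proof (rule ccontr)
      assume neg: "\<not> ?thesis"
      have T: "((w, True) \<in> Q) \<noteq> ((w, False) \<in> Q)" if "w \<in> V" for w
      proof -
        have "(flip (w, True) \<in> Q) \<noteq> ((w, True) \<in> Q)"
          using Q that unfolding orientation_def by blast
        then show ?thesis
          by simp
      qed
      have "((w, False) \<in> Q) = ((s w, False) \<in> Q)" if w: "w \<in> V" for w
      proof (cases "w \<in> R")
        case True
        then show ?thesis
          using neg T[OF w] by blast
      next
        case False
        then have "g (w, True) = (s w, False)"
          using st w by (auto simp: state_def)
        then have "((w, True) \<in> Q) \<noteq> ((s w, False) \<in> Q)"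
          using Q w unfolding orientation_def by (metis SigmaI UNIV_I)
        then show ?thesis
          using T[OF w] by blast
      qed
      then have const: "((w, False) \<in> Q) = ((v, False) \<in> Q)" if "w \<in> V" for w
        using cyclic_all[OF v, of "\<lambda>w. ((w, False) \<in> Q) = ((v, False) \<in> Q)"] that by blast
      have mem: "(w, b) \<in> Q \<longleftrightarrow> (b \<noteq> ((v, False) \<in> Q))" if "w \<in> V" for w b
        using const[OF that] T[OF that] by (cases b) auto
      have "snd u \<noteq> snd (g u)" if u: "u \<in> D" for u
      proof -
        obtain w b w' b' where wb: "u = (w, b)" "g u = (w', b')" "w \<in> V" "w' \<in> V"
          using u gD by (metis SigmaE image_subset_iff)
        have "(g u \<in> Q) \<noteq> (u \<in> Q)"
          using Q u by (auto simp: orientation_def)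
        then show ?thesis
          using wb mem by auto
      qed
      then have "homogeneous g = 0"
        unfolding homogeneous_def by (intro sum.neutral) auto
      then show False
        using st less.prems(3) by (simp add: state_def)
    qed
    then obtain x where x: "x \<in> R" and xQ: "((x, True) \<in> Q) = ((s x, False) \<in> Q)"
      by blast
    let ?x = "(x, True)" and ?z = "(s x, False)"
    have xV: "x \<in> V"
      using st x X(1) by (auto simp: state_def)
    then have xD: "?x \<in> D" "?z \<in> D"
      by auto
    \<comment> \<open>Both colour classes are orientations; the one that contains the tail of
      \<open>x\<close> also contains the head.\<close>
    define Q' where "Q' = (if ?x \<in> Q then Q else - Q)"
    have Q': "orientation flip g {u. linked flip g ?x u} Q'" "?x \<in> Q'" "?z \<in> Q'"
      using Q xQ orientation_compl by (auto simp: Q'_def cls[OF xD(1)])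
    have lxz: "linked flip g ?x ?z"
      using con xD by (simp add: connected_state_def)
    have xz: "?z \<noteq> ?x"
      by simp
    note ex = linked_exchange_oriented[OF fpf_involution_flip g finite_class[OF xD(1) gD] Q' xz lxz]
    have st': "state (R - {x}) (exchange g ?x ?z)"
      using ex(2)[OF linked_refl] by (intro state_exchange[OF st x]) auto
    moreover have "connected_state (exchange g ?x ?z)"
      using ex(1) con by (auto simp: connected_state_def)
    moreover have "finite R"
      using st finite_X finite_subset by (auto simp: state_def)
    then have "card R = Suc (card (R - {x}))"
      using card_Suc_Diff1[OF _ x] by simp
    ultimately show ?thesis
      using less.hyps[of "R - {x}" "exchange g ?x ?z"] less.prems(3) False by simp
  qed (use st con in blast)
qed

text \<open>The sum over \<open>X - R\<close> charges each restored edge once beyond its place in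
  the tour, for the detour. Halving turns the doubled lengths into lengths.\<close>

theorem improving_reconnection:
  obtains R q where "R \<subseteq> X" "card R = h + 1" "bij_betw q {..<card V} V"
    "\<And>v. v \<in> V - R \<Longrightarrow> \<exists>i<card V. {q i, q (Suc i mod card V)} = {v, s v}"
    "(\<Sum>i<card V. d (q i) (q (Suc i mod card V))) \<le> (\<Sum>v\<in>V. len v) - (\<Sum>v\<in>R. len v)
       + (\<Sum>v\<in>X - R. len v) + (\<Sum>v\<in>X. d v (\<alpha> v) + d (s v) (s (\<beta> v))) / 2"
proof -
  have "card X \<ge> h + card (circuits full)"
    using card_circuits_full X(2) by simp
  then obtain R g where st: "state R g" and con: "connected_state g" and cR: "card R = h + 1"
    using connect[OF state_full] trim by metis
  have g: "fpf_involution g" and gD: "g ` D \<subseteq> D" and RX: "R \<subseteq> X"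
    using st by (auto simp: state_def)
  note inv = fpf_involutionD[OF g] fpf_involutionD[OF fpf_involution_flip]
  obtain v0 where v0: "v0 \<in> V"
    using V_nonempty by blast
  let ?n = "card V"
  have cls: "{w. linked flip g (v0, True) w} = D"
    using linked_D[OF _ _ gD] con v0 unfolding connected_state_def by blast
  have v0D: "(v0, True) \<in> D"
    using v0 by simp
  obtain p m where m: "m > 0" and p: "p 0 = (v0, True)" "p m = (v0, True)" "\<And>i. p (Suc i) = g (flip (p i))"
    and inj_fst: "inj_on (\<lambda>i. fst (p i)) {..<m}" and D: "D = p ` {..<m} \<union> flip ` p ` {..<m}"
    and ori: "orientation flip g D (p ` {..<m})"
  proof (rule flip_cycle[OF g finite_class[OF v0D gD], unfolded cls], goal_cases)
    case (1 p m)
    from 1(2-) show ?case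
      by (rule 1(1))
  qed
  define Q where "Q = p ` {..<m}"
  note D = D[folded Q_def] and ori = ori[folded Q_def]
  have p_mod: "p (Suc i mod m) = g (flip (p i))" if "i < m" for i
    using that p(1,2) p(3)[of i] by (cases "Suc i = m") auto
  have "flip u \<notin> Q" if "u \<in> Q" for u
    using ori that D unfolding orientation_def by blast
  then have disj: "Q \<inter> flip ` Q = {}"
    by blast
  have p_Q: "p i \<in> Q" if "i < m" for i
    using that by (simp add: Q_def)
  have Q_E: "\<exists>i<m. u = p i" if "u \<in> Q" for u
    using that by (auto simp: Q_def)
  have img: "(\<lambda>i. fst (p i)) ` {..<m} = V"
  proof
    show "(\<lambda>i. fst (p i)) ` {..<m} \<subseteq> V"
    proof (rule image_subsetI)
      fix i assume "i \<in> {..<m}"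
      then have "p i \<in> D"
        using p_Q D by auto
      then show "fst (p i) \<in> V"
        by (simp add: mem_Times_iff)
    qed
    show "V \<subseteq> (\<lambda>i. fst (p i)) ` {..<m}"
    proof
      fix v assume "v \<in> V"
      then have "(v, True) \<in> Q \<union> flip ` Q"
        using D by blast
      then obtain u where "u \<in> Q" "fst u = v"
        by auto
      then show "v \<in> (\<lambda>i. fst (p i)) ` {..<m}"
        using Q_E by blast
    qed
  qed
  have mn: "m = ?n"
    using card_image[OF inj_fst] img by simp
  define q where "q = (\<lambda>i. fst (p i))"
  have q_Suc: "q (Suc i mod m) = fst (g (flip (p i)))" if "i < m" for i
    using p_mod[OF that] by (simp add: q_def)
  have bij: "bij_betw q {..<?n} V"
    using inj_fst img mn by (simp add: bij_betw_def q_def)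
  have kept: "\<exists>i<?n. {q i, q (Suc i mod ?n)} = {v, s v}" if v: "v \<in> V - R" for v
  proof -
    have gv: "g (v, True) = (s v, False)"
      using st v by (auto simp: state_def)
    have vD: "(v, True) \<in> D"
      using v by simp
    show ?thesis
    proof (cases "(v, True) \<in> Q")
      case True
      then have "(s v, False) \<notin> Q"
        using ori vD gv unfolding orientation_def by metis
      moreover have "(s v, False) \<in> D"
        using v by simp
      ultimately obtain i where i: "i < m" "(s v, False) = flip (p i)"
        using D Q_E by blast
      have "g (flip (p i)) = (v, True)"
        using i(2) gv inv(1) by metis
      then have "q (Suc i mod m) = v" "q i = s v"
        using q_Suc[OF i(1)] i(2) by (auto simp: q_def) (metis fst_conv flip_simps(2))
      then show ?thesis
        using i(1) mn by (auto simp: insert_commute)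
    next
      case False
      then obtain i where i: "i < m" "(v, True) = flip (p i)"
        using D vD Q_E by blast
      then have "q (Suc i mod m) = s v" "q i = v"
        using q_Suc[OF i(1)] gv by (auto simp: q_def) (metis fst_conv flip_simps(2))+
      then show ?thesis
        using i(1) mn by auto
    qed
  qed
  \<comment> \<open>\<open>g\<close> interchanges entering darts (\<open>Q\<close>) and leaving
    darts (their flips), so both halves of the sum equal the length of the new tour.\<close>
  have "weight g = 2 * (\<Sum>i<?n. d (q i) (q (Suc i mod ?n)))"
  proof -
    let ?F = "\<lambda>u. d (fst u) (fst (g u))"
    have finQ: "finite Q" "finite (flip ` Q)"
      by (auto simp: Q_def)
    have "weight g = (\<Sum>u\<in>Q. ?F u) + (\<Sum>u\<in>flip ` Q. ?F u)"
      unfolding weight_def D by (rule sum.union_disjoint[OF finQ disj])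
    moreover have "(\<Sum>u\<in>Q. ?F u) = (\<Sum>u\<in>flip ` Q. ?F u)"
    proof (rule sum.reindex_bij_witness[of _ g g])
      fix u assume "u \<in> Q"
      then have u: "u \<in> Q" "u \<in> D"
        using D by auto
      then have "g u \<in> D" "g u \<notin> Q"
        using gD ori by (auto simp: orientation_def)
      then show "g u \<in> flip ` Q"
        using D by auto
    next
      fix u assume "u \<in> flip ` Q"
      then have u: "u \<notin> Q" "u \<in> D"
        using D disj by auto
      then show "g u \<in> Q"
        using ori by (auto simp: orientation_def)
    qed (use inv d_sym in auto)
    moreover have "(\<Sum>u\<in>flip ` Q. ?F u) = (\<Sum>i<m. d (q i) (q (Suc i mod m)))"
    proof -
      have "inj_on flip Q"
        using inv by (auto intro: inj_onI)
      moreover have "inj_on p {..<m}"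
        using inj_fst by (auto simp: inj_on_def)
      ultimately have "(\<Sum>u\<in>flip ` Q. ?F u) = (\<Sum>i<m. ?F (flip (p i)))"
        by (simp add: sum.reindex Q_def)
      also have "\<dots> = (\<Sum>i<m. d (q i) (q (Suc i mod m)))"
        using q_Suc by (intro sum.cong) (auto simp: q_def)
      finally show ?thesis .
    qed
    ultimately show ?thesis
      by (simp add: mn)
  qed
  then have "(\<Sum>i<?n. d (q i) (q (Suc i mod ?n))) \<le> (weight full + 4 * (\<Sum>v\<in>X - R. len v)) / 2"
    using st by (simp add: state_def)
  also have "\<dots> = (\<Sum>v\<in>V. len v) - (\<Sum>v\<in>R. len v)
       + (\<Sum>v\<in>X - R. len v) + (\<Sum>v\<in>X. d v (\<alpha> v) + d (s v) (s (\<beta> v))) / 2"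
  proof -
    have "(a + 4 * y) / 2 = b - z + y + e / 2" if "a = 2 * b - 2 * x + e" "x = y + z" for a b e x y z :: real
      unfolding that by (simp add: add_divide_distrib diff_divide_distrib)
    then show ?thesis
      using weight_full sum.subset_diff[OF RX finite_X] .
  qed
  finally show ?thesis
    using that[OF RX cR bij kept] by simp
qed

end

section \<open>Even edge sets in bipartite multigraphs\<close>

text \<open>The two kinds of ends are counted separately, so \<open>t\<close> and \<open>u\<close>
  may share values: the graph is bipartite by construction, and parallel edges are allowed.\<close>

definition even_set :: "('e \<Rightarrow> 'v) \<Rightarrow> ('e \<Rightarrow> 'w) \<Rightarrow> 'e set \<Rightarrow> bool" where
  "even_set t u Z \<longleftrightarrow> (\<forall>v. even (card {e \<in> Z. t e = v})) \<and> (\<forall>v. even (card {e \<in> Z. u e = v}))"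

text \<open>Supplies the pairings \<open>\<alpha>\<close> and \<open>\<beta>\<close> of an even
  set.\<close>

lemma ex_fibre_involution:
  assumes "finite Z" "\<And>v. even (card {e \<in> Z. t e = v})"
  shows "\<exists>f. \<forall>e\<in>Z. f e \<in> Z \<and> f (f e) = e \<and> f e \<noteq> e \<and> t (f e) = t e"
  using assms
proof (induction "card Z" arbitrary: Z rule: less_induct)
  case less
  show ?case
  proof (cases "Z = {}")
    case False
    then obtain a where a: "a \<in> Z" by blast
    let ?A = "{e \<in> Z. t e = t a}"
    have "?A \<noteq> {a}"
      using less.prems(2)[of "t a"] by auto
    then obtain b where b: "b \<in> Z" "t b = t a" "b \<noteq> a"
      using a by blast
    let ?Z = "Z - {a, b}"
    have "card ?Z < card Z"
      using a less.prems(1) by (intro psubset_card_mono) auto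
    moreover have "even (card {e \<in> ?Z. t e = v})" for v
    proof (cases "v = t a")
      case True
      then have "{e \<in> ?Z. t e = v} = ?A - {a, b}"
        by auto
      then have "card {e \<in> ?Z. t e = v} = card ?A - 2"
        using a b less.prems(1) card_Diff_subset[of "{a, b}" ?A] by simp
      then show ?thesis
        using less.prems(2)[of "t a"] by simp
    next
      case False
      then have "{e \<in> ?Z. t e = v} = {e \<in> Z. t e = v}"
        using b by auto
      then show ?thesis
        using less.prems(2)[of v] by simp
    qed
    ultimately obtain f where f: "\<forall>e\<in>?Z. f e \<in> ?Z \<and> f (f e) = e \<and> f e \<noteq> e \<and> t (f e) = t e"
      using less.hyps[of ?Z] less.prems(1) by auto
    let ?f = "f(a := b, b := a)"
    have "\<forall>e\<in>Z. ?f e \<in> Z \<and> ?f (?f e) = e \<and> ?f e \<noteq> e \<and> t (?f e) = t e"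
    proof
      fix e assume "e \<in> Z"
      then consider "e = a" | "e = b" | "e \<in> ?Z"
        by blast
      then show "?f e \<in> Z \<and> ?f (?f e) = e \<and> ?f e \<noteq> e \<and> t (?f e) = t e"
      proof cases
        case 3
        then have "f e \<in> ?Z" "f (f e) = e" "f e \<noteq> e" "t (f e) = t e"
          using f by blast+
        then show ?thesis
          using 3 by auto
      qed (use a b in auto)
    qed
    then show ?thesis
      by blast
  qed simp
qed

section \<open>A Moore bound by counting trails\<close>

lemma ex_min_degree_subset:
  fixes \<delta> :: real and t u :: "'e \<Rightarrow> 'v"
  assumes "finite M" "M \<noteq> {}" "\<delta> > 0"
    and "\<delta> * (real (card (t ` M)) + real (card (u ` M))) \<le> real (card M)"
  obtains M' where "M' \<subseteq> M" "M' \<noteq> {}"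
    "\<And>e. e \<in> M' \<Longrightarrow> \<delta> \<le> real (card {e' \<in> M'. t e' = t e})"
    "\<And>e. e \<in> M' \<Longrightarrow> \<delta> \<le> real (card {e' \<in> M'. u e' = u e})"
proof -
  define good where "good A \<longleftrightarrow> A \<subseteq> M \<and> A \<noteq> {} \<and>
    \<delta> * (real (card (t ` A)) + real (card (u ` A))) \<le> real (card A)" for A
  have "good M"
    using assms by (simp add: good_def)
  \<comment> \<open>Take a smallest nonempty set that is this dense on average. Deleting all edges
    at a vertex of degree below \<open>\<delta>\<close> loses one vertex and fewer than
    \<open>\<delta>\<close> edges, so it would leave a smaller such set.\<close>
  then obtain A where A: "good A" and min: "\<And>B. good B \<Longrightarrow> card A \<le> card B"
    using ex_has_least_nat[of good M card] by auto
  have finA: "finite A"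
    using A assms(1) finite_subset by (auto simp: good_def)
  have deg: "\<delta> \<le> real (card {e' \<in> A. f e' = f e})"
    if e: "e \<in> A" and fg: "(f, g) = (t, u) \<or> (f, g) = (u, t)" for e f g
  proof (rule ccontr)
    assume neg: "\<not> ?thesis"
    let ?S = "{e' \<in> A. f e' = f e}"
    let ?B = "A - ?S"
    have cA: "\<delta> * (real (card (f ` A)) + real (card (g ` A))) \<le> real (card A)"
      using A fg by (auto simp: good_def add.commute)
    have cB: "real (card A) = real (card ?B) + real (card ?S)"
      using card_Diff_subset[of ?S A] card_mono[of A ?S] finA by simp
    have fB: "f ` A = insert (f e) (f ` ?B)" "f e \<notin> f ` ?B"
      using e by auto
    have "card (f ` A) = Suc (card (f ` ?B))"
      unfolding fB(1) using fB(2) finA by simp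
    moreover have "card (g ` ?B) \<le> card (g ` A)"
      using finA by (intro card_mono) auto
    ultimately have "\<delta> * (real (card (f ` ?B)) + real (card (g ` ?B))) + \<delta> \<le>
        \<delta> * (real (card (f ` A)) + real (card (g ` A)))"
      using assms(3) by (simp add: algebra_simps)
    then have less: "\<delta> * (real (card (f ` ?B)) + real (card (g ` ?B))) < real (card ?B)"
      using cA cB neg by linarith
    moreover have "0 \<le> \<delta> * (real (card (f ` ?B)) + real (card (g ` ?B)))"
      using assms(3) by simp
    ultimately have "?B \<noteq> {}"
      by force
    moreover have "?B \<subseteq> M"
      using A by (auto simp: good_def)
    ultimately have "good ?B"
      unfolding good_def using less fg by (auto simp: add.commute)
    then have "card A \<le> card ?B"
      by (rule min)
    moreover have "card ?B < card A"
      using e finA by (intro psubset_card_mono) auto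
    ultimately show False
      by simp
  qed
  show ?thesis
    using that[of A] A deg[of _ t u] deg[of _ u t] by (auto simp: good_def)
qed

text \<open>Trails are listed backwards; they leave the \<open>t\<close>-vertex \<open>r\<close> and alternate between the two sides.\<close>

definition trail_end :: "('e \<Rightarrow> 'v) \<Rightarrow> ('e \<Rightarrow> 'v) \<Rightarrow> 'v \<Rightarrow> 'e list \<Rightarrow> 'v" where
  "trail_end t u r es = (case es of [] \<Rightarrow> r | e # _ \<Rightarrow> if even (length es) then t e else u e)"

fun is_trail :: "'e set \<Rightarrow> ('e \<Rightarrow> 'v) \<Rightarrow> ('e \<Rightarrow> 'v) \<Rightarrow> 'v \<Rightarrow> 'e list \<Rightarrow> bool" where
  "is_trail M t u r [] = True"
| "is_trail M t u r (e # es) = (is_trail M t u r es \<and> e \<in> M \<and> e \<notin> set es \<and>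
     (if even (length es) then t e else u e) = trail_end t u r es)"

lemma is_trail_set: "is_trail M t u r es \<Longrightarrow> set es \<subseteq> M \<and> distinct es"
  by (induction es) auto

lemma card_fibre_insert:
  assumes "finite S" "e \<notin> S"
  shows "card {x \<in> insert e S. f x = v} = card {x \<in> S. f x = v} + of_bool (f e = v)"
proof -
  have "{x \<in> insert e S. f x = v} = (if f e = v then insert e {x \<in> S. f x = v} else {x \<in> S. f x = v})"
    by auto
  then show ?thesis
    using assms by simp
qed

text \<open>A trail has even degree at its inner vertices. The exclusive or covers closed trails,
  where start and end cancel.\<close>

lemma trail_parity:
  assumes "is_trail M t u r es"
  shows "(odd (card {e \<in> set es. t e = v}) \<longleftrightarrow> (v = r) \<noteq> (even (length es) \<and> v = trail_end t u r es)) \<and>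
    (odd (card {e \<in> set es. u e = v}) \<longleftrightarrow> odd (length es) \<and> v = trail_end t u r es)"
  using assms
proof (induction es)
  case (Cons e es)
  have prems: "is_trail M t u r es" "e \<notin> set es"
    "(if even (length es) then t e else u e) = trail_end t u r es"
    using Cons.prems by auto
  have ins: "card {x \<in> set (e # es). f x = v} = card {x \<in> set es. f x = v} + of_bool (f e = v)"
    for f :: "'a \<Rightarrow> 'b"
    using card_fibre_insert[of "set es" e f v] prems(2) by simp
  have end_eq: "trail_end t u r (e # es) = (if even (length es) then u e else t e)"
    by (simp add: trail_end_def)
  show ?case
    unfolding ins end_eq using prems(3) Cons.IH[OF prems(1)]
    by (cases "even (length es)") (auto simp del: set_simps)
qed (auto simp: trail_end_def)

text \<open>At most \<open>K\<close> of the edges at the end of a trail have been used already, so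
  each trail extends in at least \<open>\<delta> - K\<close> ways.\<close>

lemma card_trails_ge:
  fixes \<delta> :: real
  assumes M: "finite M" "e0 \<in> M" "r = t e0"
    and deg: "\<And>e. e \<in> M \<Longrightarrow> \<delta> \<le> real (card {e' \<in> M. t e' = t e})"
      "\<And>e. e \<in> M \<Longrightarrow> \<delta> \<le> real (card {e' \<in> M. u e' = u e})"
    and "real K \<le> \<delta>" "j \<le> K"
  shows "(\<delta> - real K) ^ j \<le> real (card {es. is_trail M t u r es \<and> length es = j})"
  using assms(7)
proof (induction j)
  case 0
  have "{es. is_trail M t u r es \<and> length es = 0} = {[]}"
    by auto
  then show ?case
    by simp
next
  case (Suc j)
  let ?W = "\<lambda>j. {es. is_trail M t u r es \<and> length es = j}"
  have finW: "finite (?W j)" for j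
    using is_trail_set by (intro finite_subset[OF _ finite_lists_length_eq[OF M(1), of j]]) fast
  define ext where "ext es = {e \<in> M. e \<notin> set es \<and>
    (if even (length es) then t e else u e) = trail_end t u r es}" for es
  have ext: "\<delta> - real K \<le> real (card (ext es))" if es: "es \<in> ?W j" for es
  proof -
    let ?f = "if even (length es) then t else u"
    have "\<delta> \<le> real (card {e \<in> M. ?f e = trail_end t u r es})"
    proof (cases es)
      case Nil
      then show ?thesis
        using deg(1)[OF M(2)] M(3) by (simp add: trail_end_def)
    next
      case (Cons e es')
      then have "e \<in> M"
        using es by auto
      then show ?thesis
        using deg[of e] Cons by (auto simp: trail_end_def)
    qed
    moreover have "card {e \<in> M. ?f e = trail_end t u r es} \<le> card (ext es) + card (set es)"
    proof -
      have "card {e \<in> M. ?f e = trail_end t u r es} \<le> card (ext es \<union> set es)"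
        using M(1) by (intro card_mono) (auto simp: ext_def)
      then show ?thesis
        using card_Un_le[of "ext es" "set es"] by simp
    qed
    moreover have "card (set es) \<le> K"
      using es card_length[of es] Suc.prems by simp
    ultimately show ?thesis
      by linarith
  qed
  have W: "?W (Suc j) = (\<lambda>(es, e). e # es) ` (SIGMA es:?W j. ext es)"
    by (force simp: length_Suc_conv ext_def image_iff)
  have "card (?W (Suc j)) = card (SIGMA es:?W j. ext es)"
    unfolding W by (rule card_image) (auto simp: inj_on_def)
  also have "\<dots> = (\<Sum>es\<in>?W j. card (ext es))"
    using finW[of j] M(1) by (intro card_SigmaI) (auto simp: ext_def)
  finally have "real (card (?W (Suc j))) = (\<Sum>es\<in>?W j. real (card (ext es)))"
    by simp
  moreover have "real (card (?W j)) * (\<delta> - real K) \<le> (\<Sum>es\<in>?W j. real (card (ext es)))"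
    using sum_mono[of "?W j" "\<lambda>_. \<delta> - real K" "\<lambda>es. real (card (ext es))"] ext by simp
  moreover have "(\<delta> - real K) ^ j * (\<delta> - real K) \<le> real (card (?W j)) * (\<delta> - real K)"
    using Suc assms(6) by (intro mult_right_mono) auto
  ultimately show ?case
    by (simp add: mult.commute)
qed

text \<open>Moore bound: the symmetric difference of two trails with the same ends is even, and a given set of
  \<open>K\<close> edges carries at most \<open>K ^ K\<close> trails.\<close>

lemma min_degree_le_of_no_even_set:
  fixes \<delta> :: real and t u :: "'e \<Rightarrow> 'v"
  assumes M: "finite M" "M \<noteq> {}" "K > 0"
    and deg: "\<And>e. e \<in> M \<Longrightarrow> \<delta> \<le> real (card {e' \<in> M. t e' = t e})"
      "\<And>e. e \<in> M \<Longrightarrow> \<delta> \<le> real (card {e' \<in> M. u e' = u e})"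
    and "real K \<le> \<delta>" and N: "card (t ` M) \<le> N" "card (u ` M) \<le> N"
    and no: "\<And>Z. Z \<subseteq> M \<Longrightarrow> Z \<noteq> {} \<Longrightarrow> card Z \<le> 2 * K \<Longrightarrow> \<not> even_set t u Z"
  shows "(\<delta> - real K) ^ K \<le> real N * real K ^ K"
proof -
  obtain e0 where e0: "e0 \<in> M"
    using M by blast
  let ?r = "t e0"
  let ?W = "{es. is_trail M t u ?r es \<and> length es = K}"
  let ?end = "trail_end t u ?r"
  have finW: "finite ?W"
    using is_trail_set by (intro finite_subset[OF _ finite_lists_length_eq[OF M(1), of K]]) fast
  have same: "set es = set es'" if es: "es \<in> ?W" "es' \<in> ?W" "?end es = ?end es'" for es es'
  proof (rule ccontr)
    assume neq: "set es \<noteq> set es'"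
    let ?Z = "(set es - set es') \<union> (set es' - set es)"
    have ev: "even (card {e \<in> ?Z. f e = v})"
      if "odd (card {e \<in> set es. f e = v}) = odd (card {e \<in> set es'. f e = v})" for f :: "'e \<Rightarrow> 'v" and v
    proof -
      let ?A = "{e \<in> set es. f e = v}" and ?B = "{e \<in> set es'. f e = v}"
      have "{e \<in> ?Z. f e = v} = (?A - ?B) \<union> (?B - ?A)"
        by auto
      moreover have "card ((?A - ?B) \<union> (?B - ?A)) = card (?A - ?B) + card (?B - ?A)"
        by (intro card_Un_disjoint) auto
      moreover have "card ?A = card (?A - ?B) + card (?A \<inter> ?B)" "card ?B = card (?B - ?A) + card (?A \<inter> ?B)"
        using card_Diff_subset_Int[of ?A ?B] card_Diff_subset_Int[of ?B ?A]
          card_mono[of ?A "?A \<inter> ?B"] card_mono[of ?B "?A \<inter> ?B"] by (auto simp: Int_commute)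
      ultimately show ?thesis
        using that by simp presburger
    qed
    have "odd (card {e \<in> set es. t e = v}) = odd (card {e \<in> set es'. t e = v})"
      "odd (card {e \<in> set es. u e = v}) = odd (card {e \<in> set es'. u e = v})" for v
      using es trail_parity[of M t u ?r es v] trail_parity[of M t u ?r es' v] by simp_all
    then have "even_set t u ?Z"
      unfolding even_set_def by (intro allI conjI ev)
    moreover have "card ?Z \<le> 2 * K"
    proof -
      have "card ?Z \<le> card (set es \<union> set es')"
        by (intro card_mono) auto
      also have "\<dots> \<le> card (set es) + card (set es')"
        by (rule card_Un_le)
      also have "\<dots> \<le> 2 * K"
        using es card_length[of es] card_length[of es'] by simp
      finally show ?thesis .
    qed
    moreover have "?Z \<subseteq> M"
      using es is_trail_set[of M t u ?r es] is_trail_set[of M t u ?r es'] by auto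
    moreover have "?Z \<noteq> {}"
      using neq by auto
    ultimately show False
      using no by blast
  qed
  have fibre: "card {es \<in> ?W. ?end es = v} \<le> K ^ K" for v
  proof (cases "{es \<in> ?W. ?end es = v} = {}")
    case False
    then obtain es where es: "es \<in> ?W" "?end es = v"
      by blast
    have "card {es' \<in> ?W. ?end es' = v} \<le> card {es'. set es' \<subseteq> set es \<and> length es' = K}"
    proof (rule card_mono)
      show "finite {es'. set es' \<subseteq> set es \<and> length es' = K}"
        by (intro finite_lists_length_eq) simp
      show "{es' \<in> ?W. ?end es' = v} \<subseteq> {es'. set es' \<subseteq> set es \<and> length es' = K}"
      proof
        fix es' assume "es' \<in> {es' \<in> ?W. ?end es' = v}"
        then have es': "es' \<in> ?W" "?end es' = ?end es"
          using es(2) by simp_all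
        show "es' \<in> {es'. set es' \<subseteq> set es \<and> length es' = K}"
          using same[OF es'(1) es(1) es'(2)] es'(1) by simp
      qed
    qed
    also have "\<dots> = card (set es) ^ K"
      by (simp add: card_lists_length_eq)
    also have "\<dots> \<le> K ^ K"
      using es card_length[of es] by (intro power_mono) auto
    finally show ?thesis .
  next
    case True
    show ?thesis
      unfolding True by simp
  qed
  have ends: "?end ` ?W \<subseteq> (if even K then t else u) ` M"
  proof (rule image_subsetI)
    fix es assume "es \<in> ?W"
    then obtain e es' where "es = e # es'" "e \<in> M" "length es = K"
      using M(3) by (cases es) auto
    then show "?end es \<in> (if even K then t else u) ` M"
      by (auto simp: trail_end_def)
  qed
  have "card ?W = (\<Sum>v\<in>?end ` ?W. card {es \<in> ?W. ?end es = v})"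
    using sum.image_gen[OF finW, of "\<lambda>_. 1::nat" ?end] by simp
  also have "\<dots> \<le> card (?end ` ?W) * K ^ K"
    using sum_mono[of "?end ` ?W" _ "\<lambda>_. K ^ K"] fibre by simp
  also have "card (?end ` ?W) \<le> N"
    using card_mono[OF _ ends] N M(1) by (cases "even K") auto
  finally have "card ?W \<le> N * K ^ K"
    by simp
  then have "real (card ?W) \<le> real N * real K ^ K"
    by (metis of_nat_le_iff of_nat_mult of_nat_power)
  then show ?thesis
    using card_trails_ge[of M e0 ?r t \<delta> u K K] M e0 deg assms(6) by auto
qed

text \<open>About \<open>\<rho> ^ K\<close> vertices allow only about \<open>\<rho> ^ Suc K\<close>
  edges: the exponent \<open>1 + 1 / K\<close> without fractional powers. The trail count is applied
  to a subgraph whose degrees are at least half of \<open>card M / N\<close>.\<close>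

theorem card_le_of_no_even_set:
  fixes \<rho> :: real and t u :: "'e \<Rightarrow> 'v"
  assumes M: "finite M" and K: "K > 0" and \<rho>: "\<rho> \<ge> 1" and A: "A \<ge> 1"
    and N: "card (t ` M) \<le> N" "card (u ` M) \<le> N" "real N \<le> A * \<rho> ^ K"
    and no: "\<And>Z. Z \<subseteq> M \<Longrightarrow> Z \<noteq> {} \<Longrightarrow> card Z \<le> 2 * K \<Longrightarrow> \<not> even_set t u Z"
  shows "real (card M) \<le> 4 * real K * A\<^sup>2 * \<rho> ^ Suc K"
proof (cases "M = {}")
  case False
  have N0: "N > 0"
    using N(1) False M by (metis card_gt_0_iff finite_imageI image_is_empty less_le_trans)
  define \<delta> where "\<delta> = real (card M) / (2 * real N)"
  have \<delta>0: "\<delta> > 0"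
    using False M N0 by (simp add: \<delta>_def card_gt_0_iff)
  have "\<delta> * (real (card (t ` M)) + real (card (u ` M))) \<le> \<delta> * (2 * real N)"
    using N \<delta>0 by (intro mult_left_mono) auto
  also have "\<dots> = real (card M)"
    using N0 by (simp add: \<delta>_def)
  finally obtain M' where M': "M' \<subseteq> M" "M' \<noteq> {}"
    "\<And>e. e \<in> M' \<Longrightarrow> \<delta> \<le> real (card {e' \<in> M'. t e' = t e})"
    "\<And>e. e \<in> M' \<Longrightarrow> \<delta> \<le> real (card {e' \<in> M'. u e' = u e})"
    using ex_min_degree_subset[OF M False \<delta>0] by blast
  have K1: "real K \<le> real K * (A * \<rho>)"
    using mult_mono[OF A \<rho>] A \<rho> by (simp add: mult_le_cancel_left1)
  have "\<delta> \<le> 2 * real K * (A * \<rho>)"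
  proof (cases "real K \<le> \<delta>")
    case True
    have "card (t ` M') \<le> N" "card (u ` M') \<le> N"
      using card_mono[OF finite_imageI[OF M] image_mono[OF M'(1)]] N(1,2) le_trans by blast+
    then have "(\<delta> - real K) ^ K \<le> real N * real K ^ K"
      using M'(1) no finite_subset[OF M'(1) M]
      by (intro min_degree_le_of_no_even_set[OF _ M'(2) K M'(3,4) True]) auto
    also have "\<dots> \<le> (A * \<rho> ^ K) * real K ^ K"
      using N(3) by (intro mult_right_mono) auto
    also have "\<dots> \<le> (A ^ K * \<rho> ^ K) * real K ^ K"
      using A K \<rho> self_le_power[of A K] by (intro mult_right_mono) auto
    also have "\<dots> = (real K * (A * \<rho>)) ^ K"
      by (simp add: power_mult_distrib)
    finally have "\<delta> - real K \<le> real K * (A * \<rho>)"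
      using A \<rho> K power_le_imp_le_base[of "\<delta> - real K" "K - 1" "real K * (A * \<rho>)"] by simp
    then show ?thesis
      using K1 by linarith
  next
    case False
    then show ?thesis
      using K1 by linarith
  qed
  then have "real (card M) \<le> (2 * real K * (A * \<rho>)) * (2 * real N)"
    using N0 by (simp add: \<delta>_def pos_divide_le_eq)
  also have "\<dots> \<le> (2 * real K * (A * \<rho>)) * (2 * (A * \<rho> ^ K))"
    using N(3) A \<rho> by (intro mult_left_mono) auto
  also have "\<dots> = 4 * real K * A\<^sup>2 * \<rho> ^ Suc K"
    by (simp add: power2_eq_square algebra_simps)
  finally show ?thesis .
qed (use A \<rho> in simp)

section \<open>Closed trails\<close>

text \<open>The circuits of darts are reused: the darts of an edge are now its two ends,
  \<open>flip\<close> runs along the edge, and \<open>g\<close> passes to the paired edge at the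
  same vertex. Starting at a \<open>u\<close>-end puts the transitions after even indices at
  \<open>t\<close>-vertices.\<close>

lemma even_set_cycle:
  assumes "finite Z" "Z \<noteq> {}" "even_set t u Z"
  obtains r :: nat and es where "r > 0" "inj_on es {..<2 * r}" "es ` {..<2 * r} \<subseteq> Z"
    "\<And>i. i < r \<Longrightarrow> t (es (2 * i)) = t (es (2 * i + 1))"
    "\<And>i. i < r \<Longrightarrow> u (es (2 * i + 1)) = u (es ((2 * i + 2) mod (2 * r)))"
proof -
  obtain \<alpha> where \<alpha>: "\<forall>e\<in>Z. \<alpha> e \<in> Z \<and> \<alpha> (\<alpha> e) = e \<and> \<alpha> e \<noteq> e \<and> t (\<alpha> e) = t e"
    using ex_fibre_involution[OF assms(1), of t] assms(3) unfolding even_set_def by blast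
  obtain \<beta> where \<beta>: "\<forall>e\<in>Z. \<beta> e \<in> Z \<and> \<beta> (\<beta> e) = e \<and> \<beta> e \<noteq> e \<and> u (\<beta> e) = u e"
    using ex_fibre_involution[OF assms(1), of u] assms(3) unfolding even_set_def by blast
  define g where "g w = (if fst w \<in> Z then if snd w then (\<alpha> (fst w), True) else (\<beta> (fst w), False) else flip w)" for w
  have g: "fpf_involution g"
    unfolding fpf_involution_def
  proof
    fix w show "g (g w) = w \<and> g w \<noteq> w"
      using \<alpha> \<beta> by (cases w; cases "fst w \<in> Z"; cases "snd w") (auto simp: g_def)
  qed
  have gT: "g (e, True) = (\<alpha> e, True)" and gF: "g (e, False) = (\<beta> e, False)" if "e \<in> Z" for e
    using that by (auto simp: g_def)
  have closed: "flip w \<in> Z \<times> UNIV \<and> g w \<in> Z \<times> UNIV" if "w \<in> Z \<times> UNIV" for w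
    using that \<alpha> \<beta> by (cases w; cases "snd w") (auto simp: gT gF)
  obtain z0 where z0: "z0 \<in> Z"
    using assms(2) by blast
  have "{w. linked flip g (z0, False) w} \<subseteq> Z \<times> UNIV"
    using linked_closed[of flip g "(z0, False)" _ "Z \<times> UNIV"] z0 closed by blast
  then have fin: "finite {w. linked flip g (z0, False) w}"
    using assms(1) by (meson finite_SigmaI finite_UNIV finite_subset)
  obtain p m where m: "m > 0" and p: "p 0 = (z0, False)" "p m = (z0, False)" "\<And>i. p (Suc i) = g (flip (p i))"
    and inj: "inj_on (\<lambda>i. fst (p i)) {..<m}"
  proof (rule flip_cycle[OF g fin], goal_cases)
    case (1 p m)
    show ?case
      by (rule 1(1)[OF 1(2-6)])
  qed
  define es where "es i = fst (p i)" for i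
  have es: "es i \<in> Z" "p i = (es i, odd i)" for i
  proof (induction i)
    case 0
    show "es 0 \<in> Z" "p 0 = (es 0, odd 0)"
      using p(1) z0 by (auto simp: es_def)
  next
    case (Suc i)
    have "p (Suc i) = g (es i, even i)"
      unfolding p(3) using Suc(2) by simp
    then show "es (Suc i) \<in> Z" "p (Suc i) = (es (Suc i), odd (Suc i))"
      using Suc(1) \<alpha> \<beta> by (cases "even i"; simp add: es_def gT gF)+
  qed
  have es_Suc: "es (Suc i) = (if even i then \<alpha> (es i) else \<beta> (es i))" for i
    using p(3)[of i] es[of i] es(2)[of "Suc i"] gT gF by (cases "even i") auto
  \<comment> \<open>The kind of end alternates along the circuit.\<close>
  have "even m"
    using es(2)[of m] p(2) by auto
  then obtain r where r: "m = 2 * r"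
    by (elim evenE)
  have per: "es m = es 0"
    using p(1,2) by (simp add: es_def)
  show ?thesis
  proof (rule that[of r es])
    show "r > 0"
      using m r by simp
    show "inj_on es {..<2 * r}"
      using inj r by (simp add: es_def inj_on_def)
    show "es ` {..<2 * r} \<subseteq> Z"
      using es(1) by blast
    show "t (es (2 * i)) = t (es (2 * i + 1))" for i
      using es_Suc[of "2 * i"] es(1)[of "2 * i"] \<alpha> by simp
    show "u (es (2 * i + 1)) = u (es ((2 * i + 2) mod (2 * r)))" if "i < r" for i
    proof -
      have "es ((2 * i + 2) mod (2 * r)) = es (Suc (2 * i + 1))"
        using that per r by (cases "i + 1 = r") auto
      then show ?thesis
        using es_Suc[of "2 * i + 1"] es(1)[of "2 * i + 1"] \<beta> by simp
    qed
  qed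
qed

locale regular_bipartite =
  fixes E :: "'e set" and t u :: "'e \<Rightarrow> 'v" and deg :: nat
  assumes finite_E: "finite E" and E_nonempty: "E \<noteq> {}" and disjoint: "\<And>e e'. t e \<noteq> u e'"
    and deg: "\<And>e. e \<in> E \<Longrightarrow> card {e' \<in> E. t e' = t e} = deg"
      "\<And>e. e \<in> E \<Longrightarrow> card {e' \<in> E. u e' = u e} = deg"
    and even_deg: "even deg"
begin

definition vertex :: "'e \<times> bool \<Rightarrow> 'v" where
  "vertex w = (if snd w then t (fst w) else u (fst w))"

lemma vertex_simps [simp]: "vertex (e, True) = t e" "vertex (e, False) = u e"
  by (simp_all add: vertex_def)

text \<open>A transition system at the vertices with as few circuits as possible links all edges that share
  a vertex, so each of its circuits is an Eulerian circuit of a component.\<close>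

lemma ex_eulerian_transitions:
  obtains g where "fpf_involution g" "g ` (E \<times> UNIV) \<subseteq> E \<times> UNIV"
    "\<And>w. w \<in> E \<times> UNIV \<Longrightarrow> vertex (g w) = vertex w"
    "\<And>w z. w \<in> E \<times> UNIV \<Longrightarrow> z \<in> E \<times> UNIV \<Longrightarrow> vertex w = vertex z \<Longrightarrow> linked flip g w z"
proof -
  let ?D = "E \<times> (UNIV :: bool set)"
  define good where "good g \<longleftrightarrow> fpf_involution g \<and> g ` ?D \<subseteq> ?D \<and> (\<forall>w\<in>?D. vertex (g w) = vertex w)" for g
  have even_fibre: "even (card {e \<in> E. f e = v})"
    if "\<And>e. e \<in> E \<Longrightarrow> card {e' \<in> E. f e' = f e} = deg" for f :: "'e \<Rightarrow> 'v" and v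
  proof (cases "{e \<in> E. f e = v} = {}")
    case True
    show ?thesis
      unfolding True by simp
  next
    case False
    then obtain e where "e \<in> E" "f e = v"
      by blast
    then show ?thesis
      using that[of e] even_deg by simp
  qed
  obtain \<alpha> where \<alpha>: "\<forall>e\<in>E. \<alpha> e \<in> E \<and> \<alpha> (\<alpha> e) = e \<and> \<alpha> e \<noteq> e \<and> t (\<alpha> e) = t e"
    using ex_fibre_involution[OF finite_E even_fibre[OF deg(1)]] by blast
  obtain \<beta> where \<beta>: "\<forall>e\<in>E. \<beta> e \<in> E \<and> \<beta> (\<beta> e) = e \<and> \<beta> e \<noteq> e \<and> u (\<beta> e) = u e"
    using ex_fibre_involution[OF finite_E even_fibre[OF deg(2)]] by blast
  define g0 where "g0 w = (if fst w \<in> E then if snd w then (\<alpha> (fst w), True) else (\<beta> (fst w), False) else flip w)" for w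
  have "fpf_involution g0"
    unfolding fpf_involution_def
  proof
    fix w show "g0 (g0 w) = w \<and> g0 w \<noteq> w"
      using \<alpha> \<beta> by (cases w; cases "fst w \<in> E"; cases "snd w") (auto simp: g0_def)
  qed
  moreover have "g0 w \<in> ?D" "vertex (g0 w) = vertex w" if "w \<in> ?D" for w
    using that \<alpha> \<beta> by (cases w; cases "snd w"; simp add: g0_def)+
  ultimately have "good g0"
    unfolding good_def image_subset_iff by blast
  then obtain g where g: "good g"
    and min: "\<And>g'. good g' \<Longrightarrow> card (linked_classes flip g ?D) \<le> card (linked_classes flip g' ?D)"
    using ex_has_least_nat[of good g0 "\<lambda>g. card (linked_classes flip g ?D)"] by auto
  have gf: "fpf_involution g" and gD: "g ` ?D \<subseteq> ?D" and gv: "\<And>w. w \<in> ?D \<Longrightarrow> vertex (g w) = vertex w"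
    using g by (auto simp: good_def)
  have "linked flip g w z" if wz: "w \<in> ?D" "z \<in> ?D" "vertex w = vertex z" for w z
  proof (rule ccontr)
    assume nl: "\<not> linked flip g w z"
    have neq: "z \<noteq> w" "z \<noteq> g w"
      using nl linked_step2[of flip g w] by auto
    note simps = exchange_simps[OF gf neq]
    have "exchange g w z v \<in> ?D \<and> vertex (exchange g w z v) = vertex v" if v: "v \<in> ?D" for v
    proof -
      have D: "g w \<in> ?D" "g z \<in> ?D" "g v \<in> ?D"
        using wz v gD by blast+
      have V: "vertex (g w) = vertex w" "vertex (g z) = vertex w" "vertex (g v) = vertex v"
        using gv wz v by auto
      consider "v = w" | "v = z" | "v = g w" | "v = g z" | "v \<notin> {w, z, g w, g z}"
        by blast
      then show ?thesis
        using D V wz simps by cases auto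
    qed
    then have "good (exchange g w z)"
      using fpf_involution_exchange[OF gf neq] unfolding good_def image_subset_iff by blast
    moreover have "card (linked_classes flip (exchange g w z) ?D) < card (linked_classes flip g ?D)"
    proof (rule card_linked_classes_exchange[OF fpf_involution_flip gf _ _ _ _ nl])
      show "flip v \<in> ?D \<and> g v \<in> ?D" if "v \<in> ?D" for v
        using that gD by (auto simp: flip_def)
    qed (use wz finite_E in auto)
    ultimately show False
      using min[of "exchange g w z"] by simp
  qed
  then show ?thesis
    using that[OF gf gD gv] by simp
qed

text \<open>The circuit contains every edge at each vertex that it meets, so it has exactly
  \<open>m / deg\<close> vertices on either side. The trail thus returns to a vertex about
  \<open>deg / 2\<close> times, which becomes the ratio of the two tours.\<close>

lemma closed_trail:
  obtains m es w where "m > 0" "inj_on es {..<m}" "es ` {..<m} \<subseteq> E"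
    "\<And>i. i < m \<Longrightarrow> {t (es i), u (es i)} = {w i, w (Suc i)}" "w m = w 0"
    "card (w ` {..<m}) * deg \<le> 2 * m"
proof -
  let ?D = "E \<times> (UNIV :: bool set)"
  obtain g where g: "fpf_involution g" and gD: "g ` ?D \<subseteq> ?D"
    and gv: "\<And>w. w \<in> ?D \<Longrightarrow> vertex (g w) = vertex w"
    and link: "\<And>w z. w \<in> ?D \<Longrightarrow> z \<in> ?D \<Longrightarrow> vertex w = vertex z \<Longrightarrow> linked flip g w z"
  proof (rule ex_eulerian_transitions, goal_cases)
    case (1 g)
    from 1(2-) show ?case
      by (rule 1(1))
  qed
  obtain e0 where e0: "e0 \<in> E"
    using E_nonempty by blast
  let ?x = "(e0, True)"
  have closed: "flip w \<in> ?D" "g w \<in> ?D" if "w \<in> ?D" for w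
    using that gD by (auto simp: flip_def)
  have cD: "{w. linked flip g ?x w} \<subseteq> ?D"
    using linked_closed[of flip g ?x _ ?D] e0 closed by blast
  then have fin: "finite {w. linked flip g ?x w}"
    using finite_E by (meson finite_SigmaI finite_UNIV finite_subset)
  obtain p m where m: "m > 0" and p: "p 0 = ?x" "p m = ?x" "\<And>i. p (Suc i) = g (flip (p i))"
    and inj: "inj_on (\<lambda>i. fst (p i)) {..<m}"
    and cls: "{w. linked flip g ?x w} = p ` {..<m} \<union> flip ` p ` {..<m}"
  proof (rule flip_cycle[OF g fin], goal_cases)
    case (1 p m)
    show ?case
      by (rule 1(1)[OF 1(2-7)])
  qed
  define es where "es = (\<lambda>i. fst (p i))"
  define w where "w = (\<lambda>i. vertex (p i))"
  let ?S = "es ` {..<m}"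
  have pD: "p i \<in> ?D" for i
    by (induction i) (use e0 p closed in auto)
  have esE: "es i \<in> E" for i
    using pD[of i] by (auto simp: es_def)
  have in_S: "fst v \<in> ?S" if "linked flip g ?x v" for v
  proof -
    have "v \<in> p ` {..<m} \<union> flip ` p ` {..<m}"
      using that cls by blast
    then show ?thesis
      by (auto simp: es_def)
  qed
  have S_linked: "linked flip g ?x (e, b)" if eS: "e \<in> ?S" for e b
  proof -
    obtain i where i: "i < m" "e = fst (p i)"
      using eS by (auto simp: es_def)
    have "linked flip g ?x (p i)" "linked flip g ?x (flip (p i))"
      using cls i(1) by blast+
    moreover have "(e, b) = p i \<or> (e, b) = flip (p i)"
      unfolding i(2) by (cases "p i") auto
    ultimately show ?thesis
      by metis
  qed
  have sat: "e \<in> ?S" if "e \<in> E" "e' \<in> ?S" "vertex (e, b) = vertex (e', b)" for e e' b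
  proof -
    have "linked flip g (e', b) (e, b)"
      using that esE by (intro link) auto
    then have "linked flip g ?x (e, b)"
      using S_linked[OF that(2), of b] linked_trans by metis
    then show ?thesis
      using in_S[of "(e, b)"] by simp
  qed
  have cS: "card ?S = m"
    using inj by (simp add: card_image es_def)
  have count: "card (f ` ?S) * deg = m"
    if f: "\<And>e. e \<in> E \<Longrightarrow> card {e' \<in> E. f e' = f e} = deg" "\<And>e e'. e \<in> E \<Longrightarrow> e' \<in> ?S \<Longrightarrow> f e = f e' \<Longrightarrow> e \<in> ?S"
    for f :: "'e \<Rightarrow> 'v"
  proof -
    have "card ?S = (\<Sum>v\<in>f ` ?S. card {e \<in> ?S. f e = v})"
      using sum.image_gen[of ?S "\<lambda>_. 1::nat" f] by simp
    also have "\<dots> = (\<Sum>v\<in>f ` ?S. deg)"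
    proof (rule sum.cong)
      fix v assume "v \<in> f ` ?S"
      then obtain e where e: "e \<in> ?S" "v = f e"
        by blast
      have "{e' \<in> ?S. f e' = v} = {e' \<in> E. f e' = f e}"
        using e f(2)[OF _ e(1)] esE by auto
      then show "card {e' \<in> ?S. f e' = v} = deg"
        using f(1)[of e] e esE by auto
    qed simp
    finally show ?thesis
      using cS by simp
  qed
  have sat_t: "e \<in> ?S" if "e \<in> E" "e' \<in> ?S" "t e = t e'" for e e'
    by (rule sat[of e e' True]) (use that in simp_all)
  have sat_u: "e \<in> ?S" if "e \<in> E" "e' \<in> ?S" "u e = u e'" for e e'
    by (rule sat[of e e' False]) (use that in simp_all)
  have "card (t ` ?S) * deg = m"
    by (rule count[OF deg(1) sat_t])
  moreover have "card (u ` ?S) * deg = m"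
    by (rule count[OF deg(2) sat_u])
  moreover have "card (w ` {..<m}) \<le> card (t ` ?S) + card (u ` ?S)"
  proof -
    have "w ` {..<m} \<subseteq> t ` ?S \<union> u ` ?S"
      by (auto simp: w_def es_def vertex_def)
    then have "card (w ` {..<m}) \<le> card (t ` ?S \<union> u ` ?S)"
      by (intro card_mono) auto
    then show ?thesis
      using card_Un_le le_trans by blast
  qed
  then have "card (w ` {..<m}) * deg \<le> (card (t ` ?S) + card (u ` ?S)) * deg"
    by (rule mult_le_mono1)
  ultimately have "card (w ` {..<m}) * deg \<le> 2 * m"
    by (simp add: add_mult_distrib)
  moreover have "{t (es i), u (es i)} = {w i, w (Suc i)}" for i
  proof -
    have "w (Suc i) = vertex (flip (p i))"
      unfolding w_def p(3) by (rule gv[OF closed(1)[OF pD]])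
    moreover have "{t (es i), u (es i)} = {vertex (p i), vertex (flip (p i))}"
      by (cases "p i"; cases "snd (p i)") (auto simp: es_def)
    ultimately show ?thesis
      by (simp add: w_def)
  qed
  moreover have "w m = w 0"
    using p(1,2) by (simp add: w_def)
  moreover have "inj_on es {..<m}"
    using inj by (simp add: es_def)
  ultimately show ?thesis
    using that[of m es w] m esE by (simp add: image_subset_iff)
qed

end

section \<open>Tours\<close>

text \<open>One edge at two positions would need \<open>i = j + 1\<close> and
  \<open>j = i + 1\<close> modulo \<open>n\<close>, impossible for \<open>n \<ge> 3\<close>. Hence
  tour lengths are sums over positions.\<close>

lemma inj_on_tour_edges:
  fixes p :: "nat \<Rightarrow> nat"
  assumes "bij_betw p {0..<n} {0..<n}" "n \<ge> 3"
  shows "inj_on (\<lambda>i. {p i, p ((i + 1) mod n)}) {..<n}"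
proof (rule inj_onI)
  fix i j assume ij: "i \<in> {..<n}" "j \<in> {..<n}" and eq: "{p i, p ((i + 1) mod n)} = {p j, p ((j + 1) mod n)}"
  have inj: "a = b" if "p a = p b" "a < n" "b < n" for a b
    using inj_onD[OF bij_betw_imp_inj_on[OF assms(1)] that(1)] that by simp
  have lt: "i < n" "j < n" "(i + 1) mod n < n" "(j + 1) mod n < n"
    using ij assms(2) by auto
  consider "p i = p j" | "p i = p ((j + 1) mod n)" "p ((i + 1) mod n) = p j"
    using eq by (auto simp: doubleton_eq_iff)
  then show "i = j"
  proof cases
    case 1
    then show ?thesis
      using inj lt by blast
  next
    case 2
    then have ij: "i = (j + 1) mod n" "j = (i + 1) mod n"
      using inj lt by metis+
    have mod: "(x + 1) mod n = x + 1 \<or> (x + 1) mod n = 0 \<and> x + 1 = n" if "x < n" for x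
      using that by (cases "x + 1 = n") auto
    then have "i = j + 1 \<or> i = 0 \<and> j + 1 = n" "j = i + 1 \<or> j = 0 \<and> i + 1 = n"
      using ij lt by metis+
    then show ?thesis
      using assms(2) by (elim disjE) linarith+
  qed
qed

lemma tour_edges_image:
  "{{p i, p ((i + 1) mod n)} | i. i < n} = (\<lambda>i. {p i, p ((i + 1) mod n)}) ` {..<n}" for p :: "nat \<Rightarrow> nat"
  by auto

lemma tour_cost_eq:
  fixes p :: "nat \<Rightarrow> nat"
  assumes "bij_betw p {0..<n} {0..<n}" "n \<ge> 3"
  shows "tour_cost c {{p i, p ((i + 1) mod n)} | i. i < n} = (\<Sum>i<n. c {p i, p ((i + 1) mod n)})"
  unfolding tour_cost_def tour_edges_image using inj_on_tour_edges[OF assms] by (simp add: sum.reindex)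

lemma is_tourE:
  assumes "is_tour n T"
  obtains p where "n \<ge> 3" "bij_betw p {0..<n} {0..<n}" "T = {{p i, p ((i + 1) mod n)} | i. i < n}"
  using assms unfolding is_tour_def by blast

lemma finite_tours: "finite {T. is_tour n T}"
proof (rule finite_subset)
  show "{T. is_tour n T} \<subseteq> Pow (Pow {0..<n})"
  proof
    fix T assume "T \<in> {T. is_tour n T}"
    then have "is_tour n T"
      by simp
    then obtain p where p: "n \<ge> 3" "bij_betw p {0..<n} {0..<n}" "T = {{p i, p ((i + 1) mod n)} | i. i < n}"
      by (rule is_tourE)
    have "p i \<in> {0..<n}" if "i < n" for i
      using p(2) that by (auto simp: bij_betw_def)
    then have "{p i, p ((i + 1) mod n)} \<subseteq> {0..<n}" if "i < n" for i
      using that p(1) by simp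
    then show "T \<in> Pow (Pow {0..<n})"
      unfolding p(3) by blast
  qed
qed simp

lemma tour_identity: "n \<ge> 3 \<Longrightarrow> is_tour n {{i, (i + 1) mod n} | i. i < n}"
  unfolding is_tour_def by (intro conjI exI[of _ "\<lambda>i. i"]) (simp_all add: bij_betw_def)

lemma finite_tour: "is_tour n T \<Longrightarrow> finite T"
  by (erule is_tourE) (simp only: tour_edges_image finite_imageI finite_lessThan)

lemma OPT_le: "is_tour n T \<Longrightarrow> OPT n c \<le> tour_cost c T"
  unfolding OPT_def using finite_tours by (intro Min_le) auto

lemma OPT_attained:
  assumes "n \<ge> 3"
  obtains T where "is_tour n T" "tour_cost c T = OPT n c"
proof -
  have "OPT n c \<in> tour_cost c ` {T. is_tour n T}"
    unfolding OPT_def using finite_tours tour_identity[OF assms] by (intro Min_in) auto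
  then show ?thesis
    using that by auto
qed

text \<open>The identity beyond \<open>n\<close> is what \<open>permutes\<close> demands.\<close>

lemma rotation_permutes: "(\<lambda>v. if v < n then Suc v mod n else v) permutes {..<n}"
proof (rule bij_imp_permutes)
  show "bij_betw (\<lambda>v. if v < n then Suc v mod n else v) {..<n} {..<n}"
  proof (rule bij_betw_byWitness[where f' = "\<lambda>v. if v = 0 then n - 1 else v - 1"])
    show "\<forall>v\<in>{..<n}. (if (if v < n then Suc v mod n else v) = 0 then n - 1
        else (if v < n then Suc v mod n else v) - 1) = v"
    proof
      fix v assume "v \<in> {..<n}"
      then show "(if (if v < n then Suc v mod n else v) = 0 then n - 1
        else (if v < n then Suc v mod n else v) - 1) = v"
        by (cases "Suc v = n") auto
    qed
  qed auto
qed simp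

lemma rotation_cyclic:
  assumes "S \<subseteq> {..<n}" "S \<noteq> {}" "(\<lambda>v. if v < n then Suc v mod n else v) ` S \<subseteq> S"
  shows "S = {..<n}"
proof
  obtain v where v: "v \<in> S" "v < n"
    using assms(1,2) by blast
  have all: "(v + j) mod n \<in> S" for j
  proof (induction j)
    case (Suc j)
    then have "(if (v + j) mod n < n then Suc ((v + j) mod n) mod n else (v + j) mod n) \<in> S"
      using assms(3) by blast
    then show ?case
      using v(2) by (simp add: mod_Suc_eq)
  qed (use v in simp)
  show "{..<n} \<subseteq> S"
  proof
    fix w assume "w \<in> {..<n}"
    then show "w \<in> S"
      using all[of "n - v + w"] v(2) by simp
  qed
qed (use assms in simp)

section \<open>The upper bound\<close>

text \<open>\<open>P\<close> is arc length along an optimal tour cut open at its first city; a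
  distance is at most the arc between the two cities.\<close>

lemma ex_tour_coordinate:
  assumes "metric_instance n c" "n \<ge> 3"
  obtains P :: "nat \<Rightarrow> real" where "\<And>x. x < n \<Longrightarrow> 0 \<le> P x \<and> P x \<le> OPT n c"
    "\<And>x y. x < n \<Longrightarrow> y < n \<Longrightarrow> x \<noteq> y \<Longrightarrow> c {x, y} \<le> \<bar>P x - P y\<bar>"
proof -
  obtain T where T: "is_tour n T" "tour_cost c T = OPT n c"
    using OPT_attained[OF assms(2)] by blast
  obtain p where "n \<ge> 3" and p: "bij_betw p {0..<n} {0..<n}" "T = {{p i, p ((i + 1) mod n)} | i. i < n}"
    by (rule is_tourE[OF T(1)])
  have p_lt: "p i < n" if "i < n" for i
    using p(1) that by (auto simp: bij_betw_def)
  have p_eq: "p i = p j \<longleftrightarrow> i = j" if "i < n" "j < n" for i j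
    using p(1) that by (auto simp: bij_betw_def inj_on_def)
  let ?e = "\<lambda>i. c {p i, p ((i + 1) mod n)}"
  have e_nonneg: "?e i \<ge> 0" if "i < n" for i
  proof -
    have "(i + 1) mod n \<noteq> i"
      using that assms(2) by (cases "i + 1 = n") auto
    then have "p i \<noteq> p ((i + 1) mod n)"
      using p_eq that by simp
    then have "{p i, p ((i + 1) mod n)} \<in> Kn_edges n"
      unfolding Kn_edges_def using p_lt[OF that] p_lt[of "(i + 1) mod n"] that
      by (intro CollectI exI[of _ "p i"] exI[of _ "p ((i + 1) mod n)"]) simp
    then show ?thesis
      using assms(1) by (simp add: metric_instance_def)
  qed
  have OPT: "OPT n c = (\<Sum>i<n. ?e i)"
    using T(2) tour_cost_eq[OF p(1) assms(2)] p(2) by simp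
  have path: "c {p i, p j} \<le> (\<Sum>l\<in>{i..<j}. ?e l)" if "i < j" "j < n" for i j
    using that
  proof (induction j)
    case (Suc j)
    have e: "?e j = c {p j, p (Suc j)}"
      using Suc.prems by simp
    show ?case
    proof (cases "i = j")
      case True
      then show ?thesis
        using Suc.prems by simp
    next
      case False
      then have "c {p i, p j} \<le> (\<Sum>l\<in>{i..<j}. ?e l)"
        using Suc by simp
      moreover have "c {p i, p (Suc j)} \<le> c {p i, p j} + c {p j, p (Suc j)}"
        using assms(1) False Suc.prems p_lt p_eq unfolding metric_instance_def by simp
      ultimately show ?thesis
        using Suc.prems e by simp
    qed
  qed simp
  define ix where "ix = the_inv_into {0..<n} p"
  have ix: "ix x < n" "p (ix x) = x" if "x < n" for x
    using p(1) that the_inv_into_into[of p "{0..<n}" x "{0..<n}"] f_the_inv_into_f[of p "{0..<n}" x]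
    by (auto simp: bij_betw_def ix_def)
  define P where "P x = (\<Sum>l<ix x. ?e l)" for x
  have diff: "P y - P x = (\<Sum>l\<in>{ix x..<ix y}. ?e l)" if "ix x < ix y" for x y
  proof -
    have "P y = P x + (\<Sum>l\<in>{ix x..<ix y}. ?e l)"
      unfolding P_def lessThan_atLeast0
      using sum.atLeastLessThan_concat[of 0 "ix x" "ix y" ?e] that by simp
    then show ?thesis
      by simp
  qed
  show ?thesis
  proof
    fix x assume x: "x < n"
    show "0 \<le> P x \<and> P x \<le> OPT n c"
      unfolding P_def OPT
    proof
      show "0 \<le> (\<Sum>l<ix x. ?e l)"
        by (rule sum_nonneg, rule e_nonneg) (use ix(1)[OF x] in simp)
      show "(\<Sum>l<ix x. ?e l) \<le> (\<Sum>l<n. ?e l)"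
        by (rule sum_mono2; (rule e_nonneg)?) (use ix(1)[OF x] in auto)
    qed
  next
    fix x y assume xy: "x < n" "y < n" "x \<noteq> y"
    then have "ix x \<noteq> ix y"
      using ix(2) by metis
    then consider "ix x < ix y" | "ix y < ix x"
      by linarith
    then show "c {x, y} \<le> \<bar>P x - P y\<bar>"
    proof cases
      case 1
      then show ?thesis
        using path[OF 1 ix(1)] ix xy diff[OF 1] by simp
    next
      case 2
      then show ?thesis
        using path[OF 2 ix(1)] ix xy diff[OF 2] by (simp add: insert_commute)
    qed
  qed
qed

lemma abs_diff_less_of_floor_eq:
  fixes x y :: real
  assumes "\<lfloor>x / \<delta>\<rfloor> = \<lfloor>y / \<delta>\<rfloor>" "\<delta> > 0"
  shows "\<bar>x - y\<bar> < \<delta>"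
proof -
  have "\<bar>x / \<delta> - y / \<delta>\<bar> < 1"
    using assms(1) by linarith
  then have "\<bar>(x - y) / \<delta>\<bar> < 1"
    by (simp add: diff_divide_distrib)
  then show ?thesis
    using assms(2) by (simp add: abs_divide)
qed

locale optimal_tour =
  fixes n k :: nat and c :: "nat set \<Rightarrow> real" and T :: "nat set set" and p :: "nat \<Rightarrow> nat"
    and P :: "nat \<Rightarrow> real"
  assumes metric: "metric_instance n c" and opt: "k_optimal n k c T" and n3: "n \<ge> 3" and k2: "k \<ge> 2"
    and p: "bij_betw p {0..<n} {0..<n}" and T: "T = {{p i, p ((i + 1) mod n)} | i. i < n}"
    and P: "\<And>x. x < n \<Longrightarrow> 0 \<le> P x \<and> P x \<le> OPT n c"
      "\<And>x y. x < n \<Longrightarrow> y < n \<Longrightarrow> x \<noteq> y \<Longrightarrow> c {x, y} \<le> \<bar>P x - P y\<bar>"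
begin

text \<open>Cities are named by their positions on \<open>T\<close>. The diagonal is set to 0
  because \<open>c\<close> is arbitrary on singletons, while the triangle inequality is required for
  all triples.\<close>

definition d :: "nat \<Rightarrow> nat \<Rightarrow> real" where
  "d u v = (if u = v then 0 else c {p u, p v})"

definition s :: "nat \<Rightarrow> nat" where
  "s v = (if v < n then Suc v mod n else v)"

abbreviation "L \<equiv> OPT n c"

lemma p_lt: "i < n \<Longrightarrow> p i < n"
  using p by (auto simp: bij_betw_def)

lemma p_eq: "i < n \<Longrightarrow> j < n \<Longrightarrow> p i = p j \<longleftrightarrow> i = j"
  using p by (auto simp: bij_betw_def inj_on_def)

lemma s_lt: "v < n \<Longrightarrow> s v < n"
  by (simp add: s_def)

lemma s_neq: "v < n \<Longrightarrow> s v \<noteq> v"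
  using n3 by (cases "Suc v = n") (auto simp: s_def)

lemma d_sym: "d u v = d v u"
  by (simp add: d_def insert_commute)

lemma d_nonneg:
  assumes "u < n" "v < n"
  shows "d u v \<ge> 0"
proof (cases "u = v")
  case False
  then have "{p u, p v} \<in> Kn_edges n"
    unfolding Kn_edges_def using assms p_lt p_eq by blast
  then show ?thesis
    using metric False by (simp add: metric_instance_def d_def)
qed (simp add: d_def)

lemma d_triangle:
  assumes "u < n" "v < n" "w < n"
  shows "d u w \<le> d u v + d v w"
proof (cases "u = v \<or> v = w \<or> u = w")
  case True
  then show ?thesis
    using d_nonneg[of u v] d_nonneg[of v w] assms by (auto simp: d_def insert_commute)
next
  case False
  then show ?thesis
    using metric p_lt p_eq assms by (simp add: d_def metric_instance_def)
qed

lemma d_le: "u < n \<Longrightarrow> v < n \<Longrightarrow> d u v \<le> \<bar>P (p u) - P (p v)\<bar>"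
  using P(2)[of "p u" "p v"] p_lt p_eq by (simp add: d_def)

lemma d_le_L: "u < n \<Longrightarrow> v < n \<Longrightarrow> d u v \<le> L"
  using d_le[of u v] P(1)[of "p u"] P(1)[of "p v"] p_lt[of u] p_lt[of v] by linarith

lemma cost_T: "tour_cost c T = (\<Sum>v<n. d v (s v))"
proof -
  have "c {p v, p ((v + 1) mod n)} = d v (s v)" if "v < n" for v
    using that s_neq[OF that] by (auto simp: d_def s_def)
  then show ?thesis
    unfolding T tour_cost_eq[OF p n3] by simp
qed

text \<open>The \<open>h + 1\<close> missing edges save at least \<open>(h + 1) * l\<close>, the
  \<open>h - 1\<close> restored ones cost at most \<open>(h - 1) * (1 + 1 / k) * l\<close>, and the
  \<open>2 * h\<close> short connections at most \<open>h * l / k\<close>. The change is at most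
  \<open>l * ((2 * h - 1) / k - 2)\<close>, which is negative since \<open>h < k\<close>.\<close>

lemma no_even_set_at_scale:
  assumes l: "l > 0" and Z: "Z \<subseteq> {v. v < n \<and> l < d v (s v) \<and> d v (s v) \<le> (1 + 1 / real k) * l}"
    "Z \<noteq> {}" "card Z \<le> 2 * (k - 1)"
  shows "\<not> even_set (\<lambda>v. \<lfloor>P (p v) / (l / (2 * k))\<rfloor>) (\<lambda>v. \<lfloor>P (p (s v)) / (l / (2 * k))\<rfloor>) Z"
proof
  define \<delta> where "\<delta> = l / (2 * k)"
  let ?t = "\<lambda>v. \<lfloor>P (p v) / \<delta>\<rfloor>" and ?u = "\<lambda>v. \<lfloor>P (p (s v)) / \<delta>\<rfloor>"
  assume "even_set (\<lambda>v. \<lfloor>P (p v) / (l / (2 * k))\<rfloor>) (\<lambda>v. \<lfloor>P (p (s v)) / (l / (2 * k))\<rfloor>) Z"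
  then have ev: "even_set ?t ?u Z"
    by (simp add: \<delta>_def)
  have \<delta>: "\<delta> > 0"
    using l k2 by (simp add: \<delta>_def)
  have Zn: "Z \<subseteq> {..<n}"
    using Z(1) by auto
  then have finZ: "finite Z"
    using finite_subset by blast
  obtain \<alpha> where pair_t: "\<forall>e\<in>Z. \<alpha> e \<in> Z \<and> \<alpha> (\<alpha> e) = e \<and> \<alpha> e \<noteq> e \<and> ?t (\<alpha> e) = ?t e"
    using ex_fibre_involution[OF finZ, of ?t] ev unfolding even_set_def by blast
  obtain \<beta> where pair_u: "\<forall>e\<in>Z. \<beta> e \<in> Z \<and> \<beta> (\<beta> e) = e \<and> \<beta> e \<noteq> e \<and> ?u (\<beta> e) = ?u e"
    using ex_fibre_involution[OF finZ, of ?u] ev unfolding even_set_def by blast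
  have "even (card Z)"
    by (rule even_card_fpf_involution[OF finZ, of \<alpha>]) (use pair_t in blast)
  then obtain h where h: "card Z = 2 * h"
    by (elim evenE)
  have h0: "h > 0"
    using h Z(2) finZ by (cases h) auto
  have hk: "h + 1 \<le> k"
    using h Z(3) h0 by linarith
  interpret paired_tour "{..<n}" s Z \<alpha> \<beta> d h
  proof unfold_locales
    have "s = (\<lambda>v. if v < n then Suc v mod n else v)"
      by (auto simp: s_def)
    then show "s permutes {..<n}"
      "\<And>S. S \<subseteq> {..<n} \<Longrightarrow> S \<noteq> {} \<Longrightarrow> s ` S \<subseteq> S \<Longrightarrow> S = {..<n}"
      using rotation_permutes rotation_cyclic by auto
    have "0 \<in> {..<n}"
      using n3 by simp
    then show "{..<n} \<noteq> {}"
      by blast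
    show "\<And>x. x \<in> Z \<Longrightarrow> \<alpha> x \<in> Z \<and> \<alpha> (\<alpha> x) = x \<and> \<alpha> x \<noteq> x"
      using pair_t by blast
    show "\<And>x. x \<in> Z \<Longrightarrow> \<beta> x \<in> Z \<and> \<beta> (\<beta> x) = x \<and> \<beta> x \<noteq> x"
      using pair_u by blast
    show "\<And>u v. d u v = d v u"
      by (rule d_sym)
    show "\<And>u v w. u \<in> {..<n} \<Longrightarrow> v \<in> {..<n} \<Longrightarrow> w \<in> {..<n} \<Longrightarrow> d u w \<le> d u v + d v w"
      using d_triangle by simp
  qed (use Zn h h0 in simp_all)
  obtain R q where R: "R \<subseteq> Z" "card R = h + 1" and q: "bij_betw q {..<n} {..<n}"
    and kept: "\<And>v. v \<in> {..<n} - R \<Longrightarrow> \<exists>i<n. {q i, q (Suc i mod n)} = {v, s v}"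
    and cost: "(\<Sum>i<n. d (q i) (q (Suc i mod n))) \<le> (\<Sum>v<n. d v (s v)) - (\<Sum>v\<in>R. d v (s v))
       + (\<Sum>v\<in>Z - R. d v (s v)) + (\<Sum>v\<in>Z. d v (\<alpha> v) + d (s v) (s (\<beta> v))) / 2"
  proof (rule improving_reconnection[unfolded card_lessThan], goal_cases)
    case (1 R q)
    from 1(2-) show ?case
      by (rule 1(1))
  qed
  have finR: "finite R"
    using R(1) finZ finite_subset by blast
  have q_lt: "q i < n" if "i < n" for i
    using q that by (auto simp: bij_betw_def)
  have q_eq: "q i = q j \<longleftrightarrow> i = j" if "i < n" "j < n" for i j
    using q that by (auto simp: bij_betw_def inj_on_def)
  define T' where "T' = {{(p \<circ> q) i, (p \<circ> q) ((i + 1) mod n)} | i. i < n}"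
  have pq: "bij_betw (p \<circ> q) {0..<n} {0..<n}"
    using q p by (intro bij_betw_trans[of q _ "{0..<n}"]) (auto simp: atLeast0LessThan)
  then have tour': "is_tour n T'"
    unfolding is_tour_def T'_def using n3 by blast
  have tour: "is_tour n T"
    using opt by (simp add: k_optimal_def)
  have "T - T' \<subseteq> (\<lambda>v. {p v, p (s v)}) ` R"
  proof
    fix e assume e: "e \<in> T - T'"
    then obtain v where v: "v < n" "e = {p v, p (s v)}"
      using T by (auto simp: s_def)
    have "v \<in> R"
    proof (rule ccontr)
      assume "v \<notin> R"
      then obtain i where i: "i < n" "{q i, q (Suc i mod n)} = {v, s v}"
        using kept[of v] v(1) by auto
      have "e = p ` {v, s v}"
        using v(2) by simp
      also have "\<dots> = {(p \<circ> q) i, (p \<circ> q) ((i + 1) mod n)}"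
        unfolding i(2)[symmetric] by simp
      finally show False
        using e i(1) unfolding T'_def by blast
    qed
    then show "e \<in> (\<lambda>v. {p v, p (s v)}) ` R"
      using v(2) by blast
  qed
  then have "card (T - T') \<le> card R"
    using finR by (meson card_image_le card_mono finite_imageI le_trans)
  then have "k_move n k T T'"
    using tour tour' R(2) hk by (simp add: k_move_def)
  moreover have "tour_cost c T' < tour_cost c T"
  proof -
    have "tour_cost c T' = (\<Sum>i<n. d (q i) (q (Suc i mod n)))"
      unfolding T'_def tour_cost_eq[OF pq n3]
    proof (rule sum.cong)
      fix i assume "i \<in> {..<n}"
      then have i: "i < n"
        by simp
      then have "q i \<noteq> q (Suc i mod n)"
        using q_eq[of i "Suc i mod n"] s_neq[OF i] by (auto simp: s_def)
      then show "c {(p \<circ> q) i, (p \<circ> q) ((i + 1) mod n)} = d (q i) (q (Suc i mod n))"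
        by (simp add: d_def)
    qed simp
    moreover have "(\<Sum>v\<in>R. d v (s v)) \<ge> real (h + 1) * l"
      using sum_mono[of R "\<lambda>_. l" "\<lambda>v. d v (s v)"] R Z(1) by fastforce
    moreover have "(\<Sum>v\<in>Z - R. d v (s v)) \<le> real (h - 1) * ((1 + 1 / real k) * l)"
    proof -
      have "card (Z - R) = h - 1"
        using R finR h by (simp add: card_Diff_subset)
      then show ?thesis
        using sum_mono[of "Z - R" "\<lambda>v. d v (s v)" "\<lambda>_. (1 + 1 / real k) * l"] Z(1) by fastforce
    qed
    moreover have "(\<Sum>v\<in>Z. d v (\<alpha> v) + d (s v) (s (\<beta> v))) \<le> real (2 * h) * (2 * \<delta>)"
    proof -
      have "d v (\<alpha> v) + d (s v) (s (\<beta> v)) \<le> 2 * \<delta>" if v: "v \<in> Z" for v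
      proof -
        have lt: "v < n" "\<alpha> v < n" "\<beta> v < n"
          using v pair_t pair_u Zn by auto
        have "d v (\<alpha> v) \<le> \<delta>"
          using d_le[OF lt(1,2)] abs_diff_less_of_floor_eq[of "P (p v)" \<delta> "P (p (\<alpha> v))"] pair_t v \<delta> by fastforce
        moreover have "d (s v) (s (\<beta> v)) \<le> \<delta>"
          using d_le[OF s_lt[OF lt(1)] s_lt[OF lt(3)]] pair_u v \<delta>
            abs_diff_less_of_floor_eq[of "P (p (s v))" \<delta> "P (p (s (\<beta> v)))"] by fastforce
        ultimately show ?thesis
          by simp
      qed
      then show ?thesis
        using sum_mono[of Z _ "\<lambda>_. 2 * \<delta>"] h by fastforce
    qed
    moreover have "- (real (h + 1) * l) + real (h - 1) * ((1 + 1 / real k) * l) + real (2 * h) * (2 * \<delta>) / 2 < 0"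
    proof -
      have "- ((a + 1) * l) + (a - 1) * ((1 + 1 / b) * l) + a * l / b = l * ((2 * a - 1) / b - 2)" for a b :: real
        by (simp add: divide_inverse algebra_simps)
      moreover have "real (2 * h) * (2 * \<delta>) / 2 = real h * l / real k" "real (h + 1) = real h + 1" "real (h - 1) = real h - 1"
        using h0 by (simp_all add: \<delta>_def)
      ultimately have "- (real (h + 1) * l) + real (h - 1) * ((1 + 1 / real k) * l) + real (2 * h) * (2 * \<delta>) / 2
          = l * ((2 * real h - 1) / real k - 2)"
        by (simp only:)
      moreover have "(2 * real h - 1) / real k < 2"
        using hk k2 by (simp add: divide_less_eq)
      ultimately show ?thesis
        using l by (simp add: mult_less_0_iff)
    qed
    ultimately show ?thesis
      using cost unfolding cost_T by linarith
  qed
  ultimately show False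
    using opt unfolding k_optimal_def by blast
qed

text \<open>Since \<open>r\<close> is a \<open>(k - 1)\<close>-th root, the number of classes is at
  most \<open>2 * k + 1\<close> times a \<open>(k - 1)\<close>-th power of \<open>r ^ Suc j\<close>,
  the form that the Moore bound with \<open>K = k - 1\<close> takes. The 1 in
  \<open>2 * k + 1\<close> absorbs the rounding.\<close>

lemma card_edges_at_scale:
  assumes r: "r > 1" "r ^ (k - 1) = 1 + 1 / real k" and L: "L > 0"
  shows "real (card {v. v < n \<and> L / r ^ ((k - 1) * Suc j) < d v (s v) \<and> d v (s v) \<le> L / r ^ ((k - 1) * j)})
    \<le> 4 * real (k - 1) * (2 * real k + 1)\<^sup>2 * r ^ (k * Suc j)"
proof -
  define l where "l = L / r ^ ((k - 1) * Suc j)"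
  define \<delta> where "\<delta> = l / (2 * k)"
  define N where "N = nat (\<lfloor>L / \<delta>\<rfloor> + 1)"
  have l: "l > 0" "\<delta> > 0"
    using L r(1) k2 by (simp_all add: l_def \<delta>_def)
  have "r ^ ((k - 1) * Suc j) = r ^ ((k - 1) * j) * (1 + 1 / real k)"
    by (simp add: power_add flip: r(2))
  then have up: "L / r ^ ((k - 1) * j) = (1 + 1 / real k) * l"
    using add_pos_nonneg[of 1 "1 / real k"] by (simp add: l_def)
  let ?M = "{v. v < n \<and> l < d v (s v) \<and> d v (s v) \<le> (1 + 1 / real k) * l}"
  let ?t = "\<lambda>v. \<lfloor>P (p v) / (l / (2 * k))\<rfloor>" and ?u = "\<lambda>v. \<lfloor>P (p (s v)) / (l / (2 * k))\<rfloor>"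
  have cls: "card (f ` ?M) \<le> N" if f: "\<And>v. v \<in> ?M \<Longrightarrow> \<exists>x<n. f v = \<lfloor>P x / \<delta>\<rfloor>" for f :: "nat \<Rightarrow> int"
  proof -
    have "f ` ?M \<subseteq> {0..\<lfloor>L / \<delta>\<rfloor>}"
    proof (rule image_subsetI)
      fix v assume "v \<in> ?M"
      then obtain x where x: "x < n" "f v = \<lfloor>P x / \<delta>\<rfloor>"
        using f by blast
      have "0 \<le> P x / \<delta>" "P x / \<delta> \<le> L / \<delta>"
        using P(1)[OF x(1)] l(2) by (simp_all add: divide_right_mono)
      then show "f v \<in> {0..\<lfloor>L / \<delta>\<rfloor>}"
        using x(2) by (simp add: floor_mono)
    qed
    then have "card (f ` ?M) \<le> card {0..\<lfloor>L / \<delta>\<rfloor>}"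
      by (intro card_mono) auto
    then show ?thesis
      by (simp add: N_def)
  qed
  have "L / \<delta> = 2 * real k * (r ^ Suc j) ^ (k - 1)"
    using L r(1) k2 by (simp add: \<delta>_def l_def power_mult[symmetric] mult.commute del: power_Suc)
  moreover have "real N \<le> L / \<delta> + 1"
    using L l(2) by (simp add: N_def)
  moreover have "1 \<le> (r ^ Suc j) ^ (k - 1)"
    using r(1) by (intro one_le_power) simp
  ultimately have N: "real N \<le> (2 * real k + 1) * (r ^ Suc j) ^ (k - 1)"
    by (simp add: algebra_simps del: power_Suc)
  have "real (card ?M) \<le> 4 * real (k - 1) * (2 * real k + 1)\<^sup>2 * (r ^ Suc j) ^ Suc (k - 1)"
  proof (rule card_le_of_no_even_set[of ?M "k - 1" "r ^ Suc j" "2 * real k + 1" ?t N ?u])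
    show "card (?t ` ?M) \<le> N" "card (?u ` ?M) \<le> N"
      using p_lt s_lt unfolding \<delta>_def[symmetric] by (intro cls; blast)+
    show "1 \<le> r ^ Suc j"
      using r(1) by (intro one_le_power) simp
    show "\<not> even_set ?t ?u Z" if "Z \<subseteq> ?M" "Z \<noteq> {}" "card Z \<le> 2 * (k - 1)" for Z
      by (rule no_even_set_at_scale[OF l(1) that])
  qed (use k2 N in auto)
  also have "(r ^ Suc j) ^ Suc (k - 1) = r ^ (k * Suc j)"
    using k2 by (simp add: power_mult[symmetric] mult.commute del: power_Suc)
  finally show ?thesis
    unfolding up by (simp add: l_def)
qed

text \<open>Level \<open>j\<close> has about \<open>r ^ (k * Suc j)\<close> edges of length at most
  \<open>L / r ^ ((k - 1) * j)\<close>, a contribution of about \<open>L * r ^ (k + j)\<close>. The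
  sum is geometric and dominated by the shortest scale.\<close>

lemma cost_le_geometric:
  assumes r: "r > 1" "r ^ (k - 1) = 1 + 1 / real k" and L: "L > 0"
  shows "tour_cost c T \<le> (\<Sum>v | v < n \<and> d v (s v) \<le> L / r ^ ((k - 1) * J). d v (s v))
    + (\<Sum>j<J. 4 * real (k - 1) * (2 * real k + 1)\<^sup>2 * r ^ k * L * r ^ j)"
proof (induction J)
  case 0
  have "{v. v < n \<and> d v (s v) \<le> L} = {..<n}"
    using d_le_L s_lt by auto
  then show ?case
    by (simp add: cost_T)
next
  case (Suc J)
  let ?B = "4 * real (k - 1) * (2 * real k + 1)\<^sup>2"
  let ?x = "\<lambda>J. L / r ^ ((k - 1) * J)"
  let ?M = "{v. v < n \<and> ?x (Suc J) < d v (s v) \<and> d v (s v) \<le> ?x J}"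
  have "?x (Suc J) \<le> ?x J"
    using r L by (intro divide_left_mono power_increasing) auto
  then have eq: "{v. v < n \<and> d v (s v) \<le> ?x J} = {v. v < n \<and> d v (s v) \<le> ?x (Suc J)} \<union> ?M"
    by auto
  have "(\<Sum>v | v < n \<and> d v (s v) \<le> ?x J. d v (s v))
      = (\<Sum>v | v < n \<and> d v (s v) \<le> ?x (Suc J). d v (s v)) + (\<Sum>v\<in>?M. d v (s v))"
    unfolding eq by (rule sum.union_disjoint) auto
  moreover have "(\<Sum>v\<in>?M. d v (s v)) \<le> ?B * r ^ k * L * r ^ J"
  proof -
    have "(\<Sum>v\<in>?M. d v (s v)) \<le> real (card ?M) * ?x J"
      using sum_mono[of ?M "\<lambda>v. d v (s v)" "\<lambda>_. ?x J"] by simp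
    also have "\<dots> \<le> (?B * r ^ (k * Suc J)) * ?x J"
      using card_edges_at_scale[OF r L, of J] L r by (intro mult_right_mono) auto
    also have "\<dots> = ?B * r ^ k * L * r ^ J"
    proof -
      have "k * Suc J = k + J + (k - 1) * J"
        using k2 by (cases k) auto
      then have "r ^ (k * Suc J) = r ^ k * r ^ J * r ^ ((k - 1) * J)"
        by (simp add: power_add)
      then show ?thesis
        using r(1) by simp
    qed
    finally show ?thesis .
  qed
  ultimately show ?case
    using Suc by simp
qed

lemma cost_le:
  assumes r: "r > 1" "r ^ (k - 1) = 1 + 1 / real k" and L: "L > 0"
  shows "tour_cost c T / L \<le>
    (1 + 4 * real (k - 1) * (2 * real k + 1)\<^sup>2 * r ^ k * r / (r - 1)) * root k (real n)"
proof -
  let ?B = "4 * real (k - 1) * (2 * real k + 1)\<^sup>2 * r ^ k"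
  define x where "x = root k (real n)"
  have x: "x \<ge> 1" "x ^ k = real n"
    using n3 k2 by (simp_all add: x_def)
  obtain J0 where "x < r ^ J0"
    using real_arch_pow[OF r(1)] by blast
  then have ex: "\<exists>J. x \<le> r ^ J"
    using less_imp_le by blast
  \<comment> \<open>Stop where \<open>r ^ J\<close> reaches the \<open>k\<close>-th root
    \<open>x\<close> of \<open>n\<close>: the geometric sum is then \<open>O(L * x)\<close>, and the
    remaining edges, at most \<open>n\<close> of length at most \<open>L / x ^ (k - 1)\<close>, add
    up to at most \<open>L * x\<close>.\<close>
  define J where "J = (LEAST J. x \<le> r ^ J)"
  have J: "x \<le> r ^ J"
    unfolding J_def by (rule LeastI_ex[OF ex])
  have J_le: "r ^ J \<le> r * x"
  proof (cases J)
    case 0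
    then show ?thesis
      using mult_mono[of 1 r 1 x] r x by simp
  next
    case (Suc i)
    then have "\<not> x \<le> r ^ i"
      unfolding J_def by (intro not_less_Least) simp
    then show ?thesis
      using Suc r by simp
  qed
  have "(\<Sum>v | v < n \<and> d v (s v) \<le> L / r ^ ((k - 1) * J). d v (s v)) \<le> L * x"
  proof -
    let ?S = "{v. v < n \<and> d v (s v) \<le> L / r ^ ((k - 1) * J)}"
    have "(\<Sum>v\<in>?S. d v (s v)) \<le> real (card ?S) * (L / r ^ ((k - 1) * J))"
      using sum_mono[of ?S "\<lambda>v. d v (s v)" "\<lambda>_. L / r ^ ((k - 1) * J)"] by simp
    also have "\<dots> \<le> real n * (L / r ^ ((k - 1) * J))"
      using card_mono[of "{..<n}" ?S] L r by (intro mult_right_mono) auto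
    also have "\<dots> \<le> real n * (L / x ^ (k - 1))"
    proof -
      have "x ^ (k - 1) \<le> r ^ ((k - 1) * J)"
        using power_mono[OF J, of "k - 1"] x by (simp add: power_mult[symmetric] mult.commute)
      then show ?thesis
        using L x r by (intro mult_left_mono divide_left_mono) auto
    qed
    also have "real n = x * x ^ (k - 1)"
      using x(2) k2 by (cases k) auto
    also have "x * x ^ (k - 1) * (L / x ^ (k - 1)) = L * x"
      using x(1) by simp
    finally show ?thesis .
  qed
  moreover have "(\<Sum>j<J. ?B * L * r ^ j) \<le> ?B * L * (r * x / (r - 1))"
  proof -
    have "(\<Sum>j<J. ?B * L * r ^ j) = ?B * L * (\<Sum>j<J. r ^ j)"
      by (rule sum_distrib_left[symmetric])
    also have "(\<Sum>j<J. r ^ j) = (r ^ J - 1) / (r - 1)"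
      using r(1) by (simp add: geometric_sum)
    also have "\<dots> \<le> r * x / (r - 1)"
      using r(1) J_le by (intro divide_right_mono) auto
    finally show ?thesis
      using r L by (simp add: mult_left_mono)
  qed
  ultimately have "tour_cost c T \<le> L * x + ?B * L * (r * x / (r - 1))"
    using cost_le_geometric[OF r L, of J] by linarith
  also have "\<dots> = ((1 + ?B * r / (r - 1)) * x) * L"
    by (simp add: algebra_simps)
  finally show ?thesis
    using L by (simp add: x_def pos_divide_le_eq)
qed

end

theorem alpha_upper_bound:
  assumes "k \<ge> 2"
  shows "\<exists>C>0. \<forall>n. alpha k n \<le> ereal (C * root k (real n))"
proof -
  define r where "r = root (k - 1) (1 + 1 / real k)"
  have r: "r > 1" "r ^ (k - 1) = 1 + 1 / real k"
    using assms by (simp_all add: r_def)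
  define C where "C = 1 + 4 * real (k - 1) * (2 * real k + 1)\<^sup>2 * r ^ k * r / (r - 1)"
  have "C > 0"
    unfolding C_def using r(1) by (intro add_pos_nonneg divide_nonneg_pos mult_nonneg_nonneg) auto
  moreover have "alpha k n \<le> ereal (C * root k (real n))" for n
    unfolding alpha_def
  proof (rule Sup_least)
    fix a assume "a \<in> {ereal (tour_cost c T / OPT n c) | c T.
       metric_instance n c \<and> OPT n c > 0 \<and> k_optimal n k c T}"
    then obtain c T where a: "a = ereal (tour_cost c T / OPT n c)"
      and cT: "metric_instance n c" "OPT n c > 0" "k_optimal n k c T"
      by blast
    have "is_tour n T"
      using cT(3) by (simp add: k_optimal_def)
    then obtain p where p: "n \<ge> 3" "bij_betw p {0..<n} {0..<n}" "T = {{p i, p ((i + 1) mod n)} | i. i < n}"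
      by (rule is_tourE)
    obtain P :: "nat \<Rightarrow> real" where P: "\<And>x. x < n \<Longrightarrow> 0 \<le> P x \<and> P x \<le> OPT n c"
      "\<And>x y. x < n \<Longrightarrow> y < n \<Longrightarrow> x \<noteq> y \<Longrightarrow> c {x, y} \<le> \<bar>P x - P y\<bar>"
      using ex_tour_coordinate[OF cT(1) p(1)] by blast
    interpret optimal_tour n k c T p P
      using cT p P assms by unfold_locales auto
    show "a \<le> ereal (C * root k (real n))"
      unfolding a using cost_le[OF r cT(2)] by (simp add: C_def)
  qed
  ultimately show ?thesis
    by blast
qed

section \<open>Instances from graphs of large girth\<close>

lemma even_sum_sym_diff:
  fixes f :: "'a \<Rightarrow> nat"
  assumes "finite X" "finite Y"
  shows "even (sum f ((X - Y) \<union> (Y - X))) \<longleftrightarrow> even (sum f X + sum f Y)"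
proof -
  have "sum f ((X - Y) \<union> (Y - X)) = sum f (X - Y) + sum f (Y - X)"
    using assms by (intro sum.union_disjoint) auto
  moreover have "sum f X = sum f (X - Y) + sum f (X \<inter> Y)" "sum f Y = sum f (Y - X) + sum f (X \<inter> Y)"
    using sum.Int_Diff[OF assms(1), of f Y] sum.Int_Diff[OF assms(2), of f X] by (simp_all add: Int_commute)
  ultimately show ?thesis
    by (auto simp: even_add)
qed

text \<open>Passes from a multiset of edges with multiplicities \<open>g\<close> to the set of edges
  of odd multiplicity.\<close>

lemma even_sum_odd_weights:
  fixes f g :: "'a \<Rightarrow> nat"
  assumes "finite X"
  shows "even (\<Sum>e | e \<in> X \<and> odd (g e). f e) \<longleftrightarrow> even (\<Sum>e\<in>X. g e * f e)"
  using assms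
proof (induction X)
  case (insert a X)
  have "{e. e \<in> insert a X \<and> odd (g e)} = (if odd (g a) then insert a {e. e \<in> X \<and> odd (g e)} else {e. e \<in> X \<and> odd (g e)})"
    by auto
  then show ?case
    using insert by (cases "odd (g a)") auto
qed simp

lemma sum_rotation:
  fixes f :: "nat \<Rightarrow> 'a :: comm_monoid_add"
  shows "(\<Sum>i<n. f ((i + 1) mod n)) = (\<Sum>i<n. f i)"
proof -
  have "(\<Sum>i<n. f i) = sum (f \<circ> (\<lambda>v. if v < n then Suc v mod n else v)) {..<n}"
    by (rule sum.permute[OF rotation_permutes])
  also have "\<dots> = (\<Sum>i<n. f ((i + 1) mod n))"
    by (rule sum.cong) auto
  finally show ?thesis ..
qed

text \<open>Every city lies on exactly two tour edges.\<close>

lemma even_tour_incidence: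
  fixes loc :: "nat \<Rightarrow> 'v"
  assumes "is_tour n T"
  shows "even (\<Sum>S\<in>T. \<Sum>i\<in>S. of_bool (loc i = v) :: nat)"
proof -
  obtain p where p: "n \<ge> 3" "bij_betw p {0..<n} {0..<n}" "T = {{p i, p ((i + 1) mod n)} | i. i < n}"
    using assms by (rule is_tourE)
  have neq: "p i \<noteq> p ((i + 1) mod n)" if "i < n" for i
  proof -
    have "(i + 1) mod n \<noteq> i"
      using that p(1) by (cases "i + 1 = n") auto
    then show ?thesis
      using inj_onD[OF bij_betw_imp_inj_on[OF p(2)], of i "(i + 1) mod n"] that by fastforce
  qed
  have "(\<Sum>S\<in>T. \<Sum>i\<in>S. of_bool (loc i = v) :: nat) =
      (\<Sum>i<n. \<Sum>j\<in>{p i, p ((i + 1) mod n)}. of_bool (loc j = v))"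
    unfolding p(3) tour_edges_image using inj_on_tour_edges[OF p(2,1)] by (simp add: sum.reindex)
  also have "\<dots> = (\<Sum>i<n. of_bool (loc (p i) = v) + of_bool (loc (p ((i + 1) mod n)) = v))"
    using neq by (intro sum.cong) auto
  also have "\<dots> = 2 * (\<Sum>i<n. of_bool (loc (p i) = v))"
    unfolding sum.distrib using sum_rotation[of "\<lambda>i. of_bool (loc (p i) = v) :: nat" n] by simp
  finally show ?thesis
    by simp
qed

text \<open>Cities are the positions on a closed trail \<open>es\<close> of a graph of girth at least \<open>2 k\<close>, with the
  spare cities parked at its start; \<open>loc\<close> is the vertex of a city. The distance between two cities
  is the least size of an edge set \<open>X\<close> whose vertices of odd degree are their two locations (that is,
  their distance in the graph), capped at \<open>k\<close>.\<close>

locale trail_instance =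
  fixes E :: "'e set" and t u :: "'e \<Rightarrow> 'v" and k n m :: nat and es :: "nat \<Rightarrow> 'e" and w :: "nat \<Rightarrow> 'v"
  assumes finite_E: "finite E" and disjoint: "\<And>e e'. t e \<noteq> u e'"
    and k1: "k \<ge> 1" and n3: "n \<ge> 3" and m0: "m > 0" and mn: "m \<le> n"
    and inj_es: "inj_on es {..<m}" and esE: "\<And>i. i < m \<Longrightarrow> es i \<in> E"
    and ends: "\<And>i. i < m \<Longrightarrow> {t (es i), u (es i)} = {w i, w (Suc i)}" and closed: "w m = w 0"
    and girth: "\<And>Z. Z \<subseteq> E \<Longrightarrow> Z \<noteq> {} \<Longrightarrow> even_set t u Z \<Longrightarrow> 2 * k \<le> card Z"
begin

definition loc :: "nat \<Rightarrow> 'v" where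
  "loc i = (if i < m then w i else w 0)"

definition inc :: "'e \<Rightarrow> 'v \<Rightarrow> nat" where
  "inc e v = of_bool (t e = v) + of_bool (u e = v)"

definition occ :: "nat set \<Rightarrow> 'v \<Rightarrow> nat" where
  "occ S v = (\<Sum>i\<in>S. of_bool (loc i = v))"

text \<open>\<open>X\<close> is a T-join, where T consists of the vertices at which an odd number of
  cities of \<open>S\<close> is located.\<close>

definition joins :: "nat set \<Rightarrow> 'e set \<Rightarrow> bool" where
  "joins S X \<longleftrightarrow> X \<subseteq> E \<and> (\<forall>v. even ((\<Sum>e\<in>X. inc e v) + occ S v))"

text \<open>Inserting \<open>k\<close> gives the cap and keeps the minimum defined for sets
  \<open>S\<close> without a join.\<close>

definition dst :: "nat set \<Rightarrow> nat" where
  "dst S = Min (insert k {card X | X. joins S X})"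

abbreviation cost :: "nat set \<Rightarrow> real" where
  "cost S \<equiv> real (dst S)"

lemma finite_joins: "finite {card X | X. joins S X}"
proof (rule finite_subset)
  show "{card X | X. joins S X} \<subseteq> card ` Pow E"
    by (auto simp: joins_def)
qed (use finite_E in simp)

lemma dst_le_k: "dst S \<le> k"
  unfolding dst_def using finite_joins by (intro Min_le) auto

lemma dst_le_card: "joins S X \<Longrightarrow> dst S \<le> card X"
  unfolding dst_def using finite_joins by (intro Min_le) auto

lemma dst_attained: "dst S < k \<Longrightarrow> \<exists>X. joins S X \<and> card X = dst S"
proof -
  assume "dst S < k"
  moreover have "dst S \<in> insert k {card X | X. joins S X}"
    unfolding dst_def using finite_joins by (intro Min_in) auto
  ultimately show ?thesis
    by auto
qed

lemma joins_finite: "joins S X \<Longrightarrow> finite X"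
  using finite_E finite_subset by (auto simp: joins_def)

lemma occ_pair: "i \<noteq> j \<Longrightarrow> occ {i, j} v = of_bool (loc i = v) + of_bool (loc j = v)"
  by (simp add: occ_def)

text \<open>No vertex is both a \<open>t\<close>- and a \<open>u\<close>-vertex, so one of the two
  counts at each vertex is zero.\<close>

lemma even_setI:
  assumes "finite Z" "\<And>v. even (\<Sum>e\<in>Z. inc e v)"
  shows "even_set t u Z"
proof -
  have sum: "(\<Sum>e\<in>Z. inc e v) = card {e \<in> Z. t e = v} + card {e \<in> Z. u e = v}" for v
    unfolding inc_def sum.distrib using assms(1) by (simp add: Int_def)
  have "card {e \<in> Z. t e = v} = 0 \<or> card {e \<in> Z. u e = v} = 0" for v
    using disjoint by (metis (mono_tags, lifting) card.empty empty_Collect_eq)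
  then have "even (card {e \<in> Z. t e = v})" "even (card {e \<in> Z. u e = v})" for v
    using assms(2)[of v] sum[of v] by (metis add_0 add.right_neutral even_zero)+
  then show ?thesis
    by (simp add: even_set_def)
qed

text \<open>The symmetric difference of joins for two pairs is a join for the outer pair; if one of
  the two distances is already \<open>k\<close>, the cap suffices.\<close>

lemma metric: "metric_instance n cost"
proof -
  have "dst {x, z} \<le> dst {x, y} + dst {y, z}" if neq: "x \<noteq> y" "y \<noteq> z" "x \<noteq> z" for x y z
  proof (cases "dst {x, y} < k \<and> dst {y, z} < k")
    case True
    then obtain X Y where XY: "joins {x, y} X" "card X = dst {x, y}" "joins {y, z} Y" "card Y = dst {y, z}"
      using dst_attained by meson
    have fin: "finite X" "finite Y"
      using XY joins_finite by auto
    let ?Z = "(X - Y) \<union> (Y - X)"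
    have "joins {x, z} ?Z"
      unfolding joins_def
    proof (intro conjI allI)
      show "?Z \<subseteq> E"
        using XY by (auto simp: joins_def)
      fix v
      have "even (sum (\<lambda>e. inc e v) ?Z) \<longleftrightarrow> even (sum (\<lambda>e. inc e v) X + sum (\<lambda>e. inc e v) Y)"
        by (rule even_sum_sym_diff[OF fin])
      moreover have "even (sum (\<lambda>e. inc e v) X + occ {x, y} v)" "even (sum (\<lambda>e. inc e v) Y + occ {y, z} v)"
        using XY by (auto simp: joins_def)
      ultimately show "even ((\<Sum>e\<in>?Z. inc e v) + occ {x, z} v)"
        using neq by (auto simp: occ_pair)
    qed
    then have "dst {x, z} \<le> card ?Z"
      by (rule dst_le_card)
    also have "\<dots> \<le> card (X \<union> Y)"
      using fin by (intro card_mono) auto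
    also have "\<dots> \<le> dst {x, y} + dst {y, z}"
      using card_Un_le[of X Y] XY by simp
    finally show ?thesis .
  next
    case False
    then show ?thesis
      using dst_le_k[of "{x, z}"] by linarith
  qed
  then show ?thesis
    unfolding metric_instance_def by (metis of_nat_0_le_iff of_nat_add of_nat_le_iff)
qed

lemma dst_eq_0_iff:
  assumes "i \<noteq> j"
  shows "dst {i, j} = 0 \<longleftrightarrow> loc i = loc j"
proof
  assume "dst {i, j} = 0"
  then obtain X where X: "joins {i, j} X" "card X = 0"
    using dst_attained[of "{i, j}"] k1 by auto
  then have "X = {}"
    using joins_finite by auto
  then have "even (occ {i, j} (loc i))"
    using X(1) by (auto simp: joins_def)
  then show "loc i = loc j"
    using assms by (auto simp: occ_pair split: if_splits)
next
  assume "loc i = loc j"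
  then have "joins {i, j} {}"
    using assms by (simp add: joins_def occ_pair)
  then show "dst {i, j} = 0"
    using dst_le_card by fastforce
qed

lemma w_neq: "i < m \<Longrightarrow> w i \<noteq> w (Suc i)"
  using ends[of i] disjoint by (metis doubleton_eq_iff insert_absorb2 singleton_insert_inj_eq)

lemma m2: "m \<ge> 2"
  using w_neq[of 0] m0 closed by (cases "m = 1") auto

abbreviation "tour_edge i \<equiv> {i, (i + 1) mod n}"

lemma tour_edge_neq: "i < n \<Longrightarrow> i \<noteq> (i + 1) mod n"
  using n3 by (cases "i + 1 = n") auto

text \<open>After position \<open>m - 1\<close> comes a parked city or city 0, and both are located
  at \<open>w 0 = w m\<close>.\<close>

lemma loc_next: "i < n \<Longrightarrow> loc ((i + 1) mod n) = (if i < m then w (Suc i) else w 0)"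
  using closed mn m0 by (cases "i + 1 = n"; cases "i + 1 = m") (auto simp: loc_def)

lemma inc_es: "i < m \<Longrightarrow> inc (es i) v = occ (tour_edge i) v"
proof -
  assume i: "i < m"
  then have "t (es i) = w i \<and> u (es i) = w (Suc i) \<or> t (es i) = w (Suc i) \<and> u (es i) = w i"
    using ends[OF i] by (auto simp: doubleton_eq_iff)
  moreover have "occ (tour_edge i) v = of_bool (w i = v) + of_bool (w (Suc i) = v)"
    using i mn loc_next[of i] by (subst occ_pair[OF tour_edge_neq]) (auto simp: loc_def)
  ultimately show ?thesis
    by (elim disjE conjE) (simp_all only: inc_def add.commute)
qed

lemma dst_tour_edge: "i < n \<Longrightarrow> dst (tour_edge i) = of_bool (i < m)"
proof (cases "i < m")
  case True
  assume i: "i < n"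
  have "joins (tour_edge i) {es i}"
    using esE[OF True] inc_es[OF True] by (simp add: joins_def)
  then have "dst (tour_edge i) \<le> 1"
    using dst_le_card by fastforce
  moreover have "dst (tour_edge i) \<noteq> 0"
    using dst_eq_0_iff[OF tour_edge_neq[OF i]] loc_next[OF i] w_neq[OF True] True by (simp add: loc_def)
  ultimately show ?thesis
    using True by simp
next
  case False
  assume i: "i < n"
  then show ?thesis
    using dst_eq_0_iff[OF tour_edge_neq[OF i]] loc_next[OF i] False by (simp add: loc_def)
qed

definition trail_tour :: "nat set set" where
  "trail_tour = {tour_edge i | i. i < n}"

lemma is_tour_trail_tour: "is_tour n trail_tour"
  unfolding trail_tour_def by (rule tour_identity[OF n3])

lemma bij_id: "bij_betw (\<lambda>i. i) {0..<n} {0..<n}"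
  by (simp add: bij_betw_def)

lemma cost_trail_tour: "tour_cost cost trail_tour = real m"
proof -
  have "tour_cost cost trail_tour = (\<Sum>i<n. cost (tour_edge i))"
    unfolding trail_tour_def by (rule tour_cost_eq[OF bij_id n3])
  also have "\<dots> = (\<Sum>i<n. of_bool (i < m))"
    using dst_tour_edge by (intro sum.cong) auto
  also have "\<dots> = real (card {i. i < n \<and> i < m})"
    by (simp add: Int_def)
  also have "{i. i < n \<and> i < m} = {..<m}"
    using mn by auto
  finally show ?thesis
    by simp
qed

text \<open>A tour of length 0 would put all cities at one vertex, but cities 0 and 1 are at the two
  ends of the first trail edge.\<close>

lemma OPT_pos: "OPT n cost > 0"
proof (rule ccontr)
  assume neg: "\<not> OPT n cost > 0"
  obtain T where T: "is_tour n T" "tour_cost cost T = OPT n cost"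
    by (rule OPT_attained[OF n3])
  obtain p where p: "n \<ge> 3" "bij_betw p {0..<n} {0..<n}" "T = {{p i, p ((i + 1) mod n)} | i. i < n}"
    using T(1) by (rule is_tourE)
  have sum0: "(\<Sum>i<n. cost {p i, p ((i + 1) mod n)}) \<le> 0"
    using neg T(2) tour_cost_eq[OF p(2,1), of cost] p(3) by simp
  have "dst {p i, p ((i + 1) mod n)} = 0" if "i < n" for i
  proof -
    have "cost {p i, p ((i + 1) mod n)} \<le> (\<Sum>i<n. cost {p i, p ((i + 1) mod n)})"
      using that by (intro member_le_sum) auto
    then show ?thesis
      using sum0 by simp
  qed
  moreover have "p i \<noteq> p ((i + 1) mod n)" if "i < n" for i
    using inj_onD[OF bij_betw_imp_inj_on[OF p(2)], of i "(i + 1) mod n"] that tour_edge_neq[OF that] by fastforce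
  ultimately have step: "loc (p i) = loc (p ((i + 1) mod n))" if "i < n" for i
    using dst_eq_0_iff that by metis
  have const: "loc (p i) = loc (p 0)" if "i < n" for i
    using that
  proof (induction i)
    case (Suc i)
    then show ?case
      using step[of i] by simp
  qed simp
  have all: "loc x = loc (p 0)" if "x < n" for x
  proof -
    have "x \<in> p ` {0..<n}"
      using p(2) that by (auto simp: bij_betw_def)
    then obtain i where "i < n" "x = p i"
      by auto
    then show ?thesis
      using const[of i] by simp
  qed
  have "loc 0 = loc 1"
    using all[of 0] all[of 1] n3 by simp
  then show False
    using w_neq[OF m0] m2 by (simp add: loc_def)
qed

text \<open>Sorting the cities by an arbitrary numbering \<open>f\<close> of the vertices lets the
  location change at most once per vertex, and the cap bounds each change by
  \<open>k\<close>.\<close>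

lemma OPT_upper: "OPT n cost \<le> real k * real (card (w ` {..<m}))"
proof -
  let ?V = "w ` {..<m}"
  obtain f :: "'v \<Rightarrow> nat" where f: "inj_on f ?V"
    using finite_imp_inj_to_nat_seg[of ?V] by auto
  have locV: "loc i \<in> ?V" for i
    using m0 by (auto simp: loc_def)
  define xs where "xs = sort_key (\<lambda>i. f (loc i)) [0..<n]"
  have len: "length xs = n" and dist: "distinct xs" and set: "set xs = {0..<n}"
    by (simp_all add: xs_def)
  have sorted: "f (loc (xs ! i)) \<le> f (loc (xs ! j))" if "i \<le> j" "j < n" for i j
    using sorted_nth_mono[OF sorted_sort_key[of "\<lambda>i. f (loc i)" "[0..<n]"], of i j] that len
    by (simp add: xs_def)
  define p where "p i = xs ! i" for i
  have p: "bij_betw p {0..<n} {0..<n}"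
    using bij_betw_nth[OF dist, of "{0..<n}" "{0..<n}"] len set
    by (simp add: p_def[abs_def] atLeast0LessThan)
  let ?ch = "{i. i < n \<and> loc (p i) \<noteq> loc (p ((i + 1) mod n))}"
  have "OPT n cost \<le> tour_cost cost {{p i, p ((i + 1) mod n)} | i. i < n}"
    by (rule OPT_le) (use p n3 in \<open>auto simp: is_tour_def\<close>)
  also have "\<dots> = (\<Sum>i<n. cost {p i, p ((i + 1) mod n)})"
    by (rule tour_cost_eq[OF p n3])
  also have "\<dots> \<le> (\<Sum>i<n. real k * of_bool (i \<in> ?ch))"
  proof (rule sum_mono)
    fix i assume "i \<in> {..<n}"
    then have i: "i < n"
      by simp
    then have "p i \<noteq> p ((i + 1) mod n)"
      using inj_onD[OF bij_betw_imp_inj_on[OF p], of i "(i + 1) mod n"] tour_edge_neq[OF i] by fastforce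
    then show "cost {p i, p ((i + 1) mod n)} \<le> real k * of_bool (i \<in> ?ch)"
      using dst_eq_0_iff[of "p i" "p ((i + 1) mod n)"] dst_le_k[of "{p i, p ((i + 1) mod n)}"] i by auto
  qed
  also have "\<dots> = real k * real (card ?ch)"
  proof -
    have "{..<n} \<inter> ?ch = ?ch"
      by auto
    then show ?thesis
      by (simp add: sum_distrib_left[symmetric] del: mem_Collect_eq)
  qed
  also have "card ?ch \<le> card ?V"
  proof (rule card_inj_on_le)
    show "inj_on (\<lambda>i. loc (p i)) ?ch"
    proof (rule linorder_inj_onI)
      fix i j assume ij: "i < j" "i \<in> ?ch" "j \<in> ?ch"
      show "loc (p i) \<noteq> loc (p j)"
      proof
        assume eq: "loc (p i) = loc (p j)"
        have "f (loc (p i)) \<le> f (loc (p (i + 1)))" "f (loc (p (i + 1))) \<le> f (loc (p j))"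
          using sorted[of i "i + 1"] sorted[of "i + 1" j] ij by (auto simp: p_def)
        then have "f (loc (p i)) = f (loc (p (i + 1)))"
          using eq by simp
        then have "loc (p i) = loc (p (i + 1))"
          using f locV by (auto dest: inj_onD)
        then show False
          using ij by simp
      qed
    qed auto
  qed (use locV in auto)
  finally show ?thesis
    using k1 by (simp add: mult_left_mono)
qed

text \<open>The removed trail edges together with the shortest connections of the added edges have even
  degrees; an improving move would make this edge set smaller than the girth.\<close>

lemma k_optimal_trail_tour: "k_optimal n k cost trail_tour"
proof -
  have False if mv: "k_move n k trail_tour T'" and less: "tour_cost cost T' < tour_cost cost trail_tour" for T'
  proof -
    let ?T = trail_tour
    let ?R = "?T - T'" and ?A = "T' - ?T"
    have T': "is_tour n T'" and cR: "card ?R \<le> k"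
      using mv by (auto simp: k_move_def)
    have fin: "finite ?T" "finite T'"
      using finite_tour is_tour_trail_tour T' by auto
    have split: "sum f ?T = sum f ?R + sum f (?T \<inter> T')" "sum f T' = sum f ?A + sum f (?T \<inter> T')"
      for f :: "nat set \<Rightarrow> nat"
      using sum.Int_Diff[OF fin(1), of f T'] sum.Int_Diff[OF fin(2), of f ?T] by (simp_all add: Int_commute)
    have "(\<Sum>S\<in>T'. dst S) < (\<Sum>S\<in>?T. dst S)"
      using less by (simp add: tour_cost_def flip: of_nat_sum)
    then have AR: "(\<Sum>S\<in>?A. dst S) < (\<Sum>S\<in>?R. dst S)"
      using split[of dst] by simp
    define I where "I = {i. i < n \<and> tour_edge i \<in> ?R}"
    define J where "J = {i \<in> I. i < m}"
    have finI: "finite I" "finite J"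
      by (auto simp: I_def J_def)
    have injI: "inj_on tour_edge I"
      using inj_on_tour_edges[OF bij_id n3] by (rule inj_on_subset) (auto simp: I_def)
    have R: "?R = tour_edge ` I"
      by (auto simp: I_def trail_tour_def)
    have "(\<Sum>S\<in>?R. dst S) = (\<Sum>i\<in>I. dst (tour_edge i))"
      unfolding R by (rule sum.reindex[OF injI, unfolded comp_def])
    also have "\<dots> = (\<Sum>i\<in>I. of_bool (i < m))"
      using dst_tour_edge by (intro sum.cong) (auto simp: I_def)
    also have "\<dots> = card J"
      using finI by (simp add: J_def Int_def)
    finally have costR: "(\<Sum>S\<in>?R. dst S) = card J" .
    have "card J \<le> card I"
      using finI by (intro card_mono) (auto simp: J_def)
    also have "card I = card ?R"
      unfolding R by (rule card_image[OF injI, symmetric])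
    finally have Jk: "card J \<le> k"
      using cR by simp
    \<comment> \<open>All added edges together cost less than \<open>card J \<le> k\<close>, so none
      of them is capped.\<close>
    have "\<exists>X. joins S X \<and> card X = dst S" if "S \<in> ?A" for S
    proof -
      have "dst S \<le> (\<Sum>S\<in>?A. dst S)"
        using that fin by (intro member_le_sum) auto
      then show ?thesis
        using AR costR Jk by (intro dst_attained) linarith
    qed
    then obtain X where X: "\<And>S. S \<in> ?A \<Longrightarrow> joins S (X S)" "\<And>S. S \<in> ?A \<Longrightarrow> card (X S) = dst S"
      by metis
    let ?Z0 = "es ` J"
    have injJ: "inj_on es J"
      by (rule inj_on_subset[OF inj_es]) (auto simp: J_def)
    have Z0: "?Z0 \<subseteq> E" "card ?Z0 = card J"
      using esE card_image[OF injJ] by (auto simp: J_def)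
    \<comment> \<open>The multiplicity of an edge among the removed trail edges and the chosen
      connections. Keeping the edges of odd multiplicity preserves the parity of all
      degrees.\<close>
    define g :: "'e \<Rightarrow> nat" where "g e = of_bool (e \<in> ?Z0) + (\<Sum>S\<in>?A. of_bool (e \<in> X S))" for e
    define Z where "Z = {e. e \<in> E \<and> odd (g e)}"
    have "even (\<Sum>e\<in>Z. inc e v)" for v
    proof -
      have restr: "(\<Sum>e\<in>E. of_bool (e \<in> Y) * inc e v) = (\<Sum>e\<in>Y. inc e v)" if "Y \<subseteq> E" for Y
      proof -
        have "E \<inter> Y = Y"
          using that by auto
        then show ?thesis
          using sum.inter_restrict[OF finite_E, of "\<lambda>e. inc e v" Y]
          by (simp add: of_bool_def if_distrib[of "\<lambda>x. x * _"] cong: if_cong)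
      qed
      have "(\<Sum>e\<in>E. g e * inc e v) =
          (\<Sum>e\<in>E. of_bool (e \<in> ?Z0) * inc e v) + (\<Sum>S\<in>?A. \<Sum>e\<in>E. of_bool (e \<in> X S) * inc e v)"
        unfolding g_def add_mult_distrib sum.distrib sum_distrib_right by (subst sum.swap) simp
      also have "\<dots> = (\<Sum>e\<in>?Z0. inc e v) + (\<Sum>S\<in>?A. \<Sum>e\<in>X S. inc e v)"
        using restr[OF Z0(1)] restr X(1) by (simp add: joins_def)
      finally have total: "(\<Sum>e\<in>E. g e * inc e v) = (\<Sum>e\<in>?Z0. inc e v) + (\<Sum>S\<in>?A. \<Sum>e\<in>X S. inc e v)" .
      have "even ((\<Sum>S\<in>?A. \<Sum>e\<in>X S. inc e v) + (\<Sum>S\<in>?A. occ S v))"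
        unfolding sum.distrib[symmetric] using X(1) by (intro dvd_sum) (auto simp: joins_def)
      moreover have "even ((\<Sum>e\<in>?Z0. inc e v) + (\<Sum>S\<in>?R. occ S v))"
      proof -
        have "(\<Sum>e\<in>?Z0. inc e v) = (\<Sum>i\<in>J. occ (tour_edge i) v)"
        proof -
          have "(\<Sum>e\<in>?Z0. inc e v) = (\<Sum>i\<in>J. inc (es i) v)"
            by (rule sum.reindex[OF injJ, unfolded comp_def])
          also have "\<dots> = (\<Sum>i\<in>J. occ (tour_edge i) v)"
            by (rule sum.cong) (auto simp only: J_def mem_Collect_eq inc_es)
          finally show ?thesis .
        qed
        moreover have "(\<Sum>S\<in>?R. occ S v) = (\<Sum>i\<in>I. occ (tour_edge i) v)"
          unfolding R by (rule sum.reindex[OF injI, unfolded comp_def])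
        moreover have "(\<Sum>i\<in>I. occ (tour_edge i) v) = (\<Sum>i\<in>I - J. occ (tour_edge i) v) + (\<Sum>i\<in>J. occ (tour_edge i) v)"
          using finI by (intro sum.subset_diff) (auto simp: J_def)
        \<comment> \<open>Both cities of such a tour edge are located at \<open>w 0\<close>.\<close>
        moreover have "even (\<Sum>i\<in>I - J. occ (tour_edge i) v)"
        proof (rule dvd_sum)
          fix i assume "i \<in> I - J"
          then have i: "i < n" "\<not> i < m"
            by (auto simp: I_def J_def)
          show "even (occ (tour_edge i) v)"
            unfolding occ_pair[OF tour_edge_neq[OF i(1)]] using loc_next[OF i(1)] i(2) by (simp add: loc_def)
        qed
        ultimately show ?thesis
          by simp
      qed
      moreover have "even (\<Sum>S\<in>?T. occ S v)" "even (\<Sum>S\<in>T'. occ S v)"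
        unfolding occ_def by (rule even_tour_incidence[OF is_tour_trail_tour] even_tour_incidence[OF T'])+
      then have "even ((\<Sum>S\<in>?R. occ S v) + (\<Sum>S\<in>?A. occ S v))"
        unfolding split by simp
      ultimately have "even (\<Sum>e\<in>E. g e * inc e v)"
        unfolding total by simp
      then show ?thesis
        unfolding Z_def even_sum_odd_weights[OF finite_E] .
    qed
    moreover have ZE: "Z \<subseteq> E"
      by (auto simp: Z_def)
    then have "finite Z"
      using finite_E finite_subset by blast
    ultimately have even: "even_set t u Z"
      by (intro even_setI)
    have finX: "finite (X S)" if "S \<in> ?A" for S
      using X(1)[OF that] by (rule joins_finite)
    have cX: "card (\<Union>S\<in>?A. X S) \<le> (\<Sum>S\<in>?A. dst S)"
      using card_UN_le[of ?A X] fin X(2) by simp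
    have finU: "finite (\<Union>S\<in>?A. X S)"
      using fin finX by blast
    have "g e = 0" if "e \<notin> ?Z0 \<union> (\<Union>S\<in>?A. X S)" for e
      using that by (auto simp: g_def)
    then have "Z \<subseteq> ?Z0 \<union> (\<Union>S\<in>?A. X S)"
      unfolding Z_def by (metis (mono_tags, lifting) even_zero mem_Collect_eq subsetI)
    then have "card Z \<le> card (?Z0 \<union> (\<Union>S\<in>?A. X S))"
      using finU finI by (intro card_mono) auto
    also have "\<dots> \<le> card J + (\<Sum>S\<in>?A. dst S)"
      using card_Un_le[of ?Z0 "\<Union>S\<in>?A. X S"] Z0(2) cX by linarith
    also have "\<dots> < 2 * k"
      using AR costR Jk by linarith
    finally have "Z = {}"
      using girth[OF ZE _ even] by fastforce
    \<comment> \<open>With \<open>Z\<close> empty, every removed trail edge occurs in some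
      connection, so the added edges cost at least as much as the removed ones.\<close>
    have "?Z0 \<subseteq> (\<Union>S\<in>?A. X S)"
    proof
      fix e assume e: "e \<in> ?Z0"
      show "e \<in> (\<Union>S\<in>?A. X S)"
      proof (rule ccontr)
        assume "e \<notin> (\<Union>S\<in>?A. X S)"
        then have "g e = 1"
          using e by (auto simp: g_def)
        then have "e \<in> Z"
          using e Z0(1) by (auto simp: Z_def)
        then show False
          using \<open>Z = {}\<close> by simp
      qed
    qed
    then have "card J \<le> card (\<Union>S\<in>?A. X S)"
      using Z0(2) finU card_mono by metis
    then show False
      using cX AR costR by linarith
  qed
  then show ?thesis
    using is_tour_trail_tour unfolding k_optimal_def by blast
qed

text \<open>The trail tour costs \<open>m\<close>, and the optimum is at most \<open>k\<close> per
  vertex of the trail, hence at most \<open>2 * k * m / r\<close>.\<close>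

lemma alpha_ge:
  assumes "card (w ` {..<m}) * r \<le> 2 * m"
  shows "ereal (real r / (2 * real k)) \<le> alpha k n"
proof -
  have "real (card (w ` {..<m})) * real r \<le> 2 * real m"
    using assms by (metis of_nat_le_iff of_nat_mult of_nat_numeral)
  then have "real k * (real (card (w ` {..<m})) * real r) \<le> real k * (2 * real m)"
    by (rule mult_left_mono) simp
  moreover have "OPT n cost * real r \<le> (real k * real (card (w ` {..<m}))) * real r"
    using OPT_upper by (rule mult_right_mono) simp
  ultimately have "real r * OPT n cost \<le> real m * (2 * real k)"
    by (simp add: mult_ac)
  then have "real r / (2 * real k) \<le> tour_cost cost trail_tour / OPT n cost"
    using OPT_pos k1 by (simp add: cost_trail_tour pos_le_divide_eq pos_divide_le_eq)
  moreover have "ereal (tour_cost cost trail_tour / OPT n cost) \<le> alpha k n"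
    unfolding alpha_def using metric OPT_pos k_optimal_trail_tour by (intro Sup_upper) blast
  ultimately show ?thesis
    by (meson ereal_less_eq(3) order_trans)
qed

end

theorem (in regular_bipartite) alpha_ge_of_girth:
  assumes "k \<ge> 1" "n \<ge> 3" "card E \<le> n"
    and girth: "\<And>Z. Z \<subseteq> E \<Longrightarrow> Z \<noteq> {} \<Longrightarrow> even_set t u Z \<Longrightarrow> 2 * k \<le> card Z"
  shows "ereal (real deg / (2 * real k)) \<le> alpha k n"
proof -
  obtain m es w where m: "m > 0" "inj_on es {..<m}" "es ` {..<m} \<subseteq> E"
    "\<And>i. i < m \<Longrightarrow> {t (es i), u (es i)} = {w i, w (Suc i)}" "w m = w 0"
    "card (w ` {..<m}) * deg \<le> 2 * m"
    by (rule closed_trail) blast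
  have "m \<le> card E"
    using card_mono[OF finite_E m(3)] card_image[OF m(2)] by simp
  then interpret trail_instance E t u k n m es w
    using m assms finite_E disjoint by unfold_locales auto
  show ?thesis
    by (rule alpha_ge[OF m(6)])
qed

section \<open>Finite fields of characteristic three\<close>

text \<open>A nonzero constant derivative excludes double roots.\<close>

lemma card_roots_of_unit_pderiv:
  fixes p :: "'a :: alg_closed_field poly"
  assumes "pderiv p = [:c:]" "c \<noteq> 0"
  shows "card {x. poly p x = 0} = degree p"
proof -
  have "p \<noteq> 0"
    using assms by auto
  then obtain A where A: "size A = degree p" "p = smult (lead_coeff p) (\<Prod>x\<in>#A. [:-x, 1:])"
    using alg_closed_imp_factorization by blast
  have count1: "count A a = 1" if a: "a \<in># A" for a
  proof (rule ccontr)
    assume "count A a \<noteq> 1"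
    moreover have "count A a > 0"
      using a by simp
    ultimately have "count A a > 1"
      by linarith
    then have "a \<in># A - {#a#}"
      by (simp add: in_diff_count)
    then have "add_mset a (add_mset a (A - {#a#} - {#a#})) = A"
      using a by (simp only: insert_DiffM)
    then obtain B where B: "A = add_mset a (add_mset a B)"
      by metis
    define r where "r = smult (lead_coeff p) (\<Prod>x\<in>#B. [:-x, 1:])"
    have r: "p = [:-a, 1:] * ([:-a, 1:] * r)"
      unfolding r_def by (subst A(2), subst B) (simp only: image_mset_add_mset prod_mset.add_mset mult_smult_right)
    have "poly (pderiv p) a = 0"
      unfolding r by (subst pderiv_mult, subst pderiv_mult) (simp add: pderiv_pCons)
    then show False
      using assms by simp
  qed
  have "{x. poly p x = 0} = set_mset A"
    using \<open>p \<noteq> 0\<close> by (subst A(2)) (auto simp: poly_prod_mset prod_mset_zero_iff)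
  moreover have "card (set_mset A) = size A"
    unfolding size_multiset_overloaded_eq using count1 by simp
  ultimately show ?thesis
    using A(1) by simp
qed

lemma card_frobenius_fixed_points:
  fixes q :: nat
  assumes "prime CHAR('a :: alg_closed_field)" "q = CHAR('a) ^ s" "s > 0"
  shows "card {x :: 'a. x ^ q = x} = q"
proof -
  define p :: "'a poly" where "p = monom 1 q - monom 1 1"
  have "CHAR('a) > 1"
    using assms(1) prime_gt_1_nat by blast
  then have q1: "q > 1"
    using assms one_less_power[of "CHAR('a)" s] by simp
  have "(of_nat q :: 'a) = 0"
    using assms by simp
  then have "pderiv p = [:-1:]"
    unfolding p_def by (simp add: pderiv_diff pderiv_monom monom_0)
  then have "card {x. poly p x = 0} = degree p"
    by (rule card_roots_of_unit_pderiv) simp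
  moreover have "degree p = q"
    unfolding p_def using q1
    by (subst diff_conv_add_uminus, subst degree_add_eq_left) (auto simp: degree_monom_eq)
  moreover have "{x. poly p x = 0} = {x. x ^ q = x}"
    by (simp add: p_def poly_monom)
  ultimately show ?thesis
    by simp
qed

definition finite_subring :: "'a :: idom set \<Rightarrow> bool" where
  "finite_subring F \<longleftrightarrow> finite F \<and> 1 \<in> F \<and> (\<forall>x\<in>F. \<forall>y\<in>F. x - y \<in> F \<and> x * y \<in> F)"

lemma CHAR_finite_3: "CHAR(Enum.finite_3) = 3"
proof (rule CHAR_eqI)
  have three: "of_nat 3 = (0 :: Enum.finite_3)"
  proof -
    have "of_nat 3 = (1 + (1 + 1) :: Enum.finite_3)"
      unfolding numeral_3_eq_3 of_nat_Suc by (simp only: of_nat_0 add_0_right)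
    also have "\<dots> = 0"
      unfolding zero_finite_3_def one_finite_3_def plus_finite_3_def by simp
    finally show ?thesis .
  qed
  then show "of_nat 3 = (0 :: Enum.finite_3)" .
  fix n assume "of_nat n = (0 :: Enum.finite_3)"
  moreover have "(of_nat n :: Enum.finite_3) = of_nat 3 * of_nat (n div 3) + of_nat (n mod 3)"
    by (metis of_nat_add of_nat_mult mult_div_mod_eq)
  ultimately have "(of_nat (n mod 3) :: Enum.finite_3) = 0"
    unfolding three by (simp only: mult_zero_left add_0_left)
  moreover have "n mod 3 = 0 \<or> n mod 3 = 1 \<or> n mod 3 = 2"
    by linarith
  ultimately have "n mod 3 = 0"
    by (elim disjE) simp_all
  then show "3 dvd n"
    by (rule mod_0_imp_dvd)
qed

text \<open>The field with \<open>3 ^ s\<close> elements, realized as the fixed points of a power of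
  Frobenius in the algebraic closure; additivity of Frobenius gives closure under
  differences.\<close>

lemma finite_subring_of_power_3:
  assumes "s > 0"
  obtains F :: "Enum.finite_3 alg_closure set" where "finite_subring F" "card F = 3 ^ s"
proof
  let ?q = "3 ^ s :: nat"
  let ?F = "{x :: Enum.finite_3 alg_closure. x ^ ?q = x}"
  have char: "CHAR(Enum.finite_3 alg_closure) = 3"
    by (simp add: CHAR_finite_3)
  then have prime: "prime CHAR(Enum.finite_3 alg_closure)"
    by simp
  show card: "card ?F = 3 ^ s"
    by (rule card_frobenius_fixed_points[OF prime _ assms]) (simp only: char)
  have add: "(x + y) ^ ?q = x ^ ?q + y ^ ?q" for x y :: "Enum.finite_3 alg_closure"
    by (rule freshmans_dream'[OF prime, where n = s]) (simp only: char)
  have "(x - y) ^ ?q = x ^ ?q - y ^ ?q" for x y :: "Enum.finite_3 alg_closure"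
    using add[of "x - y" y] by (metis add_diff_cancel_right' diff_add_cancel)
  then have "x - y \<in> ?F \<and> x * y \<in> ?F" if "x \<in> ?F" "y \<in> ?F" for x y
    using that unfolding mem_Collect_eq power_mult_distrib by metis
  moreover have "finite ?F"
    using card by (intro card_ge_0_finite) simp
  ultimately show "finite_subring ?F"
    unfolding finite_subring_def mem_Collect_eq power_one by blast
qed

lemma two_neq_0_finite_3_alg_closure: "(2 :: Enum.finite_3 alg_closure) \<noteq> 0"
proof
  assume "(2 :: Enum.finite_3 alg_closure) = 0"
  then have "of_nat 2 = (0 :: Enum.finite_3 alg_closure)"
    by simp
  then show False
    using of_nat_eq_0_iff_char_dvd[of 2, where 'a = "Enum.finite_3 alg_closure"] dvd_imp_le[of 3 2]
    by (simp add: CHAR_finite_3)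
qed

section \<open>Graphs of girth six, eight and twelve\<close>

text \<open>A lift of the complete bipartite graph on two copies of \<open>F\<close>: the fibre over
  every vertex is a copy of \<open>A\<close>, and the edge from \<open>x\<close> to \<open>y\<close>
  matches the fibres over its ends by \<open>f x y\<close>.\<close>

locale lift_graph =
  fixes F :: "'a set" and A :: "'b set" and f :: "'a \<Rightarrow> 'a \<Rightarrow> 'b \<Rightarrow> 'b"
  assumes finite_F: "finite F" and F_nonempty: "F \<noteq> {}" and finite_A: "finite A" and A_nonempty: "A \<noteq> {}"
    and bij: "\<And>x y. x \<in> F \<Longrightarrow> y \<in> F \<Longrightarrow> bij_betw (f x y) A A" and even_card: "even (card F)"
begin

definition point :: "'a \<times> 'a \<times> 'b \<Rightarrow> 'a \<times> 'b + 'a \<times> 'b" where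
  "point = (\<lambda>(x, y, a). Inl (x, a))"

definition line :: "'a \<times> 'a \<times> 'b \<Rightarrow> 'a \<times> 'b + 'a \<times> 'b" where
  "line = (\<lambda>(x, y, a). Inr (y, f x y a))"

lemma f_in: "x \<in> F \<Longrightarrow> y \<in> F \<Longrightarrow> a \<in> A \<Longrightarrow> f x y a \<in> A"
  using bij[of x y] by (auto simp: bij_betw_def)

lemma f_inj: "f x y a = f x y a' \<Longrightarrow> x \<in> F \<Longrightarrow> y \<in> F \<Longrightarrow> a \<in> A \<Longrightarrow> a' \<in> A \<Longrightarrow> a = a'"
  using bij[of x y] by (auto simp: bij_betw_def inj_on_def)

lemma card_point_fibre:
  assumes "e \<in> F \<times> F \<times> A"
  shows "card {e' \<in> F \<times> F \<times> A. point e' = point e} = card F"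
proof -
  obtain x y a where e: "e = (x, y, a)" "x \<in> F" "y \<in> F" "a \<in> A"
    using assms by auto
  have "{e' \<in> F \<times> F \<times> A. point e' = point e} = (\<lambda>y. (x, y, a)) ` F"
    using e by (auto simp: point_def)
  then show ?thesis
    by (simp add: card_image inj_on_def)
qed

lemma card_line_fibre:
  assumes "e \<in> F \<times> F \<times> A"
  shows "card {e' \<in> F \<times> F \<times> A. line e' = line e} = card F"
proof -
  obtain x y a where e: "e = (x, y, a)" "x \<in> F" "y \<in> F" "a \<in> A"
    using assms by auto
  let ?S = "{e' \<in> F \<times> F \<times> A. line e' = line e}"
  have inj: "inj_on fst ?S"
  proof (rule inj_onI)
    fix e1 e2 assume e12: "e1 \<in> ?S" "e2 \<in> ?S" "fst e1 = fst e2"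
    obtain x1 y1 a1 x2 y2 a2 where "e1 = (x1, y1, a1)" "e2 = (x2, y2, a2)"
      by (metis surj_pair)
    then show "e1 = e2"
      using e12 e f_inj[of x1 y1 a1 a2] by (auto simp: line_def)
  qed
  have img: "fst ` ?S = F"
  proof
    show "F \<subseteq> fst ` ?S"
    proof
      fix x' assume x': "x' \<in> F"
      have "f x y a \<in> f x' y ` A"
        using bij[OF x' e(3)] f_in[OF e(2-4)] by (auto simp: bij_betw_def)
      then obtain a' where "a' \<in> A" "f x' y a' = f x y a"
        by auto
      then have "(x', y, a') \<in> ?S"
        using x' e by (simp add: line_def)
      then show "x' \<in> fst ` ?S"
        by force
    qed
  qed auto
  show ?thesis
    using card_image[OF inj] unfolding img by simp
qed

sublocale regular_bipartite "F \<times> F \<times> A" point line "card F"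
proof
  show "point e \<noteq> line e'" for e e'
    by (simp add: point_def line_def split: prod.splits)
qed (use finite_F finite_A F_nonempty A_nonempty even_card card_point_fibre card_line_fibre in auto)

text \<open>\<open>(U i, B i)\<close> are the points and \<open>W i\<close> the first coordinates of
  the lines in cyclic order, extended periodically so that closing up needs no case distinction. If
  consecutive coordinates agreed, two consecutive edges would coincide.\<close>

lemma even_set_closed_walk:
  assumes Z: "Z \<subseteq> F \<times> F \<times> A" "Z \<noteq> {}" "even_set point line Z"
  obtains r :: nat and U W :: "nat \<Rightarrow> 'a" and B :: "nat \<Rightarrow> 'b" where "r > 0" "2 * r \<le> card Z"
    "\<And>i. U (i + r) = U i" "\<And>i. W (i + r) = W i" "\<And>i. B (i + r) = B i"
    "\<And>i. U i \<noteq> U (Suc i)" "\<And>i. W i \<noteq> W (Suc i)"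
    "\<And>i. f (U i) (W i) (B i) = f (U (Suc i)) (W i) (B (Suc i))"
proof -
  have finZ: "finite Z"
    using Z(1) finite_F finite_A finite_subset by (meson finite_SigmaI)
  obtain r :: nat and es where r: "r > 0" and inj: "inj_on es {..<2 * r}" and esZ: "es ` {..<2 * r} \<subseteq> Z"
    and pt: "\<And>i. i < r \<Longrightarrow> point (es (2 * i)) = point (es (2 * i + 1))"
    and ln: "\<And>i. i < r \<Longrightarrow> line (es (2 * i + 1)) = line (es ((2 * i + 2) mod (2 * r)))"
  proof (rule even_set_cycle[OF finZ Z(2,3)], goal_cases)
    case (1 r es)
    from 1(2-) show ?case
      by (rule 1(1))
  qed
  define U where "U i = fst (es (2 * (i mod r)))" for i
  define B where "B i = snd (snd (es (2 * (i mod r))))" for i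
  define W where "W i = fst (snd (es (2 * (i mod r) + 1)))" for i
  have E: "es i \<in> F \<times> F \<times> A" if "i < 2 * r" for i
    using esZ Z(1) that by blast
  have odd: "es (2 * (i mod r) + 1) = (U i, W i, B i)" for i
    using pt[of "i mod r"] r unfolding U_def W_def B_def point_def by (auto simp: case_prod_beta prod_eq_iff)
  have even: "es (2 * (Suc i mod r)) = (U (Suc i), W i, B (Suc i)) \<and>
      f (U i) (W i) (B i) = f (U (Suc i)) (W i) (B (Suc i))" for i
  proof -
    have "(2 * (i mod r) + 2) mod (2 * r) = 2 * (Suc (i mod r) mod r)"
      unfolding mult_mod_right by simp
    also have "Suc (i mod r) mod r = Suc i mod r"
      by (rule mod_Suc_eq)
    finally have "line (U i, W i, B i) = line (es (2 * (Suc i mod r)))"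
      using ln[of "i mod r"] r odd[of i] by simp
    then show ?thesis
      unfolding U_def[of "Suc i"] B_def[of "Suc i"] line_def by (auto simp: case_prod_beta prod_eq_iff)
  qed
  have neq: "es (2 * (i mod r) + 1) \<noteq> es (2 * (j mod r))" for i j
  proof -
    have "2 * (i mod r) + 1 < 2 * r" "2 * (j mod r) < 2 * r"
      using mod_less_divisor[OF r, of i] mod_less_divisor[OF r, of j] by linarith+
    moreover have "2 * a + 1 \<noteq> 2 * b" for a b :: nat
      by presburger
    ultimately show ?thesis
      using inj_onD[OF inj] by blast
  qed
  have mem: "U i \<in> F \<and> W i \<in> F \<and> B i \<in> A" for i
  proof -
    have "2 * (i mod r) + 1 < 2 * r"
      using mod_less_divisor[OF r, of i] by linarith
    then show ?thesis
      using E[of "2 * (i mod r) + 1"] odd[of i] by simp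
  qed
  show ?thesis
  proof (rule that[of r U W B])
    show "2 * r \<le> card Z"
      using card_mono[OF finZ esZ] card_image[OF inj] by simp
    show "U i \<noteq> U (Suc i)" for i
    proof
      assume eq: "U i = U (Suc i)"
      then have "B i = B (Suc i)"
        using f_inj[of "U i" "W i" "B i" "B (Suc i)"] even[of i] mem[of i] mem[of "Suc i"] by simp
      then show False
        using neq[of i "Suc i"] odd[of i] even[of i] eq by simp
    qed
    show "W i \<noteq> W (Suc i)" for i
      using neq[of "Suc i" "Suc i"] odd[of "Suc i"] even[of i] by auto
  qed (use r even in \<open>simp_all add: U_def W_def B_def\<close>)
qed

end

lemma finite_subring_0: "finite_subring F \<Longrightarrow> 0 \<in> F"
  unfolding finite_subring_def by (metis diff_self)

lemma finite_subring_closed: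
  "finite_subring F \<Longrightarrow> x \<in> F \<Longrightarrow> y \<in> F \<Longrightarrow> x - y \<in> F"
  "finite_subring F \<Longrightarrow> x \<in> F \<Longrightarrow> y \<in> F \<Longrightarrow> x * y \<in> F"
  by (auto simp: finite_subring_def)

text \<open>Point \<open>(x, p)\<close> lies on line \<open>(y, b)\<close> when
  \<open>p + b = x * y\<close>: the affine part of a projective plane.\<close>

definition lift6 :: "'a :: idom \<Rightarrow> 'a \<Rightarrow> 'a \<Rightarrow> 'a" where
  "lift6 x y p = x * y - p"

text \<open>For a line \<open>(y, b, c)\<close> incidence reads \<open>p + b = x * y\<close> and
  \<open>q + c = x * b\<close>: the affine part of a generalized quadrangle.\<close>

definition lift8 :: "'a :: idom \<Rightarrow> 'a \<Rightarrow> 'a \<times> 'a \<Rightarrow> 'a \<times> 'a" where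
  "lift8 x y = (\<lambda>(p, q). (x * y - p, x * (x * y - p) - q))"

text \<open>The affine part of the split Cayley hexagon, in a form in which
  \<open>(1, y, b, c, y * c - b * b)\<close> runs through a quadric of the four-dimensional projective space.\<close>

definition lift12 :: "'a :: idom \<Rightarrow> 'a \<Rightarrow> 'a \<times> 'a \<times> 'a \<times> 'a \<Rightarrow> 'a \<times> 'a \<times> 'a \<times> 'a" where
  "lift12 x y = (\<lambda>(p, q, r, s). let b = x * y - p; c = x * b - q in (b, c, x * c - r, x * (y * c - b * b) - s))"

text \<open>In all three lifts a coordinate of the line plus the matching coordinate of the point is
  a polynomial in \<open>x\<close> and earlier line coordinates, so the point is recovered from the
  line by the same subtractions.\<close>

lemma bij_lift6: "finite_subring F \<Longrightarrow> x \<in> F \<Longrightarrow> y \<in> F \<Longrightarrow> bij_betw (lift6 x y) F F"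
  by (rule bij_betw_byWitness[of _ "lift6 x y"]) (auto simp: lift6_def finite_subring_closed)

lemma bij_lift8: "finite_subring F \<Longrightarrow> x \<in> F \<Longrightarrow> y \<in> F \<Longrightarrow> bij_betw (lift8 x y) (F \<times> F) (F \<times> F)"
  by (rule bij_betw_byWitness[of _ "\<lambda>(b, c). (x * y - b, x * b - c)"])
    (auto simp: lift8_def finite_subring_closed)

lemma bij_lift12:
  "finite_subring F \<Longrightarrow> x \<in> F \<Longrightarrow> y \<in> F \<Longrightarrow> bij_betw (lift12 x y) (F \<times> F \<times> F \<times> F) (F \<times> F \<times> F \<times> F)"
  by (rule bij_betw_byWitness[of _ "\<lambda>(b, c, d, e). (x * y - b, x * b - c, x * c - d, x * (y * c - b * b) - e)"])
    (auto simp: lift12_def Let_def finite_subring_closed)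

lemma lift_graph_finite_subring:
  assumes "finite_subring F" "even (card (F - {0}))" "finite A" "A \<noteq> {}"
    and "\<And>x y. x \<in> F \<Longrightarrow> y \<in> F \<Longrightarrow> bij_betw (f x y) A A"
  shows "lift_graph (F - {0}) A f"
proof
  show "F - {0} \<noteq> {}"
    using assms(1) unfolding finite_subring_def by (metis Diff_iff empty_iff singletonD zero_neq_one)
qed (use assms in \<open>auto simp: finite_subring_def\<close>)

section \<open>Excluding short closed walks\<close>

lemma closed_walk_2_eq:
  fixes u0 u1 w0 w1 p0 p1 :: "'a :: idom"
  assumes "u0 * w0 - p0 = u1 * w0 - p1" "u1 * w1 - p1 = u0 * w1 - p0"
  shows "(u0 - u1) * (w0 - w1) = 0"
proof -
  have "(u0 - u1) * w0 = p0 - p1" "(u1 - u0) * w1 = p1 - p0"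
    using assms by (simp_all add: algebra_simps)
  moreover have "(u0 - u1) * (w0 - w1) = (u0 - u1) * w0 + (u1 - u0) * w1"
    by (simp add: algebra_simps)
  ultimately show ?thesis
    by simp
qed

text \<open>Weighted by the differences of consecutive \<open>u\<close>, both the \<open>w\<close>
  and the \<open>b\<close> sum to 0, because incidence makes these sums telescope. One combination
  of the two sums factors into differences of neighbouring coordinates.\<close>

lemma closed_walk_3_eq:
  fixes u0 u1 u2 w0 w1 w2 p0 p1 p2 q0 q1 q2 b0 b1 b2 :: "'a :: idom"
  assumes b: "b0 = u0 * w0 - p0" "b0 = u1 * w0 - p1" "b1 = u1 * w1 - p1" "b1 = u2 * w1 - p2"
    "b2 = u2 * w2 - p2" "b2 = u0 * w2 - p0"
    and q: "u0 * b0 - q0 = u1 * b0 - q1" "u1 * b1 - q1 = u2 * b1 - q2" "u2 * b2 - q2 = u0 * b2 - q0"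
  shows "(u2 - u0) * (u2 - u1) * (w2 - w1) = 0"
proof -
  have w: "(u0 - u1) * w0 = p0 - p1" "(u1 - u2) * w1 = p1 - p2" "(u2 - u0) * w2 = p2 - p0"
    using trans[OF b(1)[symmetric] b(2)] trans[OF b(3)[symmetric] b(4)] trans[OF b(5)[symmetric] b(6)]
    by (simp_all add: algebra_simps)
  have q': "(u0 - u1) * b0 = q0 - q1" "(u1 - u2) * b1 = q1 - q2" "(u2 - u0) * b2 = q2 - q0"
    using q by (simp_all add: algebra_simps)
  have b2: "b2 = b1 + u2 * (w2 - w1)"
    unfolding b(5) b(4) by (simp add: algebra_simps)
  have b1: "b1 = b0 + u1 * (w1 - w0)"
    unfolding b(3) b(2) by (simp add: algebra_simps)
  have "(u2 - u0) * (u2 - u1) * (w2 - w1) = ((u0 - u1) * b0 + (u1 - u2) * b1 + (u2 - u0) * b2)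
      - u1 * ((u0 - u1) * w0 + (u1 - u2) * w1 + (u2 - u0) * w2)"
    unfolding b2 b1 by (simp add: algebra_simps)
  then show ?thesis
    unfolding w q' by simp
qed

lemma closed_walk_ne_2:
  fixes U W P :: "nat \<Rightarrow> 'a :: idom"
  assumes U: "\<And>i. U i \<noteq> U (Suc i)" and W: "\<And>i. W i \<noteq> W (Suc i)"
    and per: "\<And>i. U (i + r) = U i" "\<And>i. P (i + r) = P i"
    and P: "\<And>i. U i * W i - P i = U (Suc i) * W i - P (Suc i)"
  shows "r \<noteq> 2"
proof
  assume r: "r = 2"
  have "U 2 = U 0" "P 2 = P 0"
    using per[of 0] r by (simp_all add: numeral_2_eq_2)
  then have "(U 0 - U 1) * (W 0 - W 1) = 0"
    using P[of 0] P[of 1] by (intro closed_walk_2_eq[of _ _ "P 0" _ "P 1"]) (simp_all add: numeral_2_eq_2)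
  then show False
    using U[of 0] W[of 0] by simp
qed

lemma closed_walk_ne_3:
  fixes U W b P Q :: "nat \<Rightarrow> 'a :: idom"
  assumes U: "\<And>i. U i \<noteq> U (Suc i)" and W: "\<And>i. W i \<noteq> W (Suc i)"
    and per: "\<And>i. U (i + r) = U i" "\<And>i. P (i + r) = P i" "\<And>i. Q (i + r) = Q i"
    and b: "\<And>i. b i = U i * W i - P i" "\<And>i. b i = U (Suc i) * W i - P (Suc i)"
    and Q: "\<And>i. U i * b i - Q i = U (Suc i) * b i - Q (Suc i)"
  shows "r \<noteq> 3"
proof
  assume r: "r = 3"
  have p: "U 3 = U 0" "P 3 = P 0" "Q 3 = Q 0"
    using per(1)[of 0] per(2)[of 0] per(3)[of 0] r by simp_all
  have Suc: "Suc 0 = 1" "Suc 1 = 2" "Suc 2 = 3"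
    by simp_all
  have "(U 2 - U 0) * (U 2 - U 1) * (W 2 - W 1) = 0"
    by (rule closed_walk_3_eq[OF b(1)[of 0] b(2)[of 0, unfolded Suc] b(1)[of 1] b(2)[of 1, unfolded Suc] b(1)[of 2]
      b(2)[of 2, unfolded Suc p] Q[of 0, unfolded Suc] Q[of 1, unfolded Suc] Q[of 2, unfolded Suc p]])
  then show False
    using U[of 2, unfolded Suc p] U[of 1, unfolded Suc] W[of 1, unfolded Suc] by simp
qed

text \<open>Point \<open>i\<close> is \<open>(U i, P i, Q i, R i, S i)\<close>. Line
  \<open>i\<close> passes through points \<open>i\<close> and \<open>Suc i\<close> and starts with
  \<open>W i\<close>, \<open>b i\<close>, \<open>c i\<close>; its two remaining coordinates are
  eliminated in the equations for \<open>R\<close> and \<open>S\<close>.\<close>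

locale hexagon_walk =
  fixes U W b c :: "nat \<Rightarrow> 'a :: idom" and P Q R S :: "nat \<Rightarrow> 'a" and r :: nat
  assumes U: "\<And>i. U i \<noteq> U (Suc i)" and W: "\<And>i. W i \<noteq> W (Suc i)"
    and per: "\<And>i. U (i + r) = U i" "\<And>i. W (i + r) = W i" "\<And>i. P (i + r) = P i" "\<And>i. Q (i + r) = Q i"
      "\<And>i. R (i + r) = R i" "\<And>i. S (i + r) = S i"
    and b: "\<And>i. b i = U i * W i - P i" "\<And>i. b i = U (Suc i) * W i - P (Suc i)"
    and c: "\<And>i. c i = U i * b i - Q i" "\<And>i. c i = U (Suc i) * b i - Q (Suc i)"
    and R: "\<And>i. U i * c i - R i = U (Suc i) * c i - R (Suc i)"
    and S: "\<And>i. U i * (W i * c i - b i * b i) - S i = U (Suc i) * (W i * c i - b i * b i) - S (Suc i)"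
    and two: "(2 :: 'a) \<noteq> 0"
begin

definition lam :: "nat \<Rightarrow> 'a" where
  "lam i = U i - U (Suc i)"

text \<open>The polar form of the quadric at two of its points, up to sign.\<close>

definition q :: "nat \<Rightarrow> nat \<Rightarrow> 'a" where
  "q i j = (W j - W i) * (c j - c i) - (b j - b i) * (b j - b i)"

lemma lam_nz: "lam i \<noteq> 0"
  using U by (simp add: lam_def)

lemma b_Suc: "b (Suc i) = b i + U (Suc i) * (W (Suc i) - W i)"
  unfolding b(1)[of "Suc i"] b(2)[of i] by (simp add: algebra_simps)

lemma c_Suc: "c (Suc i) = c i + U (Suc i) * U (Suc i) * (W (Suc i) - W i)"
proof -
  have "c (Suc i) = c i + U (Suc i) * (b (Suc i) - b i)"
    unfolding c(1)[of "Suc i"] c(2)[of i] by (simp add: algebra_simps)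
  then show ?thesis
    unfolding b_Suc by (simp add: algebra_simps)
qed

lemma b_per: "b (i + r) = b i" and c_per: "c (i + r) = c i" and lam_per: "lam (i + r) = lam i"
  using per(1)[of "Suc i"] by (simp_all add: b(1) c(1) lam_def per)

lemma q_per: "q i (j + r) = q i j" "q (i + r) j = q i j"
  by (simp_all add: q_def per b_per c_per)

lemma q_commute: "q i j = q j i"
  by (simp add: q_def algebra_simps)

lemma q_adjacent: "q i (Suc i) = 0"
  unfolding q_def b_Suc c_Suc by (simp add: algebra_simps)

text \<open>The step from line \<open>i\<close> to the next changes \<open>(W, b, c)\<close> by a
  multiple of \<open>(1, u, u * u)\<close> with \<open>u = U (Suc i)\<close>. Two such vectors pair
  to the square of the difference of their parameters.\<close>

lemma q_two_steps: "q i (Suc (Suc i)) = (W (Suc i) - W i) * (W (Suc (Suc i)) - W (Suc i)) * (lam (Suc i) * lam (Suc i))"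
  unfolding q_def lam_def b_Suc c_Suc by (simp add: algebra_simps)

lemma q_two_steps_nz: "q i (Suc (Suc i)) \<noteq> 0"
  unfolding q_two_steps using lam_nz W[of i] W[of "Suc i"] by simp

lemma sum_closed:
  assumes "\<And>i. lam i * g i = G i - G (Suc i)" "\<And>i. G (i + r) = G i"
  shows "(\<Sum>i<r. lam (j + i) * g (j + i)) = 0"
proof -
  have "(\<Sum>i<r. lam (j + i) * g (j + i)) = (\<Sum>i<r. G (j + i) - G (j + Suc i))"
    using assms(1) by simp
  also have "\<dots> = G (j + 0) - G (j + r)"
    by (rule sum_lessThan_telescope')
  finally show ?thesis
    using assms(2)[of j] by simp
qed

text \<open>For fixed \<open>j\<close>, \<open>q j i\<close> is a linear combination of
  \<open>1\<close>, \<open>W i\<close>, \<open>b i\<close>, \<open>c i\<close> and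
  \<open>W i * c i - b i * b i\<close>, each of which telescopes when weighted by
  \<open>lam i\<close>. The last coordinate of \<open>lift12\<close> makes the quadratic term
  telescope.\<close>

lemma sum_q: "(\<Sum>i<r. lam (j + i) * q j (j + i)) = 0"
proof -
  have "lam i * W i = P i - P (Suc i)" for i
    using b(1)[of i] b(2)[of i] by (simp add: lam_def algebra_simps)
  then have sY: "(\<Sum>i<r. lam (j + i) * W (j + i)) = 0"
    by (rule sum_closed) (rule per)
  have "lam i * b i = Q i - Q (Suc i)" for i
    using c(1)[of i] c(2)[of i] by (simp add: lam_def algebra_simps)
  then have sb: "(\<Sum>i<r. lam (j + i) * b (j + i)) = 0"
    by (rule sum_closed) (rule per)
  have "lam i * c i = R i - R (Suc i)" for i
    using R[of i] by (simp add: lam_def algebra_simps)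
  then have sc: "(\<Sum>i<r. lam (j + i) * c (j + i)) = 0"
    by (rule sum_closed) (rule per)
  have "lam i * (W i * c i - b i * b i) = S i - S (Suc i)" for i
    using S[of i] by (simp add: lam_def algebra_simps)
  then have sz: "(\<Sum>i<r. lam (j + i) * (W (j + i) * c (j + i) - b (j + i) * b (j + i))) = 0"
    by (rule sum_closed) (rule per)
  have s1: "(\<Sum>i<r. lam (j + i) * 1) = 0"
    by (rule sum_closed[of "\<lambda>_. 1" U]) (simp_all add: lam_def per)
  have "lam i * q j i = lam i * (W i * c i - b i * b i) - c j * (lam i * W i) - W j * (lam i * c i)
      + 2 * b j * (lam i * b i) + (W j * c j - b j * b j) * (lam i * 1)" for i
    by (simp add: q_def algebra_simps)
  then have "(\<Sum>i<r. lam (j + i) * q j (j + i)) =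
      (\<Sum>i<r. lam (j + i) * (W (j + i) * c (j + i) - b (j + i) * b (j + i)))
      - c j * (\<Sum>i<r. lam (j + i) * W (j + i)) - W j * (\<Sum>i<r. lam (j + i) * c (j + i))
      + 2 * b j * (\<Sum>i<r. lam (j + i) * b (j + i)) + (W j * c j - b j * b j) * (\<Sum>i<r. lam (j + i) * 1)"
    by (simp only: sum.distrib sum_subtractf sum_distrib_left)
  then show ?thesis
    unfolding sY sb sc sz s1 by simp
qed

lemma length_ne_3: "r \<noteq> 3"
proof
  assume r: "r = 3"
  have "q 0 2 = q 2 (0 + r)"
    unfolding q_per by (rule q_commute)
  also have "\<dots> = 0"
    using q_adjacent[of 2] r by (simp add: numeral_2_eq_2 numeral_3_eq_3)
  finally show False
    using q_two_steps_nz[of 0] by (simp add: numeral_2_eq_2)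
qed

lemma length_ne_4: "r \<noteq> 4"
proof
  assume r: "r = 4"
  have "q 0 3 = q 3 (0 + r)"
    unfolding q_per by (rule q_commute)
  also have "\<dots> = 0"
    using q_adjacent[of 3] r by simp
  finally have "lam 2 * q 0 2 = 0"
    using sum_q[of 0] r q_adjacent[of 0] by (simp add: eval_nat_numeral q_def)
  then show False
    using q_two_steps_nz[of 0] lam_nz[of 2] by (simp add: numeral_2_eq_2)
qed

text \<open>Around a pentagon the polar forms at distance two satisfy five relations whose product says
  that a nonzero number equals its negative.\<close>

lemma length_ne_5: "r \<noteq> 5"
proof
  assume r: "r = 5"
  define w where "w j = q j (Suc (Suc j))" for j
  \<comment> \<open>Only the lines \<open>j + 2\<close> and \<open>j + 3\<close> survive in
    \<open>sum_q\<close>; seen from the latter, line \<open>j\<close> is two steps ahead.\<close>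
  have rel: "lam (j + 2) * w j = - (lam (j + 3) * w (j + 3))" for j
  proof -
    have "q j (j + 4) = q (j + 4) (j + r)"
      unfolding q_per by (rule q_commute)
    also have "j + r = Suc (j + 4)"
      using r by simp
    finally have q4: "q j (j + 4) = 0"
      unfolding q_adjacent .
    have "q j (j + 3) = q (j + 3) (j + r)"
      unfolding q_per by (rule q_commute)
    also have "j + r = Suc (Suc (j + 3))"
      using r by simp
    finally have q3: "q j (j + 3) = w (j + 3)"
      unfolding w_def .
    have "(\<Sum>i<5. lam (j + i) * q j (j + i)) = lam j * q j j + lam (j + 1) * q j (j + 1)
        + lam (j + 2) * q j (j + 2) + lam (j + 3) * q j (j + 3) + lam (j + 4) * q j (j + 4)"
      by (simp add: eval_nat_numeral)
    moreover have "q j j = 0" "q j (j + 1) = 0" "q j (j + 2) = w j"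
      using q_adjacent[of j] by (simp_all add: q_def[of j j] w_def)
    ultimately show ?thesis
      using sum_q[of j] q3 q4 unfolding r by (simp add: eq_neg_iff_add_eq_0)
  qed
  have w_per: "w (j + 5) = w j" for j
    using q_per[of j "Suc (Suc j)"] q_per(2)[of j "Suc (Suc j) + r"] r by (simp add: w_def)
  have lam5: "lam (j + 5) = lam j" for j
    using lam_per r by simp
  have w5: "w 5 = w 0" "w 6 = w 1" "w 7 = w 2"
    using w_per[of 0] w_per[of 1] w_per[of 2] by simp_all
  have l5: "lam 5 = lam 0" "lam 6 = lam 1" "lam 7 = lam 2"
    using lam5[of 0] lam5[of 1] lam5[of 2] by simp_all
  define M where "M = lam 0 * lam 1 * lam 2 * lam 3 * lam 4 * (w 0 * w 1 * w 2 * w 3 * w 4)"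
  have "M = (lam 2 * w 0) * (lam 3 * w 1) * (lam 4 * w 2) * (lam 0 * w 3) * (lam 1 * w 4)"
    by (simp add: M_def mult_ac)
  also have "\<dots> = - ((lam 3 * w 3) * (lam 4 * w 4) * (lam 0 * w 0) * (lam 1 * w 1) * (lam 2 * w 2))"
  proof -
    have Suc: "Suc (Suc 0) = 2" "Suc (Suc (Suc 0)) = 3"
      by simp_all
    have r0: "lam 2 * w 0 = - (lam 3 * w 3)" and r1: "lam 3 * w 1 = - (lam 4 * w 4)"
      and r2: "lam 4 * w 2 = - (lam 0 * w 0)" and r3: "lam 0 * w 3 = - (lam 1 * w 1)"
      and r4: "lam 1 * w 4 = - (lam 2 * w 2)"
      using rel[of 0] rel[of 1] rel[of 2] rel[of 3] rel[of 4] by (simp_all add: w5 l5 Suc)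
    show ?thesis
      unfolding r0 r1 r2 r3 r4 by (simp only: minus_mult_minus mult_minus_left mult_minus_right minus_minus)
  qed
  also have "\<dots> = - M"
    by (simp add: M_def mult_ac)
  finally have "M + M = 0"
    by (rule iffD1[OF eq_neg_iff_add_eq_0])
  then have "2 * M = 0"
    by (simp only: mult_2)
  moreover have "w j \<noteq> 0" for j
    unfolding w_def by (rule q_two_steps_nz)
  then have "M \<noteq> 0"
    using lam_nz by (simp add: M_def)
  ultimately show False
    using two by simp
qed

end

context
  fixes F :: "'a :: idom set"
  assumes F: "finite_subring F" "even (card (F - {0}))"
begin

lemma F_facts: "finite F" "F \<noteq> {}"
  using F finite_subring_0[OF F(1)] by (auto simp: finite_subring_def)

text \<open>A closed walk of length \<open>r\<close> accounts for \<open>2 * r\<close> edges of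
  \<open>Z\<close>, so it remains to exclude \<open>r = 1\<close> and \<open>r = 2\<close>; the
  former would make consecutive \<open>U\<close> equal.\<close>

lemma girth_lift6:
  assumes "Z \<subseteq> (F - {0}) \<times> (F - {0}) \<times> F" "Z \<noteq> {}"
    "even_set lift_graph.point (lift_graph.line lift6) Z"
  shows "2 * 3 \<le> card Z"
proof -
  interpret lift_graph "F - {0}" F lift6
    by (rule lift_graph_finite_subring[OF F]) (use F_facts bij_lift6[OF F(1)] in auto)
  obtain r :: nat and U W P :: "nat \<Rightarrow> 'a" where r: "r > 0" "2 * r \<le> card Z"
    and per: "\<And>i. U (i + r) = U i" "\<And>i. W (i + r) = W i" "\<And>i. P (i + r) = P i"
    and neq: "\<And>i. U i \<noteq> U (Suc i)" "\<And>i. W i \<noteq> W (Suc i)"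
    and step: "\<And>i. lift6 (U i) (W i) (P i) = lift6 (U (Suc i)) (W i) (P (Suc i))"
  proof (rule even_set_closed_walk[OF assms], goal_cases)
    case (1 r U W B)
    from 1(2-) show ?case
      by (rule 1(1))
  qed
  have "r \<noteq> 1"
    using per(1)[of 0] neq(1)[of 0] by auto
  moreover have "r \<noteq> 2"
    by (rule closed_walk_ne_2[of U W r P]) (use neq per step in \<open>simp_all add: lift6_def\<close>)
  ultimately show ?thesis
    using r by linarith
qed

lemma girth_lift8:
  assumes "Z \<subseteq> (F - {0}) \<times> (F - {0}) \<times> F \<times> F" "Z \<noteq> {}"
    "even_set lift_graph.point (lift_graph.line lift8) Z"
  shows "2 * 4 \<le> card Z"
proof -
  interpret lift_graph "F - {0}" "F \<times> F" lift8
    by (rule lift_graph_finite_subring[OF F]) (use F_facts bij_lift8[OF F(1)] in auto)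
  obtain r :: nat and U W :: "nat \<Rightarrow> 'a" and B :: "nat \<Rightarrow> 'a \<times> 'a" where r: "r > 0" "2 * r \<le> card Z"
    and per: "\<And>i. U (i + r) = U i" "\<And>i. W (i + r) = W i" "\<And>i. B (i + r) = B i"
    and neq: "\<And>i. U i \<noteq> U (Suc i)" "\<And>i. W i \<noteq> W (Suc i)"
    and step: "\<And>i. lift8 (U i) (W i) (B i) = lift8 (U (Suc i)) (W i) (B (Suc i))"
  proof (rule even_set_closed_walk[OF assms], goal_cases)
    case (1 r U W B)
    from 1(2-) show ?case
      by (rule 1(1))
  qed
  define P Q where "P i = fst (B i)" and "Q i = snd (B i)" for i
  define b where "b i = U i * W i - P i" for i
  have perPQ: "P (i + r) = P i" "Q (i + r) = Q i" for i
    using per(3) by (simp_all add: P_def Q_def)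
  have b': "b i = U (Suc i) * W i - P (Suc i)" for i
    using step[of i] by (simp add: lift8_def case_prod_beta b_def P_def)
  have Q': "U i * b i - Q i = U (Suc i) * b i - Q (Suc i)" for i
  proof -
    have "lift8 (U i) (W i) (B i) = (b i, U i * b i - Q i)"
      by (simp add: lift8_def case_prod_beta b_def P_def Q_def)
    moreover have "lift8 (U (Suc i)) (W i) (B (Suc i)) = (b i, U (Suc i) * b i - Q (Suc i))"
      unfolding b' by (simp add: lift8_def case_prod_beta P_def Q_def)
    ultimately show ?thesis
      using step[of i] by simp
  qed
  have "r \<noteq> 3"
    by (rule closed_walk_ne_3[of U W r P Q b]) (use neq per perPQ b_def b' Q' in blast)+
  moreover have "r \<noteq> 1"
    using per(1)[of 0] neq(1)[of 0] by auto
  moreover have "r \<noteq> 2"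
    by (rule closed_walk_ne_2[of U W r P]) (use neq per perPQ b' in \<open>simp_all flip: b_def\<close>)
  ultimately show ?thesis
    using r by linarith
qed

lemma girth_lift12:
  assumes "Z \<subseteq> (F - {0}) \<times> (F - {0}) \<times> F \<times> F \<times> F \<times> F" "Z \<noteq> {}"
    "even_set lift_graph.point (lift_graph.line lift12) Z" and two: "(2 :: 'a) \<noteq> 0"
  shows "2 * 6 \<le> card Z"
proof -
  interpret lift_graph "F - {0}" "F \<times> F \<times> F \<times> F" lift12
    by (rule lift_graph_finite_subring[OF F]) (use F_facts bij_lift12[OF F(1)] in auto)
  obtain r :: nat and U W :: "nat \<Rightarrow> 'a" and B :: "nat \<Rightarrow> 'a \<times> 'a \<times> 'a \<times> 'a" where r: "r > 0" "2 * r \<le> card Z"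
    and per: "\<And>i. U (i + r) = U i" "\<And>i. W (i + r) = W i" "\<And>i. B (i + r) = B i"
    and neq: "\<And>i. U i \<noteq> U (Suc i)" "\<And>i. W i \<noteq> W (Suc i)"
    and step: "\<And>i. lift12 (U i) (W i) (B i) = lift12 (U (Suc i)) (W i) (B (Suc i))"
  proof (rule even_set_closed_walk[OF assms(1-3)], goal_cases)
    case (1 r U W B)
    from 1(2-) show ?case
      by (rule 1(1))
  qed
  define P Q R S where "P i = fst (B i)" and "Q i = fst (snd (B i))" and "R i = fst (snd (snd (B i)))"
    and "S i = snd (snd (snd (B i)))" for i
  define b where "b i = U i * W i - P i" for i
  define c where "c i = U i * b i - Q i" for i
  have perB: "P (i + r) = P i" "Q (i + r) = Q i" "R (i + r) = R i" "S (i + r) = S i" for i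
    using per(3) by (simp_all add: P_def Q_def R_def S_def)
  have B: "B i = (P i, Q i, R i, S i)" for i
    by (simp add: P_def Q_def R_def S_def)
  have lift: "lift12 (U i) (W i) (B i) = (b i, c i, U i * c i - R i, U i * (W i * c i - b i * b i) - S i)" for i
    unfolding B by (simp add: lift12_def Let_def b_def c_def)
  have b': "b i = U (Suc i) * W i - P (Suc i)" for i
    using step[of i] unfolding B by (simp add: lift12_def Let_def b_def)
  have c': "c i = U (Suc i) * b i - Q (Suc i)" for i
    using step[of i] unfolding lift B[of "Suc i"] by (simp add: lift12_def Let_def flip: b')
  have "lift12 (U (Suc i)) (W i) (B (Suc i)) =
      (b i, c i, U (Suc i) * c i - R (Suc i), U (Suc i) * (W i * c i - b i * b i) - S (Suc i))" for i
    unfolding B lift12_def Let_def by (simp flip: b' c')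
  then have R: "U i * c i - R i = U (Suc i) * c i - R (Suc i)"
    and S: "U i * (W i * c i - b i * b i) - S i = U (Suc i) * (W i * c i - b i * b i) - S (Suc i)" for i
    using step[of i] lift[of i] by simp_all
  interpret hexagon_walk U W b c P Q R S r
    using neq per(1,2) perB b_def b' c_def c' R S two by unfold_locales
  have "r \<noteq> 1"
    using per(1)[of 0] neq(1)[of 0] by auto
  moreover have "r \<noteq> 2"
    by (rule closed_walk_ne_2[of U W r P]) (use neq per perB b' in \<open>simp_all flip: b_def\<close>)
  ultimately show ?thesis
    using r length_ne_3 length_ne_4 length_ne_5 by linarith
qed

end

section \<open>The approximation ratio\<close>

lemma (in lift_graph) alpha_ge_lift:
  assumes "k \<ge> 1" "n \<ge> 3" "card F ^ 2 * card A \<le> n"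
    and "\<And>Z. Z \<subseteq> F \<times> F \<times> A \<Longrightarrow> Z \<noteq> {} \<Longrightarrow> even_set point line Z \<Longrightarrow> 2 * k \<le> card Z"
  shows "ereal (real (card F) / (2 * real k)) \<le> alpha k n"
proof (rule alpha_ge_of_girth[OF assms(1,2) _ assms(4)])
  show "card (F \<times> F \<times> A) \<le> n"
    using assms(3) by (simp add: card_cartesian_product power2_eq_square mult.assoc)
qed

lemma alpha_ge_power_3:
  assumes k: "k \<in> {3, 4, 6}" and s: "s > 0" and n: "3 ^ (s * k) \<le> n"
  shows "ereal ((3 ^ s - 1) / (2 * real k)) \<le> alpha k n"
proof -
  obtain F :: "Enum.finite_3 alg_closure set" where F: "finite_subring F" "card F = 3 ^ s"
    by (rule finite_subring_of_power_3[OF s])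
  have finF: "finite F" and F0: "F \<noteq> {}"
    using F(1) finite_subring_0[OF F(1)] by (auto simp: finite_subring_def)
  have cF: "card (F - {0}) = 3 ^ s - 1"
    using F finite_subring_0[OF F(1)] finF by simp
  then have ev: "even (card (F - {0}))"
    by simp
  have real: "real (card (F - {0})) = 3 ^ s - 1"
    unfolding cF by (simp add: of_nat_diff)
  note two = two_neq_0_finite_3_alg_closure
  have "(3::nat) ^ 1 \<le> 3 ^ (s * k)"
    using s k by (intro power_increasing) auto
  then have n3: "n \<ge> 3"
    using n by simp
  \<comment> \<open>The fibre of the lift is a power of \<open>F\<close> with \<open>k - 2\<close>
    factors.\<close>
  have size: "card (F - {0}) ^ 2 * card F ^ (k - 2) \<le> n"
  proof -
    have "card (F - {0}) ^ 2 * card F ^ (k - 2) \<le> (3 ^ s) ^ 2 * (3 ^ s) ^ (k - 2)"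
      unfolding cF F(2) by (intro mult_right_mono power_mono) auto
    also have "\<dots> = (3 ^ s) ^ (2 + (k - 2))"
      by (rule power_add[symmetric])
    also have "2 + (k - 2) = k"
      using k by auto
    finally show ?thesis
      using n by (simp add: power_mult)
  qed
  consider "k = 3" | "k = 4" | "k = 6"
    using k by blast
  then have "ereal (real (card (F - {0})) / (2 * real k)) \<le> alpha k n"
  proof cases
    case 1
    interpret lift_graph "F - {0}" F lift6
      by (rule lift_graph_finite_subring[OF F(1) ev finF F0 bij_lift6[OF F(1)]])
    show ?thesis
      unfolding 1 by (rule alpha_ge_lift[OF _ n3 _ girth_lift6[OF F(1) ev]]) (use size 1 in simp_all)
  next
    case 2
    interpret lift_graph "F - {0}" "F \<times> F" lift8
      by (rule lift_graph_finite_subring[OF F(1) ev _ _ bij_lift8[OF F(1)]]) (use finF F0 in auto)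
    show ?thesis
      unfolding 2 by (rule alpha_ge_lift[OF _ n3 _ girth_lift8[OF F(1) ev]])
        (use size 2 in \<open>simp_all add: card_cartesian_product power2_eq_square\<close>)
  next
    case 3
    interpret lift_graph "F - {0}" "F \<times> F \<times> F \<times> F" lift12
      by (rule lift_graph_finite_subring[OF F(1) ev _ _ bij_lift12[OF F(1)]]) (use finF F0 in auto)
    show ?thesis
      unfolding 3 by (rule alpha_ge_lift[OF _ n3 _ girth_lift12[OF F(1) ev _ _ _ two]])
        (use size 3 in \<open>simp_all add: card_cartesian_product power2_eq_square eval_nat_numeral mult_ac\<close>)
  qed
  then show ?thesis
    unfolding real .
qed

text \<open>For the largest \<open>s\<close> with \<open>3 ^ (s * k) \<le> n\<close> the
  \<open>k\<close>-th root of \<open>n\<close> is at most \<open>3 * 3 ^ s\<close>. The bound on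
  \<open>n\<close> gives \<open>s \<ge> 1\<close>, so \<open>3 ^ s - 1\<close> is at least two
  thirds of \<open>3 ^ s\<close>; together this yields the constant
  \<open>1 / (9 * k)\<close>.\<close>

theorem alpha_lower_bound:
  assumes k: "k \<in> {3, 4, 6}" and n: "3 ^ k \<le> n"
  shows "ereal (1 / (9 * real k) * root k (real n)) \<le> alpha k n"
proof -
  have k0: "k > 0"
    using k by auto
  have "n < 3 ^ (n * k)"
  proof -
    have "n < 3 ^ n"
      by (rule less_exp[THEN less_le_trans]) (simp add: power_mono)
    also have "(3::nat) ^ n \<le> 3 ^ (n * k)"
      using k0 by (intro power_increasing) auto
    finally show ?thesis .
  qed
  then have ex: "\<exists>s. n < 3 ^ (s * k)"
    by blast
  define s' where "s' = (LEAST s. n < 3 ^ (s * k))"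
  have s': "n < 3 ^ (s' * k)"
    unfolding s'_def by (rule LeastI_ex[OF ex])
  obtain s where s: "s' = Suc s"
    using s' n by (cases s') auto
  have "\<not> n < 3 ^ (s * k)"
    using s not_less_Least[of s "\<lambda>s. n < 3 ^ (s * k)"] unfolding s'_def by simp
  then have le: "3 ^ (s * k) \<le> n"
    by simp
  have s0: "s > 0"
  proof (rule ccontr)
    assume "\<not> s > 0"
    then have "n < 3 ^ k"
      using s' s by simp
    then show False
      using n by simp
  qed
  have "real n < (3 * 3 ^ s) ^ k"
  proof -
    have "real n < real (3 ^ (s' * k))"
      using s' by (rule of_nat_less_iff[THEN iffD2])
    also have "\<dots> = (3 * 3 ^ s) ^ k"
      unfolding s by (simp add: power_add power_mult power_mult_distrib)
    finally show ?thesis .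
  qed
  then have "root k (real n) \<le> root k ((3 * 3 ^ s) ^ k)"
    using k0 by simp
  also have "\<dots> = 3 * 3 ^ s"
    by (rule real_root_power_cancel) (use k0 in simp_all)
  finally have rt: "root k (real n) \<le> 3 * 3 ^ s" .
  have "(3::real) ^ 1 \<le> 3 ^ s"
    using s0 by (intro power_increasing) auto
  then have "1 / (9 * real k) * root k (real n) \<le> (3 ^ s - 1) / (2 * real k)"
    using rt k0 by (simp add: divide_simps mult.commute)
  then show ?thesis
    using alpha_ge_power_3[OF k s0 le] by (meson ereal_less_eq(3) order_trans)
qed

theorem theorem5p1:
  fixes k :: nat
  assumes "k \<in> {3, 4, 6}"
  shows "\<exists>c1 c2 :: real. c1 > 0 \<and> c2 > 0 \<and> (\<exists>N. \<forall>n\<ge>N.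
           ereal (c1 * root k (real n)) \<le> alpha k n \<and>
           alpha k n \<le> ereal (c2 * root k (real n)))"
proof -
  have "k \<ge> 2"
    using assms by auto
  then obtain C where C: "C > 0" "\<And>n. alpha k n \<le> ereal (C * root k (real n))"
    using alpha_upper_bound by blast
  moreover have "1 / (9 * real k) > 0"
    using \<open>k \<ge> 2\<close> by simp
  ultimately show ?thesis
    using alpha_lower_bound[OF assms] by blast
qed

end
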